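(* Let $R>0$ and let $\mathbf{f}\in L_2(B_R;\mathcal{A};\mathbb{R})$ be monogenic in $B_R$, with decomposition $\mathbf{f}=\mathbf{f}(0)+\mathbf{g}+\mathbf{h}$ as described in the context. Then for $0\le r<R$, $$\mathcal{M}(\mathbf{f},r)\le|\mathbf{f}(0)|+\frac{2r}{(R-r)^2}\Big(A_1(r,R)\sup_{|\xi|<R}|\mathbf{Sc}\{\mathbf{f}(\xi)\}|+A_2(r,R)\sup_{|\xi|<R}|\mathbf{Sc}\{\mathbf{h}(\xi)\mathbf{e}_1\}|\Big),$$ where $A_1(r,R)=\sqrt{\tfrac23}\,\frac{(3R-r)(3R^2-Rr+r^2)}{(R-r)^2}$ and $A_2(r,R)=2(2R-r)$.
   Context: Quaternions $\mathbb{H}$ have basis $1,\mathbf{e}_1,\mathbf{e}_2,\mathbf{e}_3$ with $\mathbf{e}_i^2=-1$, $\mathbf{e}_1\mathbf{e}_2=\mathbf{e}_3=-\mathbf{e}_2\mathbf{e}_1$, $\mathbf{e}_2\mathbf{e}_3=\mathbf{e}_1=-\mathbf{e}_3\mathbf{e}_2$, $\mathbf{e}_3\mathbf{e}_1=\mathbf{e}_2=-\mathbf{e}_1\mathbf{e}_3$. $\mathbf{Sc}(a_0+a_1\mathbf{e}_1+a_2\mathbf{e}_2+a_3\mathbf{e}_3)=a_0$, conjugation flips the signs of $a_1,a_2,a_3$, $|\cdot|$ is the Euclidean norm. Reduced quaternions: $\mathcal{A}=\mathrm{span}_\mathbb{R}\{1,\mathbf{e}_1,\mathbf{e}_2\}$,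 with $x=(x_0,x_1,x_2)\in\mathbb{R}^3$ identified with $x_0+x_1\mathbf{e}_1+x_2\mathbf{e}_2$. $D=\partial_{x_0}+\mathbf{e}_1\partial_{x_1}+\mathbf{e}_2\partial_{x_2}$, $\overline{D}=\partial_{x_0}-\mathbf{e}_1\partial_{x_1}-\mathbf{e}_2\partial_{x_2}$; an $\mathcal{A}$-valued $C^1$ function $\mathbf{f}$ is monogenic if $D\mathbf{f}=0$. $B_R$ is the open ball of radius $R$ centered at $0$; $L_2(B_R;\mathcal{A};\mathbb{R})$ carries the real inner product $\langle\mathbf{f},\mathbf{g}\rangle=\int_{B_R}\mathbf{Sc}(\overline{\mathbf{f}}\mathbf{g})\,dV$. $\mathcal{M}(\mathbf{f},r)=\max_{|x|=r}|\mathbf{f}(x)|$. Spherical coordinates $x_0=r\cos\theta_1$, $x_1=r\sin\theta_1\cos\theta_2$, $x_2=r\sin\theta_1\sin\theta_2$; $P^m_n(t)=(1-t^2)^{m/2}\frac{d^m}{dt^m}P_n(t)$ (associated Legendre), $T_k,U_k$ Chebyshev polynomials of first and second kind; $U^l_{n}=P^l_{n}(\cos\theta_1)T_l(\cos\theta_2)$, $V^m_{n}=P^m_{n}(\cos\theta_1)\sin\theta_2\,U_{m-1}(\cos\theta_2)$. Basis polynomials: $\mathbf{X}^{l,\dagger}_n:=\tfrac12\overline{D}(r^{n+1}U^l_{n+1})$, $l=0,\ldots,n+1$, $\mathbf{Y}^{m,\dagger}_n:=\tfrac12\overline{D}(r^{n+1}V^m_{n+1})$, $m=1,\ldots,n+1$;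 $\mathbf{X}^{l,\dagger,*_R}_n,\mathbf{Y}^{m,\dagger,*_R}_n$ denote them normalized to unit norm in $L_2(B_R;\mathcal{A};\mathbb{R})$. These normalized polynomials ($n\ge0$) form an orthonormal basis of the space of square-integrable monogenic $\mathcal{A}$-valued functions on $B_R$, so each such $\mathbf{f}$ has a Fourier expansion $\mathbf{f}=\sum_{n\ge0}\big[\mathbf{X}^{0,\dagger,*_R}_na^{0,*_R}_n+\sum_{m=1}^{n+1}(\mathbf{X}^{m,\dagger,*_R}_na^{m,*_R}_n+\mathbf{Y}^{m,\dagger,*_R}_nb^{m,*_R}_n)\big]$ with real coefficients. The decomposition is $\mathbf{f}=\mathbf{f}(0)+\mathbf{g}+\mathbf{h}$, where $\mathbf{h}=\sum_{n\ge1}\big[\mathbf{X}^{n+1,\dagger,*_R}_na^{n+1,*_R}_n+\mathbf{Y}^{n+1,\dagger,*_R}_nb^{n+1,*_R}_n\big]$ (the part along the hyperholomorphic constants, which depend only on $x_1,x_2$) and $\mathbf{g}=\sum_{n\ge1}\big[\mathbf{X}^{0,\dagger,*_R}_na^{0,*_R}_n+\sum_{m=1}^{n}(\mathbf{X}^{m,\dagger,*_R}_na^{m,*_R}_n+\mathbf{Y}^{m,\dagger,*_R}_nb^{m,*_R}_n)\big]$. *)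

theory Defs
  imports "HOL-Analysis.Analysis" "HOL-Computational_Algebra.Polynomial"
begin

type_synonym quat = "real^4"

definition qmult :: "quat \<Rightarrow> quat \<Rightarrow> quat" (infixl "\<otimes>q" 70) where
  "a \<otimes>q b = vector
     [a$1*b$1 - a$2*b$2 - a$3*b$3 - a$4*b$4,
      a$1*b$2 + a$2*b$1 + a$3*b$4 - a$4*b$3,
      a$1*b$3 - a$2*b$4 + a$3*b$1 + a$4*b$2,
      a$1*b$4 + a$2*b$3 - a$3*b$2 + a$4*b$1]"

definition qone :: quat where "qone = axis 1 1"
definition qe1 :: quat where "qe1 = axis 2 1"
definition qe2 :: quat where "qe2 = axis 3 1"
definition qe3 :: quat where "qe3 = axis 4 1"

definition Sc :: "quat \<Rightarrow> real" where "Sc a = a$1"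

definition qcnj :: "quat \<Rightarrow> quat" where
  "qcnj a = vector [a$1, - a$2, - a$3, - a$4]"

text \<open>Reduced quaternions A = span{1,e1,e2}: the e3-component vanishes.\<close>
definition in_A :: "quat \<Rightarrow> bool" where "in_A a \<longleftrightarrow> a$4 = 0"

text \<open>Points x = (x0,x1,x2) of R^3 are real^3 with x0 = x$1, x1 = x$2, x2 = x$3.\<close>

definition partial :: "3 \<Rightarrow> (real^3 \<Rightarrow> 'b::real_normed_vector) \<Rightarrow> real^3 \<Rightarrow> 'b" where
  "partial i F x = frechet_derivative F (at x) (axis i 1)"

definition Dop :: "(real^3 \<Rightarrow> quat) \<Rightarrow> real^3 \<Rightarrow> quat" where
  "Dop f x = partial 1 f x + qe1 \<otimes>q partial 2 f x + qe2 \<otimes>q partial 3 f x"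

definition Dbar_real :: "(real^3 \<Rightarrow> real) \<Rightarrow> real^3 \<Rightarrow> quat" where
  "Dbar_real F x = partial 1 F x *\<^sub>R qone - partial 2 F x *\<^sub>R qe1 - partial 3 F x *\<^sub>R qe2"

definition monogenic_on_ball :: "real \<Rightarrow> (real^3 \<Rightarrow> quat) \<Rightarrow> bool" where
  "monogenic_on_ball R f \<longleftrightarrow>
     (\<forall>x\<in>ball 0 R. in_A (f x)) \<and>
     (\<forall>x\<in>ball 0 R. f differentiable (at x)) \<and>
     (\<forall>i. continuous_on (ball 0 R) (partial i f)) \<and>
     (\<forall>x\<in>ball 0 R. Dop f x = 0)"

definition in_L2_ball :: "real \<Rightarrow> (real^3 \<Rightarrow> quat) \<Rightarrow> bool" where
  "in_L2_ball R f \<longleftrightarrow>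
     (\<forall>x\<in>ball 0 R. in_A (f x)) \<and>
     set_borel_measurable lborel (ball 0 R) f \<and>
     set_integrable lborel (ball 0 R) (\<lambda>x. (norm (f x))\<^sup>2)"

definition L2_inner :: "real \<Rightarrow> (real^3 \<Rightarrow> quat) \<Rightarrow> (real^3 \<Rightarrow> quat) \<Rightarrow> real" where
  "L2_inner R f g = (LINT x:ball 0 R|lborel. Sc (qcnj (f x) \<otimes>q g x))"

definition L2_norm :: "real \<Rightarrow> (real^3 \<Rightarrow> quat) \<Rightarrow> real" where
  "L2_norm R f = sqrt (L2_inner R f f)"

text \<open>Legendre polynomial via Rodrigues' formula.\<close>
definition legendreP :: "nat \<Rightarrow> real poly" where
  "legendreP n = smult (1 / (2 ^ n * fact n)) ((pderiv ^^ n) ([:-1, 0, 1:] ^ n))"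

definition assoc_legendre :: "nat \<Rightarrow> nat \<Rightarrow> real \<Rightarrow> real" where
  "assoc_legendre m n t = sqrt (1 - t\<^sup>2) ^ m * poly ((pderiv ^^ m) (legendreP n)) t"

fun chebyT :: "nat \<Rightarrow> real \<Rightarrow> real" where
  "chebyT 0 t = 1"
| "chebyT (Suc 0) t = t"
| "chebyT (Suc (Suc k)) t = 2 * t * chebyT (Suc k) t - chebyT k t"

fun chebyU :: "nat \<Rightarrow> real \<Rightarrow> real" where
  "chebyU 0 t = 1"
| "chebyU (Suc 0) t = 2 * t"
| "chebyU (Suc (Suc k)) t = 2 * t * chebyU (Suc k) t - chebyU k t"

text \<open>x0 = r cos th1, x1 = r sin th1 cos th2, x2 = r sin th1 sin th2, with th1 in [0,pi].
  On the x0-axis (where th2 is undetermined) we take th2 = 0; the solid harmonics below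
  do not depend on this choice.\<close>
definition cos_th1 :: "real^3 \<Rightarrow> real" where "cos_th1 x = x$1 / norm x"
definition rho :: "real^3 \<Rightarrow> real" where "rho x = sqrt ((x$2)\<^sup>2 + (x$3)\<^sup>2)"
definition cos_th2 :: "real^3 \<Rightarrow> real" where
  "cos_th2 x = (if rho x = 0 then 1 else x$2 / rho x)"
definition sin_th2 :: "real^3 \<Rightarrow> real" where
  "sin_th2 x = (if rho x = 0 then 0 else x$3 / rho x)"

definition solidU :: "nat \<Rightarrow> nat \<Rightarrow> real^3 \<Rightarrow> real" where
  "solidU n l x = norm x ^ n * (assoc_legendre l n (cos_th1 x) * chebyT l (cos_th2 x))"
definition solidV :: "nat \<Rightarrow> nat \<Rightarrow> real^3 \<Rightarrow> real" where
  "solidV n m x = norm x ^ n * (assoc_legendre m n (cos_th1 x) * sin_th2 x * chebyU (m - 1) (cos_th2 x))"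

definition Xdag :: "nat \<Rightarrow> nat \<Rightarrow> real^3 \<Rightarrow> quat" where
  "Xdag l n = (\<lambda>x. (1/2) *\<^sub>R Dbar_real (solidU (n+1) l) x)"
definition Ydag :: "nat \<Rightarrow> nat \<Rightarrow> real^3 \<Rightarrow> quat" where
  "Ydag m n = (\<lambda>x. (1/2) *\<^sub>R Dbar_real (solidV (n+1) m) x)"

definition Xdag_n :: "real \<Rightarrow> nat \<Rightarrow> nat \<Rightarrow> real^3 \<Rightarrow> quat" where
  "Xdag_n R l n = (\<lambda>x. (1 / L2_norm R (Xdag l n)) *\<^sub>R Xdag l n x)"
definition Ydag_n :: "real \<Rightarrow> nat \<Rightarrow> nat \<Rightarrow> real^3 \<Rightarrow> quat" where
  "Ydag_n R m n = (\<lambda>x. (1 / L2_norm R (Ydag m n)) *\<^sub>R Ydag m n x)"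

definition coef_a :: "real \<Rightarrow> (real^3 \<Rightarrow> quat) \<Rightarrow> nat \<Rightarrow> nat \<Rightarrow> real" where
  "coef_a R f l n = L2_inner R (Xdag_n R l n) f"
definition coef_b :: "real \<Rightarrow> (real^3 \<Rightarrow> quat) \<Rightarrow> nat \<Rightarrow> nat \<Rightarrow> real" where
  "coef_b R f m n = L2_inner R (Ydag_n R m n) f"

definition hpart :: "real \<Rightarrow> (real^3 \<Rightarrow> quat) \<Rightarrow> real^3 \<Rightarrow> quat" where
  "hpart R f x = (\<Sum>k. let n = Suc k in
       coef_a R f (n+1) n *\<^sub>R Xdag_n R (n+1) n x + coef_b R f (n+1) n *\<^sub>R Ydag_n R (n+1) n x)"

definition maxmod :: "(real^3 \<Rightarrow> quat) \<Rightarrow> real \<Rightarrow> real" where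
  "maxmod f r = (SUP x\<in>sphere 0 r. norm (f x))"

definition A1 :: "real \<Rightarrow> real \<Rightarrow> real" where
  "A1 r R = sqrt (2/3) * ((3*R - r) * (3*R\<^sup>2 - R*r + r\<^sup>2)) / (R - r)\<^sup>2"
definition A2 :: "real \<Rightarrow> real \<Rightarrow> real" where
  "A2 r R = 2 * (2*R - r)"

end

theory Submission
  imports Defs "HOL-Complex_Analysis.Complex_Analysis"
begin

text \<open>A monogenic reduced-quaternion function is a Riesz system, so its components are harmonic
  and expand into homogeneous harmonic polynomials. The sectoral part $h$ is holomorphic in
  $z = x_1 + i x_2$, and the Borel--Caratheodory argument bounds it by its component
  $Sc (h e_1)$. The homogeneous parts of $g$ are determined by those of $Sc f$: estimates of homogeneous harmonic
  polynomials in terms of their $L^2$ norms bound the degree-$n$ part by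
  $\sqrt{2/3}\,(n+1)(n+2)(2n+1)\,(r/R)^n \sup |Sc f|$, and summing the series gives $A_1$.\<close>

text \<open>The hypothesis provides a C^1 function, so no Laplacian can be formed at the outset.
  Everything is therefore phrased through solid averages with weights \<open>(1 - |y|^2)^k\<close>.
  The weight vanishes on the sphere, so integration by parts has no boundary term, and first
  derivatives suffice to turn the Riesz system into a mean value property. Smoothness comes from
  that property, and only then the Laplace equation.

  The vector part is packed into F = f_1 - i f_2. With V = Sc f the system reads (d_1 + i d_2) F =
  d_0 V and d_0 F = - (d_1 - i d_2) V. So V determines F up to a holomorphic function of z, and this
  ambiguity is what h captures.

  The cubic factor sqrt(2/3) (n+1)(n+2)(2n+1) is reached as a majorant. On the disc x_0 = 0 a Taylor
  part costs \<open>grad_const n / 2\<close>; another 8.35 per degree is held in reserve. Its total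
  8.35 r / (R - r) pays for V itself and for leaving the disc, because sqrt 15 + 2 sqrt 5 <=
  8.35.\<close>

no_notation fps_nth (infixl \<open>$\<close> 75)

section \<open>Gradients and integrals over the unit ball\<close>

text \<open>Values are complex so that f_1 - i f_2 and powers of z are covered. The gradient is an
  explicit coefficient family, so that product and chain rules are read off coordinate by
  coordinate.\<close>

definition has_grad :: "(real^3 \<Rightarrow> complex) \<Rightarrow> (3 \<Rightarrow> complex) \<Rightarrow> real^3 \<Rightarrow> bool" where
  "has_grad v g x \<longleftrightarrow> (v has_derivative (\<lambda>h. \<Sum>j\<in>UNIV. of_real (h$j) * g j)) (at x)"

lemma has_gradD: "has_grad v g x \<Longrightarrow> (v has_derivative (\<lambda>h. \<Sum>j\<in>UNIV. of_real (h$j) * g j)) (at x)"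
  by (simp add: has_grad_def)

lemma has_grad_eq: "has_grad v g x \<Longrightarrow> (\<And>j. g j = g' j) \<Longrightarrow> has_grad v g' x"
  by (simp add: has_grad_def)

lemma has_grad_partial:
  assumes "has_grad v g x" shows "partial j v x = g j"
proof -
  have "frechet_derivative v (at x) = (\<lambda>h. \<Sum>j\<in>UNIV. of_real (h$j) * g j)"
    using frechet_derivative_at[OF has_gradD[OF assms]] by simp
  then have "partial j v x = (\<Sum>i\<in>UNIV. of_real ((axis j 1 :: real^3)$i) * g i)"
    by (simp add: partial_def)
  also have "\<dots> = (\<Sum>i\<in>UNIV. if i = j then g i else 0)"
    by (rule sum.cong) (auto simp: axis_def)
  finally show ?thesis by simp
qed

lemma has_grad_unique: "has_grad v g x \<Longrightarrow> has_grad v g' x \<Longrightarrow> g j = g' j"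
  using has_grad_partial by metis

lemma has_grad_cong_open:
  assumes "has_grad v g x" "open S" "x \<in> S" "\<And>y. y \<in> S \<Longrightarrow> v y = w y"
  shows "has_grad w g x"
  using assms unfolding has_grad_def by (blast intro: has_derivative_transform_within_open)

text \<open>No differentiability is assumed: locally equal functions have the same set of
  derivatives at the point, so the choice inside \<open>frechet_derivative\<close> returns the same
  value.\<close>

lemma partial_cong_open:
  assumes "open S" "x \<in> S" "\<And>y. y \<in> S \<Longrightarrow> v y = w y"
  shows "partial j v x = partial j w x"
proof -
  have "(v has_derivative D) (at x) \<longleftrightarrow> (w has_derivative D) (at x)" for D
    using has_derivative_transform_within_open[OF _ assms(1,2)] assms(3) by metis
  then show ?thesis by (simp add: partial_def frechet_derivative_def)
qed

lemma has_grad_isCont: "has_grad v g x \<Longrightarrow> isCont v x"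
  unfolding has_grad_def by (rule has_derivative_continuous)

lemma has_grad_imp_continuous_on: "(\<And>x. x \<in> S \<Longrightarrow> has_grad v (g x) x) \<Longrightarrow> continuous_on S v"
  by (meson continuous_at_imp_continuous_on has_grad_isCont)

lemma has_grad_const: "has_grad (\<lambda>x. c) (\<lambda>j. 0) x"
  by (simp add: has_grad_def)

lemma has_grad_add: "has_grad v g x \<Longrightarrow> has_grad w h x \<Longrightarrow> has_grad (\<lambda>x. v x + w x) (\<lambda>j. g j + h j) x"
  unfolding has_grad_def
  by (auto intro!: derivative_eq_intros simp: fun_eq_iff algebra_simps sum.distrib)

lemma has_grad_mult: "has_grad v g x \<Longrightarrow> has_grad w h x \<Longrightarrow>
    has_grad (\<lambda>x. v x * w x) (\<lambda>j. v x * h j + g j * w x) x"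
  unfolding has_grad_def
  by (auto intro!: derivative_eq_intros simp: fun_eq_iff algebra_simps sum.distrib sum_distrib_left)

lemma has_grad_cmult: "has_grad v g x \<Longrightarrow> has_grad (\<lambda>x. c * v x) (\<lambda>j. c * g j) x"
  using has_grad_mult[OF has_grad_const[of c], of v g x] by simp

lemma has_grad_cnj: "has_grad v g x \<Longrightarrow> has_grad (\<lambda>x. cnj (v x)) (\<lambda>j. cnj (g j)) x"
  unfolding has_grad_def
  by (auto intro!: derivative_eq_intros simp: fun_eq_iff)

lemma has_grad_sum: "(\<And>i. i \<in> I \<Longrightarrow> has_grad (v i) (g i) x) \<Longrightarrow>
    has_grad (\<lambda>x. \<Sum>i\<in>I. v i x) (\<lambda>j. \<Sum>i\<in>I. g i j) x"
  by (induction I rule: infinite_finite_induct) (auto intro: has_grad_const has_grad_add)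

lemma has_grad_coord: "has_grad (\<lambda>x. of_real (x$i)) (\<lambda>j. if j = i then 1 else 0) x"
proof -
  have "bounded_linear (\<lambda>x::real^3. complex_of_real (x$i))"
    by (intro bounded_linear_compose[OF bounded_linear_of_real] bounded_linear_vec_nth)
  then have "((\<lambda>x::real^3. complex_of_real (x$i)) has_derivative (\<lambda>x. complex_of_real (x$i))) (at x)"
    by (rule bounded_linear_imp_has_derivative)
  then show ?thesis by (simp add: has_grad_def if_distrib cong: if_cong)
qed

lemma has_grad_pow: "has_grad v g x \<Longrightarrow>
    has_grad (\<lambda>x. v x ^ n) (\<lambda>j. of_nat n * v x ^ (n - 1) * g j) x"
proof (induction n)
  case 0 then show ?case by (simp add: has_grad_const)
next
  case (Suc n)
  have "has_grad (\<lambda>x. v x * v x ^ n) (\<lambda>j. v x * (of_nat n * v x ^ (n - 1) * g j) + g j * v x ^ n) x"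
    by (rule has_grad_mult) (use Suc in auto)
  then show ?case
    by (rule_tac has_grad_eq) (simp, cases n, auto simp: algebra_simps)
qed

lemma has_grad_affine:
  assumes "has_grad v g (x + t *\<^sub>R y)"
  shows "has_grad (\<lambda>y. v (x + t *\<^sub>R y)) (\<lambda>j. of_real t * g j) y"
proof -
  have "((\<lambda>y. x + t *\<^sub>R y) has_derivative (\<lambda>h. t *\<^sub>R h)) (at y)"
    by (auto intro!: derivative_eq_intros)
  from has_derivative_compose[OF this has_gradD[OF assms]]
  show ?thesis
    by (simp add: has_grad_def o_def mult.assoc mult.left_commute)
qed

lemma has_grad_ray:
  assumes "has_grad v g (x + t *\<^sub>R y)"
  shows "((\<lambda>t. v (x + t *\<^sub>R y)) has_vector_derivative (\<Sum>j\<in>UNIV. of_real (y$j) * g j)) (at t)"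
proof -
  have "((\<lambda>t. x + t *\<^sub>R y) has_derivative (\<lambda>h. h *\<^sub>R y)) (at t)"
    by (auto intro!: derivative_eq_intros)
  from has_derivative_compose[OF this has_gradD[OF assms]]
  show ?thesis
    by (simp add: has_vector_derivative_def o_def scaleR_conv_of_real[where 'a=complex] sum_distrib_left mult.assoc)
qed

text \<open>The weight vanishing on the unit sphere. Its gradient is \<open>-2 y\<close>, so each
  integration by parts trades one power of it for a radial factor.\<close>

definition uc :: "real^3 \<Rightarrow> complex" where "uc y = of_real (1 - y \<bullet> y)"

lemma has_grad_uc: "has_grad uc (\<lambda>j. - 2 * of_real (y$j)) y"
proof -
  have "((\<lambda>y::real^3. complex_of_real (1 - y \<bullet> y)) has_derivative (\<lambda>h. of_real (- (y \<bullet> h + h \<bullet> y)))) (at y)"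
    by (auto intro!: derivative_eq_intros)
  then show ?thesis
    unfolding has_grad_def uc_def
    by (rule has_derivative_eq_rhs) (auto simp: inner_vec_def fun_eq_iff sum_negf sum_distrib_left algebra_simps simp flip: sum.distrib)
qed

lemma continuous_on_uc[continuous_intros]: "continuous_on S uc"
  unfolding uc_def by (intro continuous_intros)

text \<open>Supplies the constant dominating the difference quotients in
  \<open>bint_by_parts\<close>: continuous partials are bounded on the compact ball, and convexity
  integrates that bound.\<close>

lemma has_grad_lipschitz:
  assumes der: "\<And>y. y \<in> cball 0 1 \<Longrightarrow> has_grad B (\<lambda>j. dB j y) y"
    and cont: "\<And>j. continuous_on (cball 0 1) (dB j)"
  obtains L where "L \<ge> 0" "\<And>x y. x \<in> cball 0 1 \<Longrightarrow> y \<in> cball 0 1 \<Longrightarrow> norm (B x - B y) \<le> L * norm (x - y)"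
proof -
  have "\<exists>M. \<forall>y\<in>cball 0 1. norm (dB j y) \<le> M" for j
    using compact_continuous_image[OF cont[of j] compact_cball]
    by (meson bounded_iff compact_imp_bounded image_eqI)
  then obtain M where M: "\<And>j y. y \<in> cball 0 1 \<Longrightarrow> norm (dB j y) \<le> M j" by metis
  define L where "L = (\<Sum>j\<in>UNIV. \<bar>M j\<bar>)"
  have L0: "L \<ge> 0" by (simp add: L_def sum_nonneg)
  have on: "onorm (\<lambda>h::real^3. \<Sum>j\<in>UNIV. of_real (h$j) * dB j y) \<le> L" if "y \<in> cball 0 1" for y
  proof (rule onorm_le)
    fix h :: "real^3"
    have "norm (\<Sum>j\<in>UNIV. of_real (h$j) * dB j y) \<le> (\<Sum>j\<in>UNIV. \<bar>M j\<bar> * norm h)"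
    proof (rule sum_norm_le)
      fix j :: 3
      have "\<bar>h$j\<bar> * norm (dB j y) \<le> norm h * \<bar>M j\<bar>"
        using M[OF that, of j] component_le_norm_cart[of h j] by (intro mult_mono) auto
      then show "norm (of_real (h$j) * dB j y) \<le> \<bar>M j\<bar> * norm h" by (simp add: norm_mult mult.commute)
    qed
    then show "norm (\<Sum>j\<in>UNIV. of_real (h$j) * dB j y) \<le> L * norm h" by (simp add: L_def sum_distrib_right)
  qed
  have "norm (B x - B y) \<le> L * norm (x - y)" if x: "x \<in> cball 0 1" and y: "y \<in> cball 0 1" for x y
  proof (rule differentiable_bound[OF convex_cball _ _ x y])
    show "(B has_derivative (\<lambda>h. \<Sum>j\<in>UNIV. of_real (h$j) * dB j z)) (at z within cball 0 1)" if "z \<in> cball 0 1" for z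
      by (rule has_derivative_at_withinI[OF has_gradD[OF der[OF that]]])
  qed (rule on)
  with L0 show ?thesis by (rule that)
qed

section \<open>Integration over the unit ball of R^3\<close>

definition bint :: "(real^3 \<Rightarrow> 'a::{banach, second_countable_topology}) \<Rightarrow> 'a" where
  "bint g = (LINT y:ball 0 1|lborel. g y)"

abbreviation cb :: "(real^3 \<Rightarrow> 'a::real_normed_vector) \<Rightarrow> bool" where
  "cb g \<equiv> continuous_on (cball 0 1) g"

lemma cb_integrable:
  fixes g :: "real^3 \<Rightarrow> 'a::{banach, second_countable_topology}"
  assumes "cb g" shows "set_integrable lborel (ball 0 1) g"
proof -
  have "set_integrable lborel (cball 0 1) g"
    using borel_integrable_compact[OF compact_cball assms]
    by (simp add: set_integrable_def indicator_scaleR_eq_if)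
  then show ?thesis by (rule set_integrable_subset) auto
qed

lemma bint_cong: "(\<And>y. norm y < 1 \<Longrightarrow> f y = g y) \<Longrightarrow> bint f = bint g"
  unfolding bint_def by (rule set_lebesgue_integral_cong) auto

lemma bint_add: "cb f \<Longrightarrow> cb g \<Longrightarrow> bint (\<lambda>y. f y + g y) = bint f + bint g"
  unfolding bint_def by (rule set_integral_add) (auto intro: cb_integrable)

lemma bint_diff: "cb f \<Longrightarrow> cb g \<Longrightarrow> bint (\<lambda>y. f y - g y) = bint f - bint g"
  unfolding bint_def by (rule set_integral_diff) (auto intro: cb_integrable)

lemma bint_cmult: "bint (\<lambda>y. c * f y) = c * bint f" for c :: "'a::{real_normed_field, banach, second_countable_topology}"
  unfolding bint_def by (rule set_integral_mult_right)

lemma bint_cmult_right: "bint (\<lambda>y. f y * c) = bint f * c" for c :: "'a::{real_normed_field, banach, second_countable_topology}"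
  unfolding bint_def by (rule set_integral_mult_left)

lemma bint_sum: "finite I \<Longrightarrow> (\<And>i. i \<in> I \<Longrightarrow> cb (f i)) \<Longrightarrow> bint (\<lambda>y. \<Sum>i\<in>I. f i y) = (\<Sum>i\<in>I. bint (f i))"
proof (induction I rule: finite_induct)
  case empty then show ?case by (simp add: bint_def)
next
  case (insert a I) then show ?case by (simp add: bint_add continuous_on_sum)
qed

lemma bint_of_real: "bint (\<lambda>y. complex_of_real (g y)) = of_real (bint g)"
  unfolding bint_def by (rule set_integral_complex_of_real)

lemma bint_norm_le:
  fixes g :: "real^3 \<Rightarrow> 'a::{banach, second_countable_topology}"
  assumes "cb g" shows "norm (bint g) \<le> bint (\<lambda>y. norm (g y))"
  unfolding bint_def by (rule set_integral_norm_bound) (rule cb_integrable[OF assms])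

lemma bint_mono:
  fixes f g :: "real^3 \<Rightarrow> real"
  assumes "cb f" "cb g" "\<And>y. norm y < 1 \<Longrightarrow> f y \<le> g y" shows "bint f \<le> bint g"
  unfolding bint_def using assms by (intro set_integral_mono cb_integrable) auto

text \<open>The volume of the unit ball, which cancels from the bounds on Taylor parts and
  gradients.\<close>

definition W0 :: real where "W0 = bint (\<lambda>y. 1)"

lemma W0_pos: "W0 > 0"
proof -
  have "W0 = measure lborel (ball (0::real^3) 1)"
    by (simp add: W0_def bint_def set_lebesgue_integral_def)
  also have "\<dots> > 0" using content_ball_pos[of 1 "0::real^3"] by simp
  finally show ?thesis .
qed

lemma bint_const: "bint (\<lambda>y. c) = of_real W0 * (c::complex)"
  using bint_cmult_right[of "\<lambda>y. 1" c] bint_of_real[of "\<lambda>y. 1"] by (simp add: W0_def)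

lemma bint_const_real: "bint (\<lambda>y. c) = W0 * (c::real)"
  using bint_cmult_right[of "\<lambda>y. 1" c]  by (simp add: W0_def)

lemma bint_bound:
  fixes g :: "real^3 \<Rightarrow> 'a::{banach, second_countable_topology}"
  assumes "cb g" "\<And>y. norm y < 1 \<Longrightarrow> norm (g y) \<le> K" shows "norm (bint g) \<le> W0 * K"
proof -
  have "norm (bint g) \<le> bint (\<lambda>y. norm (g y))" by (rule bint_norm_le) fact
  also have "\<dots> \<le> bint (\<lambda>y. K)" using assms by (intro bint_mono continuous_intros) auto
  finally show ?thesis by (simp add: bint_const_real)
qed

lemma lborel_shift_integral:
  fixes f :: "real^3 \<Rightarrow> 'a::{banach, second_countable_topology}"
  assumes "f \<in> borel_measurable borel"
  shows "(LINT y|lborel. f (y + a)) = (LINT y|lborel. f y)"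
proof -
  have "(LINT y|lborel. f y) = (LINT y|distr lborel borel ((+) a). f y)" by (simp add: lborel_distr_plus)
  also have "\<dots> = (LINT y|lborel. f (a + y))"
    using assms by (simp add: integral_distr)
  finally show ?thesis by (simp add: add.commute)
qed


lemma lborel_integrable_shift:
  fixes f :: "real^3 \<Rightarrow> 'a::{banach, second_countable_topology}"
  assumes "integrable lborel f"
  shows "integrable lborel (\<lambda>y. f (y + a))"
proof -
  have "integrable (distr lborel borel ((+) a)) f" using assms by (simp add: lborel_distr_plus)
  then have "integrable lborel (\<lambda>y. f (a + y))" by (rule integrable_distr[rotated]) simp
  then show ?thesis by (simp add: add.commute)
qed

text \<open>Recasts the derivative as a limit of difference quotients, the shape in which sequential
  dominated convergence can be applied.\<close>

lemma has_vector_derivative_tendsto: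
  fixes f :: "real \<Rightarrow> 'a::real_normed_vector"
  shows "(f has_vector_derivative d) (at t within S) \<longleftrightarrow> ((\<lambda>s. (f s - f t) /\<^sub>R (s - t)) \<longlongrightarrow> d) (at t within S)"
proof -
  have "((\<lambda>s. (f s - f t) /\<^sub>R (s - t)) \<longlongrightarrow> d) (at t within S) \<longleftrightarrow>
        ((\<lambda>s. norm ((f s - f t) /\<^sub>R (s - t) - d)) \<longlongrightarrow> 0) (at t within S)"
    by (subst Lim_null) (simp only: tendsto_norm_zero_iff)
  also have "\<dots> \<longleftrightarrow> ((\<lambda>s. norm (((f s - f t) - (s - t) *\<^sub>R d) /\<^sub>R norm (s - t))) \<longlongrightarrow> 0) (at t within S)"
  proof (rule filterlim_cong[OF refl refl])
    have "norm ((f s - f t) /\<^sub>R (s - t) - d) = norm (((f s - f t) - (s - t) *\<^sub>R d) /\<^sub>R norm (s - t))"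
      if "s \<noteq> t" for s
    proof -
      have "(f s - f t) /\<^sub>R (s - t) - d = ((f s - f t) - (s - t) *\<^sub>R d) /\<^sub>R (s - t)"
        using that by (simp add: scaleR_diff_right)
      also have "norm \<dots> = norm (((f s - f t) - (s - t) *\<^sub>R d) /\<^sub>R norm (s - t))"
        unfolding norm_scaleR by simp
      finally show ?thesis .
    qed
    then show "\<forall>\<^sub>F s in at t within S. norm ((f s - f t) /\<^sub>R (s - t) - d) = norm (((f s - f t) - (s - t) *\<^sub>R d) /\<^sub>R norm (s - t))"
      by (simp add: eventually_at_filter)
  qed
  also have "\<dots> \<longleftrightarrow> (f has_vector_derivative d) (at t within S)"
    by (simp only: tendsto_norm_zero_iff has_vector_derivative_def has_derivative_at_within)
       (simp add: bounded_linear_scaleR_left)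
  finally show ?thesis by simp
qed

lemma sphere_null: "sphere (0::real^3) 1 \<in> null_sets lborel"
proof -
  have "sphere (0::real^3) 1 \<in> null_sets lebesgue"
    using negligible_sphere negligible_iff_null_sets by blast
  then show ?thesis by (simp add: null_sets_completion_iff)
qed

text \<open>Translation invariance makes the integral of every difference quotient of the Lipschitz
  function $B\,(1-|y|^2)_+^{k+1}$ vanish, and dominated convergence passes to the limit.\<close>

lemma bint_by_parts:
  assumes der: "\<And>y. y \<in> cball 0 1 \<Longrightarrow> has_grad B (\<lambda>j. dB j y) y"
    and cont: "\<And>j. cb (dB j)"
  shows "bint (\<lambda>y. dB j y * uc y ^ Suc k) = 2 * of_nat (Suc k) * bint (\<lambda>y. B y * of_real (y$j) * uc y ^ k)"
proof -
  define \<psi> where "\<psi> y = B y * uc y ^ Suc k" for y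
  define d\<psi> where "d\<psi> i y = dB i y * uc y ^ Suc k - 2 * of_nat (Suc k) * (B y * of_real (y$i) * uc y ^ k)" for i y
  have cB: "cb B" using der by (rule has_grad_imp_continuous_on)
  have g\<psi>: "has_grad \<psi> (\<lambda>i. d\<psi> i y) y" if "y \<in> cball 0 1" for y
    unfolding \<psi>_def d\<psi>_def
    by (rule has_grad_eq[OF has_grad_mult[OF der[OF that] has_grad_pow[OF has_grad_uc]]])
       (simp add: algebra_simps)
  have c\<psi>: "cb (d\<psi> i)" for i
    unfolding d\<psi>_def by (intro continuous_intros cont cB)
  obtain L where L: "L \<ge> 0" "\<And>x y. x \<in> cball 0 1 \<Longrightarrow> y \<in> cball 0 1 \<Longrightarrow> norm (\<psi> x - \<psi> y) \<le> L * norm (x - y)"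
    using has_grad_lipschitz[of \<psi> d\<psi>] g\<psi> c\<psi> by blast
  define \<phi> where "\<phi> y = (if norm y < 1 then \<psi> y else 0)" for y
  have \<psi>0: "\<psi> y = 0" if "norm y = 1" for y
    using that by (simp add: \<psi>_def uc_def dot_square_norm)
  have lip: "norm (\<phi> x - \<phi> y) \<le> L * norm (x - y)" for x y
  proof -
    have half: "norm (\<phi> x - \<phi> y) \<le> L * norm (x - y)" if "norm x < 1" "norm y \<ge> 1" for x y
    proof -
      \<comment> \<open>The segment from \<open>x\<close> to \<open>y\<close> meets the sphere,
        where \<open>\<psi>\<close> vanishes; only its inner part, which is no longer than the
        whole, contributes to the difference.\<close>
      define \<theta> where "\<theta> = (\<lambda>s::real. norm (x + s *\<^sub>R (y - x)))"
      have "\<exists>s. 0 \<le> s \<and> s \<le> 1 \<and> \<theta> s = 1"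
        by (rule IVT') (use that in \<open>auto simp: \<theta>_def intro!: continuous_intros\<close>)
      then obtain s where s: "0 \<le> s" "s \<le> 1" "norm (x + s *\<^sub>R (y - x)) = 1" by (auto simp: \<theta>_def)
      have "norm (\<phi> x - \<phi> y) = norm (\<psi> x - \<psi> (x + s *\<^sub>R (y - x)))"
        using that s \<psi>0 by (simp add: \<phi>_def)
      also have "\<dots> \<le> L * norm (x - (x + s *\<^sub>R (y - x)))"
        using that s by (intro L(2)) auto
      also have "\<dots> = L * (s * norm (x - y))" using s by (simp add: norm_minus_commute)
      also have "\<dots> \<le> L * norm (x - y)"
        using s L(1) by (intro mult_left_mono mult_left_le_one_le) auto
      finally show ?thesis .
    qed
    consider "norm x < 1" "norm y < 1" | "norm x < 1" "norm y \<ge> 1" | "norm x \<ge> 1" "norm y < 1" | "norm x \<ge> 1" "norm y \<ge> 1"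
      by linarith
    then show ?thesis
    proof cases
      case 1 then show ?thesis using L(2)[of x y] by (simp add: \<phi>_def)
    next
      case 2 then show ?thesis by (rule half)
    next
      case 3 then show ?thesis using half[of y x] by (simp add: norm_minus_commute)
    next
      case 4 then show ?thesis using L(1) by (simp add: \<phi>_def)
    qed
  qed
  have c\<phi>: "continuous_on UNIV \<phi>"
    by (rule lipschitz_on_continuous_on[of L]) (auto intro!: lipschitz_onI simp: dist_norm lip L(1))
  then have m\<phi>: "\<phi> \<in> borel_measurable borel" by (rule borel_measurable_continuous_onI)
  have int\<phi>: "integrable lborel \<phi>"
  proof -
    have "set_integrable lborel (ball 0 1) \<psi>"
      unfolding \<psi>_def by (intro cb_integrable continuous_intros cB)
    moreover have "\<phi> = (\<lambda>y. indicator (ball 0 1) y *\<^sub>R \<psi> y)" by (auto simp: \<phi>_def fun_eq_iff)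
    ultimately show ?thesis by (simp add: set_integrable_def)
  qed
  define e where "e = (axis j 1 :: real^3)"
  have e1: "norm e = 1" by (simp add: e_def norm_axis_1)
  \<comment> \<open>Steps of length at most 1 keep every difference quotient supported in the ball
    of radius 2, where the constant \<open>L\<close> is an integrable majorant.\<close>
  define h where "h n = inverse (real (Suc n))" for n
  have h: "h n > 0" "h n \<le> 1" "h \<longlonglongrightarrow> 0" for n
    unfolding h_def using LIMSEQ_inverse_real_of_nat by (auto simp: inverse_le_1_iff)
  define s where "s n y = (\<phi> (y + h n *\<^sub>R e) - \<phi> y) /\<^sub>R h n" for n y
  define D where "D y = (indicator (ball 0 1) y *\<^sub>R d\<psi> j y)" for y
  have "(\<lambda>n. LINT y|lborel. s n y) \<longlonglongrightarrow> (LINT y|lborel. D y)"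
  proof (rule integral_dominated_convergence[where w="\<lambda>y. indicator (cball 0 2) y * L"])
    show "D \<in> borel_measurable lborel"
      unfolding D_def using borel_measurable_continuous_on_indicator[of "ball 0 1" "d\<psi> j"]
        continuous_on_subset[OF c\<psi>] by auto
    show "s n \<in> borel_measurable lborel" for n
      unfolding s_def measurable_lborel2
      by (intro borel_measurable_continuous_onI continuous_intros continuous_on_compose2[OF c\<phi>]) auto
    show "integrable lborel (\<lambda>y::real^3. indicator (cball 0 2) y * L)"
      by (intro integrable_mult_left integrable_real_indicator)
         (rule emeasure_lborel_cball_finite | simp)+
    show "AE y in lborel. norm (s n y) \<le> indicator (cball 0 2) y * L" for n
    proof (rule AE_I2)
      fix y :: "real^3"
      show "norm (s n y) \<le> indicator (cball 0 2) y * L"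
      proof (cases "norm y \<le> 2")
        case True
        have "norm (\<phi> (y + h n *\<^sub>R e) - \<phi> y) \<le> L * h n"
          using lip[of "y + h n *\<^sub>R e" y] h(1)[of n] e1 by simp
        moreover have "norm (s n y) = norm (\<phi> (y + h n *\<^sub>R e) - \<phi> y) / h n"
          using h(1)[of n] by (simp add: s_def divide_inverse mult.commute)
        ultimately have "norm (s n y) \<le> L" using h(1)[of n] by (simp add: pos_divide_le_eq)
        with True show ?thesis by simp
      next
        case False
        have "norm (y + h n *\<^sub>R e) \<ge> norm y - norm (h n *\<^sub>R e)" by (rule norm_diff_ineq)
        then have "norm (y + h n *\<^sub>R e) \<ge> 1" using False h(1,2)[of n] e1 by simp
        then show ?thesis using False by (simp add: s_def \<phi>_def)
      qed
    qed
    show "AE y in lborel. (\<lambda>n. s n y) \<longlonglongrightarrow> D y"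
      using AE_not_in[OF sphere_null]
    proof eventually_elim
      case (elim y)
      have lim: "(\<lambda>n. y + h n *\<^sub>R e) \<longlonglongrightarrow> y + 0 *\<^sub>R e" by (intro tendsto_intros h)
      show ?case
      proof (cases "norm y < 1")
        case True
        have "((\<lambda>t. \<psi> (y + t *\<^sub>R e)) has_vector_derivative (\<Sum>i\<in>UNIV. of_real (e$i) * d\<psi> i y)) (at 0)"
          using g\<psi>[of y] True by (intro has_grad_ray) auto
        also have "(\<Sum>i\<in>UNIV. of_real (e$i) * d\<psi> i y) = (\<Sum>i\<in>UNIV. if i = j then d\<psi> i y else 0)"
          by (rule sum.cong) (auto simp: e_def axis_def)
        finally have "((\<lambda>t. (\<psi> (y + t *\<^sub>R e) - \<psi> y) /\<^sub>R t) \<longlongrightarrow> d\<psi> j y) (at 0)"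
          by (simp add: has_vector_derivative_tendsto)
        then have "(\<lambda>n. (\<psi> (y + h n *\<^sub>R e) - \<psi> y) /\<^sub>R h n) \<longlonglongrightarrow> d\<psi> j y"
          by (rule filterlim_compose) (use h in \<open>auto simp: filterlim_at intro!: always_eventually less_imp_neq[symmetric]\<close>)
        moreover have "\<forall>\<^sub>F n in sequentially. (\<psi> (y + h n *\<^sub>R e) - \<psi> y) /\<^sub>R h n = s n y"
        proof -
          have "\<forall>\<^sub>F n in sequentially. norm (y + h n *\<^sub>R e) < 1"
            using tendsto_norm[OF lim] True by (simp add: order_tendstoD(2))
          then show ?thesis by eventually_elim (use True in \<open>simp add: s_def \<phi>_def\<close>)
        qed
        ultimately show ?thesis using True by (simp add: D_def filterlim_cong[OF refl refl])
      next
        case False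
        then have y: "norm y > 1" using elim by simp
        have "\<forall>\<^sub>F n in sequentially. norm (y + h n *\<^sub>R e) > 1"
          using tendsto_norm[OF lim] y by (simp add: order_tendstoD(1))
        then have "\<forall>\<^sub>F n in sequentially. s n y = 0"
          by eventually_elim (use y in \<open>simp add: s_def \<phi>_def\<close>)
        then show ?thesis using y by (simp add: D_def tendsto_eventually)
      qed
    qed
  qed
  moreover have "(LINT y|lborel. s n y) = 0" for n
  proof -
    have "integrable lborel (\<lambda>y. \<phi> (y + h n *\<^sub>R e))"
      using lborel_integrable_shift[OF int\<phi>] by simp
    then have "(LINT y|lborel. s n y) = ((LINT y|lborel. \<phi> (y + h n *\<^sub>R e)) - (LINT y|lborel. \<phi> y)) /\<^sub>R h n"
      by (simp add: s_def int\<phi>)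
    then show ?thesis by (simp add: lborel_shift_integral m\<phi>)
  qed
  ultimately have "(LINT y|lborel. D y) = 0"
    by (simp add: LIMSEQ_const_iff)
  then have "bint (d\<psi> j) = 0" by (simp add: bint_def set_lebesgue_integral_def D_def)
  moreover have "bint (d\<psi> j) = bint (\<lambda>y. dB j y * uc y ^ Suc k) - 2 * of_nat (Suc k) * bint (\<lambda>y. B y * of_real (y$j) * uc y ^ k)"
    unfolding d\<psi>_def by (subst bint_diff) (intro continuous_intros cont cB | simp add: bint_cmult)+
  ultimately show ?thesis by simp
qed

section \<open>Differentiation of ball integrals with respect to a parameter\<close>

lemma bint_has_vector_derivative:
  fixes G G' :: "real \<Rightarrow> real^3 \<Rightarrow> complex"
  assumes e: "e > 0" and cG: "\<And>t. t \<in> ball t0 e \<Longrightarrow> cb (G t)" and cG': "cb (G' t0)"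
    and der: "\<And>t y. t \<in> ball t0 e \<Longrightarrow> norm y < 1 \<Longrightarrow> ((\<lambda>t. G t y) has_vector_derivative G' t y) (at t)"
    and bd: "\<And>t y. t \<in> ball t0 e \<Longrightarrow> norm y < 1 \<Longrightarrow> norm (G' t y) \<le> K"
  shows "((\<lambda>t. bint (G t)) has_vector_derivative bint (G' t0)) (at t0)"
proof -
  have "((\<lambda>t. bint (G t)) has_vector_derivative bint (G' t0)) (at t0 within ball t0 e)"
    unfolding has_vector_derivative_tendsto tendsto_at_iff_sequentially
  proof (intro allI impI)
    fix X :: "nat \<Rightarrow> real"
    assume X: "\<forall>i. X i \<in> ball t0 e - {t0}" and lim: "X \<longlonglongrightarrow> t0"
    have t0: "t0 \<in> ball t0 e" using e by simp
    let ?s = "\<lambda>n y. indicator (ball 0 1) y *\<^sub>R ((G (X n) y - G t0 y) /\<^sub>R (X n - t0))"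
    have "(\<lambda>n. LINT y|lborel. ?s n y) \<longlonglongrightarrow> (LINT y|lborel. indicator (ball 0 1) y *\<^sub>R G' t0 y)"
    proof (rule integral_dominated_convergence[where w="\<lambda>y. indicator (ball 0 1) y * K"])
      have bi: "(\<lambda>x. indicator (ball 0 1) x *\<^sub>R g x) \<in> borel_measurable lborel" if "cb g" for g :: "real^3 \<Rightarrow> complex"
        using borel_measurable_continuous_on_indicator[of "ball 0 1" g] continuous_on_subset[OF that] by auto
      show "(\<lambda>x. indicator (ball 0 1) x *\<^sub>R G' t0 x) \<in> borel_measurable lborel" by (rule bi) fact
      show "?s n \<in> borel_measurable lborel" for n
        by (rule bi) (use X t0 in \<open>auto intro!: continuous_intros cG\<close>)
      show "integrable lborel (\<lambda>y::real^3. indicator (ball 0 1) y * K)"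
        by (intro integrable_mult_left integrable_real_indicator)
           (rule emeasure_lborel_ball_finite | simp)+
      show "AE y in lborel. norm (?s n y) \<le> indicator (ball 0 1) y * K" for n
      proof (rule AE_I2)
        fix y :: "real^3"
        show "norm (?s n y) \<le> indicator (ball 0 1) y * K"
        proof (cases "norm y < 1")
          case True
          have "norm (G (X n) y - G t0 y) \<le> K * norm (X n - t0)"
          proof (rule differentiable_bound[OF convex_ball])
            show "((\<lambda>t. G t y) has_derivative (\<lambda>h. h *\<^sub>R G' t y)) (at t within ball t0 e)" if "t \<in> ball t0 e" for t
              using der[OF that True] by (auto simp: has_vector_derivative_def intro: has_derivative_at_withinI)
            show "onorm (\<lambda>h. h *\<^sub>R G' t y) \<le> K" if "t \<in> ball t0 e" for t
              using bd[OF that True] by (intro onorm_le) (simp add: mult.commute[of K] mult_left_mono)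
          qed (use X t0 in auto)
          moreover have "norm ((G (X n) y - G t0 y) /\<^sub>R (X n - t0)) = norm (G (X n) y - G t0 y) / norm (X n - t0)"
            by (simp add: divide_inverse mult.commute)
          moreover have "norm (X n - t0) > 0" using X by simp
          ultimately show ?thesis using True by (simp add: pos_divide_le_eq)
        qed simp
      qed
      show "AE y in lborel. (\<lambda>n. ?s n y) \<longlonglongrightarrow> indicator (ball 0 1) y *\<^sub>R G' t0 y"
      proof (rule AE_I2)
        fix y :: "real^3"
        show "(\<lambda>n. ?s n y) \<longlonglongrightarrow> indicator (ball 0 1) y *\<^sub>R G' t0 y"
        proof (cases "norm y < 1")
          case True
          have "((\<lambda>t. (G t y - G t0 y) /\<^sub>R (t - t0)) \<longlongrightarrow> G' t0 y) (at t0)"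
            using der[OF t0 True] by (simp add: has_vector_derivative_tendsto)
          then have "(\<lambda>n. (G (X n) y - G t0 y) /\<^sub>R (X n - t0)) \<longlonglongrightarrow> G' t0 y"
            by (rule filterlim_compose) (use X lim in \<open>auto simp: filterlim_at intro!: always_eventually\<close>)
          then show ?thesis using True by simp
        qed simp
      qed
    qed
    moreover have "(LINT y|lborel. ?s n y) = (bint (G (X n)) - bint (G t0)) /\<^sub>R (X n - t0)" for n
    proof -
      have "(LINT y|lborel. ?s n y) = bint (\<lambda>y. (G (X n) y - G t0 y) /\<^sub>R (X n - t0))"
        unfolding bint_def set_lebesgue_integral_def ..
      also have "\<dots> = bint (\<lambda>y. G (X n) y - G t0 y) /\<^sub>R (X n - t0)"
        unfolding bint_def by (rule set_integral_scaleR_right)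
      also have "bint (\<lambda>y. G (X n) y - G t0 y) = bint (G (X n)) - bint (G t0)"
        using X t0 by (intro bint_diff cG) auto
      finally show ?thesis .
    qed
    ultimately show "((\<lambda>s. (bint (G s) - bint (G t0)) /\<^sub>R (s - t0)) \<circ> X) \<longlonglongrightarrow> bint (G' t0)"
      by (simp add: o_def bint_def set_lebesgue_integral_def)
  qed
  then show ?thesis using e by (simp add: at_within_open[of _ "ball t0 e"])
qed

text \<open>The form used later: joint continuity on a compact product yields both the uniform bound
  and the continuity of the integrand at \<open>t0\<close>.\<close>

lemma bint_has_vector_derivative':
  fixes G G' :: "real \<Rightarrow> real^3 \<Rightarrow> complex"
  assumes e: "e > 0" and cG: "\<And>t. t \<in> ball t0 e \<Longrightarrow> cb (G t)"
    and cG': "continuous_on (cball t0 e \<times> cball 0 1) (\<lambda>(t, y). G' t y)"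
    and der: "\<And>t y. t \<in> ball t0 e \<Longrightarrow> norm y < 1 \<Longrightarrow> ((\<lambda>t. G t y) has_vector_derivative G' t y) (at t)"
  shows "((\<lambda>t. bint (G t)) has_vector_derivative bint (G' t0)) (at t0)"
proof -
  have "compact ((\<lambda>(t, y). G' t y) ` (cball t0 e \<times> cball 0 1))"
    by (intro compact_continuous_image cG' compact_Times compact_cball)
  then have "bounded ((\<lambda>(t, y). G' t y) ` (cball t0 e \<times> cball 0 1))" by (rule compact_imp_bounded)
  then obtain K where K: "\<And>x. x \<in> cball t0 e \<times> cball 0 1 \<Longrightarrow> norm ((\<lambda>(t, y). G' t y) x) \<le> K"
    by (auto simp: bounded_iff)
  show ?thesis
  proof (rule bint_has_vector_derivative[OF e cG _ der])
    show "norm (G' t y) \<le> K" if "t \<in> ball t0 e" "norm y < 1" for t y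
      using K[of "(t, y)"] that by auto
    have "cb ((\<lambda>(t, y). G' t y) \<circ> (\<lambda>y. (t0, y)))"
      by (rule continuous_on_compose[OF _ continuous_on_subset[OF cG']])
         (use e in \<open>auto intro!: continuous_intros\<close>)
    then show "cb (G' t0)" by (simp add: o_def)
  qed auto
qed

section \<open>Green's identity\<close>

text \<open>The operator y_j d_m - y_m d_j is tangent to spheres, so it integrates to zero against a
  radial weight. Concretely, integrating \<open>v y_j\<close> by parts in direction \<open>m\<close>
  and \<open>v y_m\<close> in direction \<open>j\<close> gives the same moment, and the two
  Kronecker terms cancel.\<close>

lemma bint_curl:
  assumes der: "\<And>y. y \<in> cball 0 1 \<Longrightarrow> has_grad v (\<lambda>j. dv j y) y"
    and cont: "\<And>j. cb (dv j)"
  shows "bint (\<lambda>y. (dv m y * of_real (y$j) - dv j y * of_real (y$m)) * uc y ^ Suc k) = 0"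
proof -
  have cv: "cb v" using der by (rule has_grad_imp_continuous_on)
  have *: "bint (\<lambda>y. (v y * (if m = j then 1 else 0) + dv m y * of_real (y$j)) * uc y ^ Suc k) =
     2 * of_nat (Suc k) * bint (\<lambda>y. (v y * of_real (y$j)) * of_real (y$m) * uc y ^ k)" for m j
    by (rule bint_by_parts) (intro has_grad_mult has_grad_coord der continuous_intros cont cv | simp)+
  have "bint (\<lambda>y. (v y * (if m = j then 1 else 0) + dv m y * of_real (y$j)) * uc y ^ Suc k)
      - bint (\<lambda>y. (v y * (if j = m then 1 else 0) + dv j y * of_real (y$m)) * uc y ^ Suc k) = 0"
    unfolding * by (simp add: mult_ac)
  moreover have "bint (\<lambda>y. (v y * (if m = j then 1 else 0) + dv m y * of_real (y$j)) * uc y ^ Suc k)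
      - bint (\<lambda>y. (v y * (if j = m then 1 else 0) + dv j y * of_real (y$m)) * uc y ^ Suc k)
    = bint (\<lambda>y. (v y * (if m = j then 1 else 0) + dv m y * of_real (y$j)) * uc y ^ Suc k
       - (v y * (if j = m then 1 else 0) + dv j y * of_real (y$m)) * uc y ^ Suc k)"
    by (rule bint_diff[symmetric]; intro continuous_intros cont cv)
  moreover have "\<dots> = bint (\<lambda>y. (dv m y * of_real (y$j) - dv j y * of_real (y$m)) * uc y ^ Suc k)"
    by (rule bint_cong) (auto simp: algebra_simps)
  ultimately show ?thesis by simp
qed

text \<open>Integration by parts of each \<open>A * dq j\<close>; the divergence drops out and the
  weight stands in for the boundary term, leaving the radial part of the field with one power of the
  weight less. The field enters through its vanishing divergence, so it may be a constant field, the
  gradient of a harmonic polynomial, or the conjugate of such a gradient.\<close>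

lemma bint_green:
  assumes A: "\<And>y. y \<in> cball 0 1 \<Longrightarrow> has_grad A (\<lambda>j. dA j y) y"
    and cA: "\<And>j. cb (dA j)"
    and q: "\<And>j y. y \<in> cball 0 1 \<Longrightarrow> has_grad (dq j) (\<lambda>i. ddq j i y) y"
    and cq: "\<And>i j. cb (ddq i j)"
    and harm: "\<And>y. y \<in> cball 0 1 \<Longrightarrow> (\<Sum>j\<in>UNIV. ddq j j y) = 0"
  shows "bint (\<lambda>y. (\<Sum>j\<in>UNIV. dA j y * dq j y) * uc y ^ Suc k) =
     2 * of_nat (Suc k) * bint (\<lambda>y. A y * (\<Sum>j\<in>UNIV. of_real (y$j) * dq j y) * uc y ^ k)"
proof -
  have ccA: "cb A" using A by (rule has_grad_imp_continuous_on)
  have cdq: "cb (dq j)" for j using q by (rule has_grad_imp_continuous_on)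
  have *: "bint (\<lambda>y. (A y * ddq j j y + dA j y * dq j y) * uc y ^ Suc k) =
      2 * of_nat (Suc k) * bint (\<lambda>y. (A y * dq j y) * of_real (y$j) * uc y ^ k)" for j
    by (rule bint_by_parts) (intro has_grad_mult A q continuous_intros cA cq ccA cdq | assumption)+
  have "bint (\<lambda>y. (\<Sum>j\<in>UNIV. dA j y * dq j y) * uc y ^ Suc k)
      = bint (\<lambda>y. \<Sum>j\<in>UNIV. (A y * ddq j j y + dA j y * dq j y) * uc y ^ Suc k)"
  proof (rule bint_cong)
    fix y :: "real^3" assume "norm y < 1"
    then have "(\<Sum>j\<in>UNIV. A y * ddq j j y) = 0"
      using harm[of y] by (simp flip: sum_distrib_left)
    then show "(\<Sum>j\<in>UNIV. dA j y * dq j y) * uc y ^ Suc k = (\<Sum>j\<in>UNIV. (A y * ddq j j y + dA j y * dq j y) * uc y ^ Suc k)"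
      by (simp only: sum.distrib add_0 flip: sum_distrib_right)
  qed
  also have "\<dots> = (\<Sum>j\<in>UNIV. bint (\<lambda>y. (A y * ddq j j y + dA j y * dq j y) * uc y ^ Suc k))"
    by (rule bint_sum) (auto intro!: continuous_intros cA cq ccA cdq)
  also have "\<dots> = 2 * of_nat (Suc k) * (\<Sum>j\<in>UNIV. bint (\<lambda>y. (A y * dq j y) * of_real (y$j) * uc y ^ k))"
    unfolding * by (simp add: sum_distrib_left)
  also have "(\<Sum>j\<in>UNIV. bint (\<lambda>y. (A y * dq j y) * of_real (y$j) * uc y ^ k))
      = bint (\<lambda>y. \<Sum>j\<in>UNIV. (A y * dq j y) * of_real (y$j) * uc y ^ k)"
    by (rule bint_sum[symmetric]) (auto intro!: continuous_intros ccA cdq)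
  also have "\<dots> = bint (\<lambda>y. A y * (\<Sum>j\<in>UNIV. of_real (y$j) * dq j y) * uc y ^ k)"
    by (rule bint_cong) (simp add: sum_distrib_left sum_distrib_right mult_ac)
  finally show ?thesis .
qed

lemma continuous_on_bint:
  fixes G :: "'p::metric_space \<Rightarrow> real^3 \<Rightarrow> complex"
  assumes S: "compact S" and c: "continuous_on (S \<times> cball 0 1) (\<lambda>(x, y). G x y)"
  shows "continuous_on S (\<lambda>x. bint (G x))"
proof -
  have "compact ((\<lambda>(t, y). G t y) ` (S \<times> cball 0 1))"
    by (intro compact_continuous_image c compact_Times compact_cball S)
  then have "bounded ((\<lambda>(t, y). G t y) ` (S \<times> cball 0 1))" by (rule compact_imp_bounded)
  then obtain K where K: "\<And>x. x \<in> S \<times> cball 0 1 \<Longrightarrow> norm ((\<lambda>(t, y). G t y) x) \<le> K"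
    by (auto simp: bounded_iff)
  have cG: "cb (G x)" if "x \<in> S" for x
  proof -
    have "cb ((\<lambda>(t, y). G t y) \<circ> (\<lambda>y. (x, y)))"
      by (rule continuous_on_compose[OF _ continuous_on_subset[OF c]])
         (use that in \<open>auto intro!: continuous_intros\<close>)
    then show ?thesis by (simp add: o_def)
  qed
  show ?thesis
    unfolding continuous_on_sequentially
  proof (intro allI ballI impI, elim conjE)
    fix X :: "nat \<Rightarrow> 'p" and a assume a: "a \<in> S" and X: "\<forall>n. X n \<in> S" and lim: "X \<longlonglongrightarrow> a"
    have "(\<lambda>n. LINT y|lborel. indicator (ball 0 1) y *\<^sub>R G (X n) y) \<longlonglongrightarrow> (LINT y|lborel. indicator (ball 0 1) y *\<^sub>R G a y)"
    proof (rule integral_dominated_convergence[where w="\<lambda>y. indicator (ball 0 1) y * K"])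
      have bi: "(\<lambda>x. indicator (ball 0 1) x *\<^sub>R g x) \<in> borel_measurable lborel" if "cb g" for g :: "real^3 \<Rightarrow> complex"
        using borel_measurable_continuous_on_indicator[of "ball 0 1" g] continuous_on_subset[OF that] by auto
      show "(\<lambda>y. indicator (ball 0 1) y *\<^sub>R G a y) \<in> borel_measurable lborel" by (rule bi[OF cG[OF a]])
      show "(\<lambda>y. indicator (ball 0 1) y *\<^sub>R G (X n) y) \<in> borel_measurable lborel" for n
        by (rule bi[OF cG]) (use X in auto)
      show "integrable lborel (\<lambda>y::real^3. indicator (ball 0 1) y * K)"
        by (intro integrable_mult_left integrable_real_indicator)
           (rule emeasure_lborel_ball_finite | simp)+
      show "AE y in lborel. norm (indicator (ball 0 1) y *\<^sub>R G (X n) y) \<le> indicator (ball 0 1) y * K" for n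
      proof (rule AE_I2)
        fix y :: "real^3"
        show "norm (indicator (ball 0 1) y *\<^sub>R G (X n) y) \<le> indicator (ball 0 1) y * K"
          using K[of "(X n, y)"] X by (cases "norm y < 1") auto
      qed
      show "AE y in lborel. (\<lambda>n. indicator (ball 0 1) y *\<^sub>R G (X n) y) \<longlonglongrightarrow> indicator (ball 0 1) y *\<^sub>R G a y"
      proof (rule AE_I2)
        fix y :: "real^3"
        show "(\<lambda>n. indicator (ball 0 1) y *\<^sub>R G (X n) y) \<longlonglongrightarrow> indicator (ball 0 1) y *\<^sub>R G a y"
        proof (cases "norm y < 1")
          case True
          have "(\<lambda>n. (X n, y)) \<longlonglongrightarrow> (a, y)" by (intro tendsto_Pair lim tendsto_const)
          then have "((\<lambda>(x, y). G x y) \<circ> (\<lambda>n. (X n, y))) \<longlonglongrightarrow> (\<lambda>(x, y). G x y) (a, y)"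
            using c[unfolded continuous_on_sequentially, rule_format, of "(a, y)" "\<lambda>n. (X n, y)"] a X True
            by simp
          then show ?thesis using True by (simp add: o_def)
        qed simp
      qed
    qed
    then show "((\<lambda>x. bint (G x)) \<circ> X) \<longlonglongrightarrow> bint (G a)"
      by (simp add: o_def bint_def set_lebesgue_integral_def)
  qed
qed

lemma lborel_scale_integral_scaleR:
  fixes f :: "real^3 \<Rightarrow> 'a::{banach, second_countable_topology}"
  assumes "f \<in> borel_measurable borel" "c > 0"
  shows "(LINT y|lborel. f y) = (c^3) *\<^sub>R (LINT y|lborel. f (a + c *\<^sub>R y))"
proof -
  have "(LINT y|lborel. f y) = (LINT y|density (distr lborel borel (\<lambda>x. a + c *\<^sub>R x)) (\<lambda>_. ennreal (\<bar>c\<bar> ^ DIM(real^3))). f y)"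
    by (subst lborel_affine[of c a]) (use assms in auto)
  also have "\<dots> = (LINT y|distr lborel borel (\<lambda>x. a + c *\<^sub>R x). (c^3) *\<^sub>R f y)"
    using assms by (subst integral_density) (auto simp: ennreal_power)
  also have "\<dots> = (LINT y|lborel. (c^3) *\<^sub>R f (a + c *\<^sub>R y))"
    using assms by (subst integral_distr) auto
  finally show ?thesis by simp
qed

lemma lborel_scale_integral:
  fixes f :: "real^3 \<Rightarrow> complex"
  assumes "f \<in> borel_measurable borel" "c > 0"
  shows "(LINT y|lborel. f y) = of_real (c^3) * (LINT y|lborel. f (a + c *\<^sub>R y))"
  using lborel_scale_integral_scaleR[OF assms, of a] by (simp add: scaleR_conv_of_real)

text \<open>Tailored to the kernel \<open>(max 0 (d^2 - |z|^2))^2\<close>: its second derivatives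
  jump across |z| = d, but its first-order Taylor remainder is still quadratic.\<close>

lemma has_grad_quadratic:
  assumes e: "e > 0" and bd: "\<And>h. norm h < e \<Longrightarrow> norm (v (x + h) - v x - (\<Sum>j\<in>UNIV. of_real (h$j) * g j)) \<le> C * (norm h)\<^sup>2"
  shows "has_grad v g x"
proof -
  have bl: "bounded_linear (\<lambda>h::real^3. \<Sum>j\<in>UNIV. of_real (h$j) * g j)"
    by (intro bounded_linear_sum bounded_linear_mult_const bounded_linear_compose[OF bounded_linear_of_real] bounded_linear_vec_nth)
  have C: "C \<le> \<bar>C\<bar> + 1" "\<bar>C\<bar> + 1 > 0" by auto
  show ?thesis
    unfolding has_grad_def has_derivative_at_alt
  proof (intro conjI allI impI bl)
    fix \<epsilon> :: real assume \<epsilon>: "\<epsilon> > 0"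
    show "\<exists>d>0. \<forall>y. norm (y - x) < d \<longrightarrow> norm (v y - v x - (\<Sum>j\<in>UNIV. of_real ((y - x)$j) * g j)) \<le> \<epsilon> * norm (y - x)"
    proof (intro exI[of _ "min e (\<epsilon> / (\<bar>C\<bar> + 1))"] conjI allI impI)
      show "min e (\<epsilon> / (\<bar>C\<bar> + 1)) > 0" using e \<epsilon> C by simp
      fix y assume y: "norm (y - x) < min e (\<epsilon> / (\<bar>C\<bar> + 1))"
      have "norm (v y - v x - (\<Sum>j\<in>UNIV. of_real ((y - x)$j) * g j)) \<le> C * (norm (y - x))\<^sup>2"
        using bd[of "y - x"] y by simp
      also have "\<dots> \<le> ((\<bar>C\<bar> + 1) * norm (y - x)) * norm (y - x)"
        using C(1) by (simp add: power2_eq_square mult_right_mono mult.assoc[symmetric])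
      also have "\<dots> \<le> \<epsilon> * norm (y - x)"
        using y C(2) by (intro mult_right_mono) (auto simp: less_divide_eq mult.commute)
      finally show "norm (v y - v x - (\<Sum>j\<in>UNIV. of_real ((y - x)$j) * g j)) \<le> \<epsilon> * norm (y - x)" .
    qed
  qed
qed

text \<open>The function t -> (max 0 t)^2 is C^1 with a derivative of Lipschitz constant 2, which
  makes its first-order remainder at most the square of the increment.\<close>

lemma max_sq_remainder: "\<bar>(max 0 b)\<^sup>2 - (max 0 a)\<^sup>2 - 2 * max 0 a * (b - a)\<bar> \<le> (b - a)\<^sup>2" for a b :: real
proof (cases "a \<ge> 0"; cases "b \<ge> 0")
  assume ab: "a \<ge> 0" "b \<ge> 0"
  have "b\<^sup>2 - a\<^sup>2 - 2 * a * (b - a) = (b - a)\<^sup>2" by (simp add: power2_eq_square algebra_simps)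
  with ab show ?thesis by simp
next
  assume ab: "a \<ge> 0" "\<not> b \<ge> 0"
  then have "a * b \<le> 0" by (simp add: mult_nonneg_nonpos)
  moreover have "b\<^sup>2 \<ge> 0" "a\<^sup>2 \<ge> 0" by auto
  moreover have "(max 0 b)\<^sup>2 - (max 0 a)\<^sup>2 - 2 * max 0 a * (b - a) = a\<^sup>2 - 2 * (a * b)"
    using ab by (simp add: max_def power2_eq_square algebra_simps)
  moreover have "(b - a)\<^sup>2 = b\<^sup>2 + a\<^sup>2 - 2 * (a * b)" by (simp add: power2_diff)
  ultimately show ?thesis by linarith
next
  assume ab: "\<not> a \<ge> 0" "b \<ge> 0"
  then have "a * b \<le> 0" by (simp add: mult_nonpos_nonneg)
  moreover have "b\<^sup>2 \<ge> 0" "a\<^sup>2 \<ge> 0" by auto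
  moreover have "(max 0 b)\<^sup>2 - (max 0 a)\<^sup>2 - 2 * max 0 a * (b - a) = b\<^sup>2"
    using ab by (simp add: max_def power2_eq_square algebra_simps)
  moreover have "(b - a)\<^sup>2 = b\<^sup>2 + a\<^sup>2 - 2 * (a * b)" by (simp add: power2_diff)
  ultimately show ?thesis by linarith
qed (simp add: max_def)

section \<open>Functions with a mean value property\<close>

lemma bint_pos:
  assumes c: "cb f" and nn: "\<And>y. norm y < 1 \<Longrightarrow> 0 \<le> f y" and y0: "norm y0 < 1" "f y0 > (0::real)"
  shows "bint f > 0"
proof -
  have "continuous_on (ball 0 1) f" using c by (rule continuous_on_subset) auto
  then have "isCont f y0" using y0 by (simp add: continuous_on_eq_continuous_at)
  then have "\<forall>\<^sub>F y in at y0. f y > f y0 / 2"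
    using y0 by (intro order_tendstoD(1)[of f "f y0"]) (auto simp: isCont_def)
  moreover have "\<forall>\<^sub>F y in at y0. y \<in> ball 0 1"
    using y0 by (intro eventually_at_topological[THEN iffD2]) (auto intro!: exI[of _ "ball 0 1"])
  ultimately have "\<forall>\<^sub>F y in at y0. f y > f y0 / 2 \<and> y \<in> ball 0 1" by (rule eventually_conj)
  then obtain \<delta> where \<delta>: "\<delta> > 0" "\<And>y. y \<noteq> y0 \<Longrightarrow> dist y y0 < \<delta> \<Longrightarrow> f y > f y0 / 2 \<and> y \<in> ball 0 1"
    by (auto simp: eventually_at)
  have *: "f y \<ge> f y0 / 2 \<and> y \<in> ball 0 1" if "y \<in> ball y0 \<delta>" for y
    using \<delta>(2)[of y] that y0 by (cases "y = y0") (auto simp: dist_commute)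
  have "0 < f y0 / 2 * measure lborel (ball y0 \<delta>)"
    using y0 content_ball_pos[OF \<delta>(1), of y0] by simp
  also have "\<dots> = (LINT y|lborel. indicator (ball y0 \<delta>) y * (f y0 / 2))" by simp
  also have "\<dots> \<le> (LINT y|lborel. indicator (ball 0 1) y *\<^sub>R f y)"
  proof (rule integral_mono)
    show "integrable lborel (\<lambda>y. indicator (ball y0 \<delta>) y * (f y0 / 2))"
      by (intro integrable_mult_left integrable_real_indicator)
         (rule emeasure_lborel_ball_finite | simp)+
    show "integrable lborel (\<lambda>y. indicator (ball 0 1) y *\<^sub>R f y)"
      using cb_integrable[OF c] by (simp add: set_integrable_def)
    show "indicator (ball y0 \<delta>) y * (f y0 / 2) \<le> indicator (ball 0 1) y *\<^sub>R f y" for y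
      using *[of y] nn[of y] by (auto simp: indicator_def)
  qed
  also have "\<dots> = bint f" by (simp add: bint_def set_lebesgue_integral_def)
  finally show ?thesis .
qed

text \<open>The exponent 2 is what makes the averaging kernel, extended by zero outside its ball, a
  C^1 function; functions with this property therefore inherit continuous partials from the
  kernel.\<close>

definition mean_value_on :: "(real^3) set \<Rightarrow> (real^3 \<Rightarrow> complex) \<Rightarrow> bool" where
  "mean_value_on U v \<longleftrightarrow> open U \<and> continuous_on U v \<and>
     (\<forall>x d. d > 0 \<longrightarrow> cball x d \<subseteq> U \<longrightarrow> bint (\<lambda>y. v (x + d *\<^sub>R y) * uc y ^ 2) = v x * bint (\<lambda>y. uc y ^ 2))"

lemma N2_nz: "bint (\<lambda>y. uc y ^ 2) \<noteq> 0"
proof -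
  have "bint (\<lambda>y. uc y ^ 2) = of_real (bint (\<lambda>y. (1 - y \<bullet> y)\<^sup>2))"
    by (simp add: uc_def flip: bint_of_real)
  moreover have "bint (\<lambda>y::real^3. (1 - y \<bullet> y)\<^sup>2) > 0"
    by (rule bint_pos[where ?y0.0=0]) (auto intro!: continuous_intros)
  ultimately show ?thesis by simp
qed

lemma cball_affine_mem:
  assumes "cball x d \<subseteq> U" "d \<ge> 0" "norm y \<le> 1" shows "x + d *\<^sub>R y \<in> U"
proof -
  have "norm (d *\<^sub>R y) \<le> d" using assms(2,3) by (simp add: mult_left_le)
  then show ?thesis using assms(1) by (auto simp: subset_iff dist_norm)
qed

lemma cb_affine:
  assumes "continuous_on U v" "cball x d \<subseteq> U" "d \<ge> 0"
  shows "cb (\<lambda>y. v (x + d *\<^sub>R y))"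
  by (rule continuous_on_compose2[OF assms(1)])
     (use cball_affine_mem[OF assms(2,3)] in \<open>auto intro!: continuous_intros\<close>)

text \<open>Moves the dependence on \<open>x\<close> from \<open>v\<close> into the kernel, over a
  ball around the fixed centre \<open>x0\<close>. The integral of the cut-off product is computed
  twice by substitution: with scale \<open>d\<close> around \<open>x\<close>, where the weight
  contributes \<open>d^4\<close>, and with scale \<open>2 d\<close> around \<open>x0\<close>. The
  factor 8 is the quotient of the two Jacobians.\<close>

lemma mean_value_on_kernel:
  assumes MV: "mean_value_on U v" and d: "d > 0" and sub: "cball x0 (2 * d) \<subseteq> U" and x: "norm (x - x0) < d"
  shows "v x * (of_real (d^4) * bint (\<lambda>y. uc y ^ 2)) =
    8 * bint (\<lambda>y. v (x0 + (2 * d) *\<^sub>R y) * of_real ((max 0 (d\<^sup>2 - (x0 + (2 * d) *\<^sub>R y - x) \<bullet> (x0 + (2 * d) *\<^sub>R y - x)))\<^sup>2))"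
proof -
  define K where "K y = complex_of_real ((max 0 (d\<^sup>2 - (y - x) \<bullet> (y - x)))\<^sup>2)" for y
  define g where "g y = indicator (ball x0 (2 * d)) y *\<^sub>R (v y * K y)" for y
  have cU: "continuous_on U v" using MV by (simp add: mean_value_on_def)
  have mg: "g \<in> borel_measurable borel"
    unfolding g_def K_def
    by (intro borel_measurable_continuous_on_indicator continuous_intros continuous_on_subset[OF cU])
       (use sub ball_subset_cball in auto)
  have inball: "x + d *\<^sub>R y \<in> ball x0 (2 * d)" if "norm y < 1" for y
  proof -
    have "norm (x + d *\<^sub>R y - x0) \<le> norm (x - x0) + norm (d *\<^sub>R y)"
      by (metis norm_triangle_ineq add_diff_eq add.commute diff_add_eq)
    also have "\<dots> < d + d" using x that d by (intro add_strict_mono) auto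
    finally show ?thesis by (simp add: dist_norm norm_minus_commute)
  qed
  have "g (x + d *\<^sub>R y) = indicator (ball 0 1) y *\<^sub>R (of_real (d^4) * (v (x + d *\<^sub>R y) * uc y ^ 2))" for y
  proof -
    have e: "d\<^sup>2 - (d *\<^sub>R y) \<bullet> (d *\<^sub>R y) = d\<^sup>2 * (1 - y \<bullet> y)" by (simp add: power2_eq_square algebra_simps)
    show ?thesis
    proof (cases "norm y < 1")
      case True
      then have "y \<bullet> y \<le> 1" by (simp add: dot_square_norm power_le_one)
      then have "max 0 (d\<^sup>2 * (1 - y \<bullet> y)) = d\<^sup>2 * (1 - y \<bullet> y)" by simp
      moreover have "(d\<^sup>2 * (1 - y \<bullet> y))\<^sup>2 = d^4 * (1 - y \<bullet> y)\<^sup>2" by (simp add: power_mult_distrib)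
      ultimately have "K (x + d *\<^sub>R y) = of_real (d^4) * uc y ^ 2"
        unfolding K_def uc_def by (simp only: add_diff_cancel_left' e of_real_mult of_real_power)
      then show ?thesis using True inball[OF True] by (simp add: g_def)
    next
      case False
      then have "y \<bullet> y \<ge> 1" by (simp add: dot_square_norm)
      then have "d\<^sup>2 * (1 - y \<bullet> y) \<le> 0" by (simp add: mult_nonneg_nonpos)
      then have "K (x + d *\<^sub>R y) = 0"
        unfolding K_def by (simp only: add_diff_cancel_left' e) simp
      then show ?thesis using False by (simp add: g_def)
    qed
  qed
  then have "(LINT y|lborel. g y) = of_real (d^3) * bint (\<lambda>y. of_real (d^4) * (v (x + d *\<^sub>R y) * uc y ^ 2))"
    by (subst lborel_scale_integral[OF mg d, of x]) (simp only: bint_def set_lebesgue_integral_def)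
  also have "\<dots> = of_real (d^3) * (of_real (d^4) * (v x * bint (\<lambda>y. uc y ^ 2)))"
  proof -
    have "cball x d \<subseteq> U"
    proof -
      have "cball x d \<subseteq> cball x0 (2 * d)"
        using x by (subst cball_subset_cball_iff) (auto simp: dist_norm)
      then show ?thesis using sub by blast
    qed
    then have "bint (\<lambda>y. v (x + d *\<^sub>R y) * uc y ^ 2) = v x * bint (\<lambda>y. uc y ^ 2)"
      using MV d by (simp add: mean_value_on_def)
    then show ?thesis by (simp only: bint_cmult)
  qed
  finally have 1: "(LINT y|lborel. g y) = of_real (d^3) * (v x * (of_real (d^4) * bint (\<lambda>y. uc y ^ 2)))"
    by (simp add: mult_ac)
  have "g (x0 + (2 * d) *\<^sub>R y) = indicator (ball 0 1) y *\<^sub>R (v (x0 + (2 * d) *\<^sub>R y) * K (x0 + (2 * d) *\<^sub>R y))" for y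
  proof -
    have "x0 + (2 * d) *\<^sub>R y \<in> ball x0 (2 * d) \<longleftrightarrow> y \<in> ball 0 1" using d by (auto simp: dist_norm)
    then show ?thesis by (simp add: g_def indicator_def)
  qed
  then have 2: "(LINT y|lborel. g y) = of_real (d^3) * (8 * bint (\<lambda>y. v (x0 + (2 * d) *\<^sub>R y) * K (x0 + (2 * d) *\<^sub>R y)))"
    using d by (subst lborel_scale_integral[OF mg, of "2 * d" x0]) (simp_all add: bint_def set_lebesgue_integral_def power_mult_distrib)
  from 1 2 d show ?thesis unfolding K_def by simp
qed

lemma kernel_has_grad:
  fixes d :: real and x0 x :: "real^3" and w :: "real^3 \<Rightarrow> complex"
  defines "z \<equiv> \<lambda>x y. x0 + (2 * d) *\<^sub>R y - x"
  assumes cw: "cb w" and d: "d > 0" and x: "norm (x - x0) < d"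
  shows "has_grad (\<lambda>x. bint (\<lambda>y. w y * of_real ((max 0 (d\<^sup>2 - z x y \<bullet> z x y))\<^sup>2)))
     (\<lambda>j. bint (\<lambda>y. w y * of_real (4 * max 0 (d\<^sup>2 - z x y \<bullet> z x y) * z x y $ j))) x"
proof -
  have "bounded (w ` cball 0 1)" using cw by (intro compact_imp_bounded compact_continuous_image) auto
  then obtain M where "\<forall>y\<in>cball 0 1. norm (w y) \<le> M" by (auto simp: bounded_iff)
  then have M: "\<And>y. norm y \<le> 1 \<Longrightarrow> norm (w y) \<le> M" by simp
  have M0: "M \<ge> 0" using order_trans[OF norm_ge_zero M[of 0]] by simp
  have cz: "cb (z x)" for x unfolding z_def by (intro continuous_intros)
  have ck: "cb (\<lambda>y. w y * of_real ((max 0 (d\<^sup>2 - z x y \<bullet> z x y))\<^sup>2))" for x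
    unfolding z_def by (intro continuous_intros cw)
  have cD: "cb (\<lambda>y. w y * of_real (4 * max 0 (d\<^sup>2 - z x y \<bullet> z x y) * z x y $ j))" for x j
    unfolding z_def by (intro continuous_intros cw)
  show ?thesis
  \<comment> \<open>51 = 49 + 2. The increment of the argument of \<open>max 0\<close> is at most 7
    d |h|, namely 2 * 3d |h| plus |h|^2 <= d |h|, whose square gives 49; its second-order term
    |h|^2, multiplied by \<open>2 * max 0 a\<close>, gives 2.\<close>
  proof (rule has_grad_quadratic[OF d, where C="W0 * (M * (51 * d\<^sup>2))"])
    fix h :: "real^3" assume h: "norm h < d"
    have "bint (\<lambda>y. w y * of_real ((max 0 (d\<^sup>2 - z (x + h) y \<bullet> z (x + h) y))\<^sup>2))
       - bint (\<lambda>y. w y * of_real ((max 0 (d\<^sup>2 - z x y \<bullet> z x y))\<^sup>2))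
       - (\<Sum>j\<in>UNIV. of_real (h$j) * bint (\<lambda>y. w y * of_real (4 * max 0 (d\<^sup>2 - z x y \<bullet> z x y) * z x y $ j)))
      = bint (\<lambda>y. w y * of_real ((max 0 (d\<^sup>2 - z (x + h) y \<bullet> z (x + h) y))\<^sup>2)
          - w y * of_real ((max 0 (d\<^sup>2 - z x y \<bullet> z x y))\<^sup>2)
          - (\<Sum>j\<in>UNIV. of_real (h$j) * (w y * of_real (4 * max 0 (d\<^sup>2 - z x y \<bullet> z x y) * z x y $ j))))"
    proof -
      let ?A = "\<lambda>y. w y * of_real ((max 0 (d\<^sup>2 - z (x + h) y \<bullet> z (x + h) y))\<^sup>2)"
      let ?B = "\<lambda>y. w y * of_real ((max 0 (d\<^sup>2 - z x y \<bullet> z x y))\<^sup>2)"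
      let ?C = "\<lambda>j y. of_real (h$j) * (w y * of_real (4 * max 0 (d\<^sup>2 - z x y \<bullet> z x y) * z x y $ j))"
      have "bint (\<lambda>y. ?A y - ?B y - (\<Sum>j\<in>UNIV. ?C j y)) = bint (\<lambda>y. ?A y - ?B y) - bint (\<lambda>y. \<Sum>j\<in>UNIV. ?C j y)"
        by (rule bint_diff; intro continuous_intros cw cz)
      moreover have "bint (\<lambda>y. ?A y - ?B y) = bint ?A - bint ?B"
        by (rule bint_diff[OF ck ck])
      moreover have "bint (\<lambda>y. \<Sum>j\<in>UNIV. ?C j y) = (\<Sum>j\<in>UNIV. bint (?C j))"
        by (rule bint_sum) (simp, intro continuous_intros cw cz)
      ultimately show ?thesis by (simp only: bint_cmult)
    qed
    also have "norm \<dots> \<le> W0 * (M * (51 * d\<^sup>2 * (norm h)\<^sup>2))"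
    proof (rule bint_bound)
      show "cb (\<lambda>y. w y * of_real ((max 0 (d\<^sup>2 - z (x + h) y \<bullet> z (x + h) y))\<^sup>2)
          - w y * of_real ((max 0 (d\<^sup>2 - z x y \<bullet> z x y))\<^sup>2)
          - (\<Sum>j\<in>UNIV. of_real (h$j) * (w y * of_real (4 * max 0 (d\<^sup>2 - z x y \<bullet> z x y) * z x y $ j))))"
        by (intro continuous_intros cw cz)
      fix y :: "real^3" assume y: "norm y < 1"
      define a where "a = d\<^sup>2 - z x y \<bullet> z x y"
      define b where "b = d\<^sup>2 - z (x + h) y \<bullet> z (x + h) y"
      have zz: "z (x + h) y = z x y - h" by (simp add: z_def)
      have ba: "b - a = 2 * (z x y \<bullet> h) - h \<bullet> h"
        unfolding a_def b_def zz by (simp add: algebra_simps inner_commute)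
      have nz: "norm (z x y) \<le> 3 * d"
      proof -
        have "norm (z x y) = norm ((2 * d) *\<^sub>R y - (x - x0))" by (simp add: z_def algebra_simps)
        also have "\<dots> \<le> norm ((2 * d) *\<^sub>R y) + norm (x - x0)" by (rule norm_triangle_ineq4)
        also have "\<dots> \<le> 2 * d + d" using x y d by (intro add_mono) auto
        finally show ?thesis by simp
      qed
      have zh: "\<bar>z x y \<bullet> h\<bar> \<le> 3 * d * norm h"
        using Cauchy_Schwarz_ineq2[of "z x y" h] nz by (meson mult_right_mono norm_ge_zero order_trans)
      have "\<bar>b - a\<bar> \<le> 7 * d * norm h"
      proof -
        have "h \<bullet> h \<le> d * norm h" using h by (simp add: dot_square_norm power2_eq_square mult_right_mono)
        moreover have "h \<bullet> h \<ge> 0" by simp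
        ultimately show ?thesis using zh unfolding ba by linarith
      qed
      then have "\<bar>b - a\<bar>\<^sup>2 \<le> (7 * d * norm h)\<^sup>2" by (rule power_mono) simp
      then have ba2: "(b - a)\<^sup>2 \<le> 49 * d\<^sup>2 * (norm h)\<^sup>2" by (simp add: power_mult_distrib)
      have ma: "0 \<le> max 0 a" "max 0 a \<le> d\<^sup>2" by (auto simp: a_def)
      have rem: "\<bar>(max 0 b)\<^sup>2 - (max 0 a)\<^sup>2 - 4 * max 0 a * (z x y \<bullet> h)\<bar> \<le> 51 * d\<^sup>2 * (norm h)\<^sup>2"
      proof -
        have "(max 0 b)\<^sup>2 - (max 0 a)\<^sup>2 - 4 * max 0 a * (z x y \<bullet> h) =
           ((max 0 b)\<^sup>2 - (max 0 a)\<^sup>2 - 2 * max 0 a * (b - a)) - 2 * (max 0 a * (h \<bullet> h))"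
          unfolding ba by (simp add: algebra_simps)
        moreover have "max 0 a * (h \<bullet> h) \<le> d\<^sup>2 * (norm h)\<^sup>2" "0 \<le> max 0 a * (h \<bullet> h)"
          using ma by (auto simp: dot_square_norm intro!: mult_right_mono)
        ultimately show ?thesis using max_sq_remainder[of b a] ba2 by linarith
      qed
      have "w y * of_real ((max 0 b)\<^sup>2) - w y * of_real ((max 0 a)\<^sup>2)
          - (\<Sum>j\<in>UNIV. of_real (h$j) * (w y * of_real (4 * max 0 a * z x y $ j)))
          = w y * of_real ((max 0 b)\<^sup>2 - (max 0 a)\<^sup>2 - 4 * max 0 a * (z x y \<bullet> h))"
        by (simp add: inner_vec_def sum_distrib_left algebra_simps)
      also have "norm \<dots> \<le> M * (51 * d\<^sup>2 * (norm h)\<^sup>2)"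
        unfolding norm_mult norm_of_real using M[of y] y rem M0 by (intro mult_mono) auto
      finally show "norm (w y * of_real ((max 0 (d\<^sup>2 - z (x + h) y \<bullet> z (x + h) y))\<^sup>2)
          - w y * of_real ((max 0 (d\<^sup>2 - z x y \<bullet> z x y))\<^sup>2)
          - (\<Sum>j\<in>UNIV. of_real (h$j) * (w y * of_real (4 * max 0 (d\<^sup>2 - z x y \<bullet> z x y) * z x y $ j))))
         \<le> M * (51 * d\<^sup>2 * (norm h)\<^sup>2)"
        unfolding a_def b_def .
    qed
    finally show "norm (bint (\<lambda>y. w y * of_real ((max 0 (d\<^sup>2 - z (x + h) y \<bullet> z (x + h) y))\<^sup>2))
       - bint (\<lambda>y. w y * of_real ((max 0 (d\<^sup>2 - z x y \<bullet> z x y))\<^sup>2))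
       - (\<Sum>j\<in>UNIV. of_real (h$j) * bint (\<lambda>y. w y * of_real (4 * max 0 (d\<^sup>2 - z x y \<bullet> z x y) * z x y $ j))))
       \<le> W0 * (M * (51 * d\<^sup>2)) * (norm h)\<^sup>2"
      by (simp add: mult_ac)
  qed
qed

text \<open>Near \<open>x0\<close> the function is an integral against a kernel that is C^1 in
  \<open>x\<close>; differentiation falls on the kernel, and the resulting parameter integrals are
  continuous.\<close>

lemma mean_value_on_has_grad_aux:
  assumes MV: "mean_value_on U v" and x0: "x0 \<in> U"
  shows "\<exists>d>0. \<forall>j. (\<forall>x\<in>ball x0 d. has_grad v (\<lambda>j. partial j v x) x) \<and> continuous_on (ball x0 d) (partial j v)"
proof -
  have "open U" using MV by (simp add: mean_value_on_def)
  then obtain e where e: "e > 0" "cball x0 e \<subseteq> U" using x0 open_contains_cball by blast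
  define d where "d = e / 2"
  have d: "d > 0" "cball x0 (2 * d) \<subseteq> U" using e by (auto simp: d_def)
  define w where "w y = v (x0 + (2 * d) *\<^sub>R y)" for y
  define z where "z x y = x0 + (2 * d) *\<^sub>R y - x" for x y
  define C where "C = 8 / (of_real (d^4) * bint (\<lambda>y. uc y ^ 2))"
  define D where "D j x = bint (\<lambda>y. w y * of_real (4 * max 0 (d\<^sup>2 - z x y \<bullet> z x y) * z x y $ j))" for j x
  have cU: "continuous_on U v" using MV by (simp add: mean_value_on_def)
  have cw: "cb w"
    unfolding w_def by (rule cb_affine[OF cU d(2)]) (use d in auto)
  have rep: "v x = C * bint (\<lambda>y. w y * of_real ((max 0 (d\<^sup>2 - z x y \<bullet> z x y))\<^sup>2))" if "x \<in> ball x0 d" for x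
    using mean_value_on_kernel[OF MV d, of x] that d N2_nz
    by (simp add: C_def w_def z_def dist_norm norm_minus_commute field_simps)
  have g: "has_grad v (\<lambda>j. C * D j x) x" if "x \<in> ball x0 d" for x
  proof (rule has_grad_cong_open[OF _ open_ball that])
    show "has_grad (\<lambda>x. C * bint (\<lambda>y. w y * of_real ((max 0 (d\<^sup>2 - z x y \<bullet> z x y))\<^sup>2))) (\<lambda>j. C * D j x) x"
      unfolding D_def z_def using that
      by (intro has_grad_cmult kernel_has_grad[OF cw d(1)]) (auto simp: dist_norm norm_minus_commute)
  qed (simp add: rep)
  have p: "partial j v x = C * D j x" if "x \<in> ball x0 d" for j x
    by (rule has_grad_partial[OF g[OF that]])
  have "continuous_on (cball x0 d) (D j)" for j
  proof -
    have "continuous_on (cball x0 d \<times> cball 0 1) (w \<circ> snd)"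
      by (intro continuous_on_compose continuous_on_snd continuous_on_id continuous_on_subset[OF cw]) auto
    then show ?thesis
      unfolding D_def z_def
      by (intro continuous_on_bint compact_cball)
         (auto simp: case_prod_unfold o_def intro!: continuous_intros)
  qed
  then have "continuous_on (ball x0 d) (\<lambda>x. C * D j x)" for j
    by (intro continuous_intros) (meson ball_subset_cball continuous_on_subset)
  then have "continuous_on (ball x0 d) (partial j v)" for j
    by (subst continuous_on_cong[OF refl p]) auto
  then show ?thesis using d g p by (intro exI[of _ d]) (auto intro: has_grad_eq)
qed

lemma mean_value_on_has_grad: "mean_value_on U v \<Longrightarrow> x \<in> U \<Longrightarrow> has_grad v (\<lambda>j. partial j v x) x"
  using mean_value_on_has_grad_aux by (metis centre_in_ball)

lemma mean_value_on_continuous_partial: assumes "mean_value_on U v" shows "continuous_on U (partial j v)"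
proof (rule continuous_at_imp_continuous_on, rule ballI)
  fix x assume "x \<in> U"
  then obtain d where "d > 0" "continuous_on (ball x d) (partial j v)"
    using mean_value_on_has_grad_aux[OF assms] by blast
  then show "isCont (partial j v) x" by (simp add: continuous_on_eq_continuous_at)
qed

text \<open>The mean value identity is differentiated as the centre is translated along a coordinate
  axis. Since the conclusion has the form of the hypothesis, iteration yields derivatives of all
  orders.\<close>

lemma mean_value_on_partial:
  assumes MV: "mean_value_on U v" shows "mean_value_on U (partial j v)"
  unfolding mean_value_on_def
proof (intro conjI allI impI)
  show oU: "open U" using MV by (simp add: mean_value_on_def)
  show "continuous_on U (partial j v)" by (rule mean_value_on_continuous_partial[OF MV])
  fix x d assume d: "d > 0" and sub: "cball x d \<subseteq> U"
  have cU: "continuous_on U v" using MV by (simp add: mean_value_on_def)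
  \<comment> \<open>Room around the whole closed ball, so that its centre may be shifted along
    \<open>E\<close> without leaving \<open>U\<close>.\<close>
  obtain e where e: "e > 0" "(\<Union>z\<in>cball x d. cball z e) \<subseteq> U"
    using compact_subset_open_imp_cball_epsilon_subset[OF compact_cball oU sub] by blast
  define E where "E = (axis j 1 :: real^3)"
  have E: "norm E = 1" by (simp add: E_def norm_axis_1)
  have mem: "x + s *\<^sub>R E + d *\<^sub>R y \<in> U" if "\<bar>s\<bar> \<le> e" "norm y \<le> 1" for s y
  proof -
    have "x + d *\<^sub>R y \<in> cball x d" using that d by (simp add: dist_norm mult_left_le)
    moreover have "x + s *\<^sub>R E + d *\<^sub>R y \<in> cball (x + d *\<^sub>R y) e" using that E by (simp add: dist_norm algebra_simps)
    ultimately show ?thesis using e(2) by blast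
  qed
  have sub': "cball (x + s *\<^sub>R E) d \<subseteq> U" if "\<bar>s\<bar> \<le> e" for s
  proof
    fix p assume "p \<in> cball (x + s *\<^sub>R E) d"
    then have "norm (p - (x + s *\<^sub>R E)) \<le> d" by (simp add: dist_norm norm_minus_commute)
    then have "norm ((p - (x + s *\<^sub>R E)) /\<^sub>R d) \<le> 1" using d by (simp add: pos_divide_le_eq flip: divide_inverse_commute)
    from mem[OF that this] show "p \<in> U" using d by simp
  qed
  have dE: "(\<Sum>i\<in>UNIV. of_real (E$i) * partial i v p) = partial j v p" for p
  proof -
    have "(\<Sum>i\<in>UNIV. of_real (E$i) * partial i v p) = (\<Sum>i\<in>UNIV. if i = j then partial i v p else 0)"
      by (rule sum.cong) (auto simp: E_def axis_def)
    then show ?thesis by simp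
  qed
  have 1: "((\<lambda>s. bint (\<lambda>y. v (x + s *\<^sub>R E + d *\<^sub>R y) * uc y ^ 2)) has_vector_derivative
      bint (\<lambda>y. partial j v (x + 0 *\<^sub>R E + d *\<^sub>R y) * uc y ^ 2)) (at 0)"
  proof (rule bint_has_vector_derivative'[OF e(1)])
    fix s :: real assume s: "s \<in> ball 0 e"
    show "cb (\<lambda>y. v (x + s *\<^sub>R E + d *\<^sub>R y) * uc y ^ 2)"
      by (intro continuous_intros cb_affine[OF cU sub']) (use s d in auto)
    fix y :: "real^3" assume y: "norm y < 1"
    have "x + d *\<^sub>R y + s *\<^sub>R E \<in> U" using mem[of s y] s y by (simp add: algebra_simps)
    from has_grad_ray[OF mean_value_on_has_grad[OF MV this]]
    have "((\<lambda>s. v (x + d *\<^sub>R y + s *\<^sub>R E)) has_vector_derivative partial j v (x + d *\<^sub>R y + s *\<^sub>R E)) (at s)"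
      by (simp only: dE)
    then have "((\<lambda>s. v (x + s *\<^sub>R E + d *\<^sub>R y)) has_vector_derivative partial j v (x + s *\<^sub>R E + d *\<^sub>R y)) (at s)"
      by (simp add: algebra_simps)
    then show "((\<lambda>s. v (x + s *\<^sub>R E + d *\<^sub>R y) * uc y ^ 2) has_vector_derivative partial j v (x + s *\<^sub>R E + d *\<^sub>R y) * uc y ^ 2) (at s)"
      by (rule has_vector_derivative_mult_left)
  next
    show "continuous_on (cball 0 e \<times> cball 0 1) (\<lambda>(s, y). partial j v (x + s *\<^sub>R E + d *\<^sub>R y) * uc y ^ 2)"
    proof -
      have "continuous_on (cball 0 e \<times> cball 0 1) (\<lambda>p. partial j v (x + fst p *\<^sub>R E + d *\<^sub>R snd p))"
        by (rule continuous_on_compose2[OF mean_value_on_continuous_partial[OF MV]])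
           (auto intro!: continuous_intros mem)
      moreover have "continuous_on (cball 0 e \<times> cball 0 1) (\<lambda>p::real \<times> (real^3). uc (snd p))"
        unfolding uc_def by (intro continuous_intros)
      ultimately show ?thesis by (auto simp: case_prod_unfold intro!: continuous_intros)
    qed
  qed
  have 2: "((\<lambda>s. bint (\<lambda>y. v (x + s *\<^sub>R E + d *\<^sub>R y) * uc y ^ 2)) has_vector_derivative
      partial j v x * bint (\<lambda>y. uc y ^ 2)) (at 0)"
  proof (rule has_vector_derivative_transform_within_open)
    have "x + 0 *\<^sub>R E \<in> U" using sub d by auto
    from has_grad_ray[OF mean_value_on_has_grad[OF MV this]]
    have "((\<lambda>s. v (x + s *\<^sub>R E)) has_vector_derivative partial j v x) (at 0)"
      unfolding dE by simp
    then show "((\<lambda>s. v (x + s *\<^sub>R E) * bint (\<lambda>y. uc y ^ 2)) has_vector_derivative partial j v x * bint (\<lambda>y. uc y ^ 2)) (at 0)"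
      by (rule has_vector_derivative_mult_left)
    show "v (x + s *\<^sub>R E) * bint (\<lambda>y. uc y ^ 2) = bint (\<lambda>y. v (x + s *\<^sub>R E + d *\<^sub>R y) * uc y ^ 2)" if "s \<in> ball 0 e" for s
      using MV d sub'[of s] that by (simp add: mean_value_on_def)
  qed (use e in auto)
  show "bint (\<lambda>y. partial j v (x + d *\<^sub>R y) * uc y ^ 2) = partial j v x * bint (\<lambda>y. uc y ^ 2)"
    using vector_derivative_unique_at[OF 1 2] by simp
qed

lemma mean_value_on_affine_grad:
  assumes MV: "mean_value_on U v" and sub: "cball x d \<subseteq> U" and d: "d \<ge> 0"
  shows "y \<in> cball 0 1 \<Longrightarrow> has_grad (\<lambda>y. v (x + d *\<^sub>R y)) (\<lambda>j. of_real d * partial j v (x + d *\<^sub>R y)) y"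
    and "cb (\<lambda>y. v (x + d *\<^sub>R y))" "cb (\<lambda>y. partial j v (x + d *\<^sub>R y))"
    "cb (\<lambda>y. of_real d * partial j v (x + d *\<^sub>R y))"
proof -
  show "has_grad (\<lambda>y. v (x + d *\<^sub>R y)) (\<lambda>j. of_real d * partial j v (x + d *\<^sub>R y)) y" if "y \<in> cball 0 1"
    by (rule has_grad_affine[OF mean_value_on_has_grad[OF MV]]) (use cball_affine_mem[OF sub d] that in auto)
  show "cb (\<lambda>y. v (x + d *\<^sub>R y))"
    by (rule cb_affine[OF _ sub d]) (use MV in \<open>simp add: mean_value_on_def\<close>)
  show "cb (\<lambda>y. partial j v (x + d *\<^sub>R y))"
    by (rule cb_affine[OF mean_value_on_continuous_partial[OF MV] sub d])
  then show "cb (\<lambda>y. of_real d * partial j v (x + d *\<^sub>R y))" by (intro continuous_intros)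
qed

text \<open>Integration by parts rewrites the mean of a mixed second derivative as a first-order
  moment of one partial. The moments for the two orders differ by an integral of the type in
  \<open>bint_curl\<close>, which is zero, and the mean value property turns equality of means into
  equality at the centre.\<close>

lemma partial_commute:
  assumes MV: "mean_value_on U v" and x: "x \<in> U"
  shows "partial i (partial j v) x = partial j (partial i v) x"
proof -
  have "open U" using MV by (simp add: mean_value_on_def)
  then obtain d where d: "d > 0" "cball x d \<subseteq> U" using x open_contains_cball by blast
  then have d0: "d \<ge> 0" by simp
  have P: "bint (\<lambda>y. of_real d * partial i (partial j v) (x + d *\<^sub>R y) * uc y ^ Suc 1)
      = 2 * of_nat (Suc 1) * bint (\<lambda>y. partial j v (x + d *\<^sub>R y) * of_real (y$i) * uc y ^ 1)" for i j
    by (rule bint_by_parts) (rule mean_value_on_affine_grad[OF mean_value_on_partial[OF MV] d(2) d0]; assumption)+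
  have E: "of_real d * (partial i (partial j v) x * bint (\<lambda>y. uc y ^ 2))
      = 4 * bint (\<lambda>y. partial j v (x + d *\<^sub>R y) * of_real (y$i) * uc y)" for i j
  proof -
    have "bint (\<lambda>y. partial i (partial j v) (x + d *\<^sub>R y) * uc y ^ 2) = partial i (partial j v) x * bint (\<lambda>y. uc y ^ 2)"
      using mean_value_on_partial[OF mean_value_on_partial[OF MV]] d by (simp add: mean_value_on_def)
    moreover have "bint (\<lambda>y. of_real d * partial i (partial j v) (x + d *\<^sub>R y) * uc y ^ Suc 1)
       = of_real d * bint (\<lambda>y. partial i (partial j v) (x + d *\<^sub>R y) * uc y ^ 2)"
      by (simp add: bint_cmult mult.assoc numeral_2_eq_2)
    ultimately show ?thesis using P[of i j] by simp
  qed
  have "bint (\<lambda>y. (of_real d * partial j v (x + d *\<^sub>R y) * of_real (y$i) - of_real d * partial i v (x + d *\<^sub>R y) * of_real (y$j)) * uc y ^ Suc 0) = 0"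
    by (rule bint_curl) (rule mean_value_on_affine_grad[OF MV d(2) d0]; assumption)+
  moreover have "bint (\<lambda>y. (of_real d * partial j v (x + d *\<^sub>R y) * of_real (y$i) - of_real d * partial i v (x + d *\<^sub>R y) * of_real (y$j)) * uc y ^ Suc 0)
     = bint (\<lambda>y. of_real d * (partial j v (x + d *\<^sub>R y) * of_real (y$i) * uc y) - of_real d * (partial i v (x + d *\<^sub>R y) * of_real (y$j) * uc y))"
    by (simp add: algebra_simps)
  moreover have "\<dots> = of_real d * bint (\<lambda>y. partial j v (x + d *\<^sub>R y) * of_real (y$i) * uc y) - of_real d * bint (\<lambda>y. partial i v (x + d *\<^sub>R y) * of_real (y$j) * uc y)"
    by (subst bint_diff) (intro continuous_intros mean_value_on_affine_grad[OF MV d(2) d0] | simp add: bint_cmult)+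
  ultimately have "of_real d * (partial i (partial j v) x * bint (\<lambda>y. uc y ^ 2))
      = of_real d * (partial j (partial i v) x * bint (\<lambda>y. uc y ^ 2))"
    using d unfolding E by simp
  then show ?thesis using d N2_nz by simp
qed

section \<open>Harmonic functions and their homogeneous parts\<close>

lemma bint_ray_derivative:
  assumes der: "\<And>p. p \<in> ball x D \<Longrightarrow> has_grad v (\<lambda>j. dv j p) p"
    and cont: "\<And>j. continuous_on (ball x D) (dv j)" and cq: "cb q" and t0: "\<bar>t0\<bar> < D"
  shows "((\<lambda>t. bint (\<lambda>y. v (x + t *\<^sub>R y) * q y)) has_vector_derivative
     bint (\<lambda>y. (\<Sum>j\<in>UNIV. of_real (y$j) * dv j (x + t0 *\<^sub>R y)) * q y)) (at t0)"
proof (rule bint_has_vector_derivative')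
  define e where "e = (D - \<bar>t0\<bar>) / 2"
  show e: "e > 0" using t0 by (simp add: e_def)
  have tD: "\<bar>t\<bar> < D" if "t \<in> cball t0 e" for t
    using that t0 by (auto simp: e_def dist_real_def field_simps abs_if split: if_splits)
  have mem: "x + t *\<^sub>R y \<in> ball x D" if "t \<in> cball t0 e" "norm y \<le> 1" for t y
  proof -
    have "\<bar>t\<bar> * norm y \<le> \<bar>t\<bar>" using that by (simp add: mult_left_le)
    then show ?thesis using tD[OF that(1)] by (simp add: dist_norm)
  qed
  have cv: "continuous_on (ball x D) v" using der by (rule has_grad_imp_continuous_on)
  show "cb (\<lambda>y. v (x + t *\<^sub>R y) * q y)" if "t \<in> ball t0 e" for t
    by (intro continuous_intros cq continuous_on_compose2[OF cv]) (use that mem[of t] in auto)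
  show "continuous_on (cball t0 e \<times> cball 0 1) (\<lambda>(t, y). (\<Sum>j\<in>UNIV. of_real (y$j) * dv j (x + t *\<^sub>R y)) * q y)"
  proof -
    have "continuous_on (cball t0 e \<times> cball 0 1) (\<lambda>p. dv j (x + fst p *\<^sub>R snd p))" for j
      by (rule continuous_on_compose2[OF cont]) (use mem in \<open>auto intro!: continuous_intros\<close>)
    moreover have "continuous_on (cball t0 e \<times> cball 0 1) (\<lambda>p. q (snd p))"
      by (rule continuous_on_compose2[OF cq]) (auto intro!: continuous_intros)
    ultimately show ?thesis by (auto simp: case_prod_unfold intro!: continuous_intros)
  qed
  show "((\<lambda>t. v (x + t *\<^sub>R y) * q y) has_vector_derivative (\<Sum>j\<in>UNIV. of_real (y$j) * dv j (x + t *\<^sub>R y)) * q y) (at t)"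
    if "t \<in> ball t0 e" "norm y < 1" for t y
    by (intro has_vector_derivative_mult_left has_grad_ray der mem) (use that in auto)
qed

text \<open>The derivative of the weighted mean with respect to the radius is the integral in
  \<open>zero\<close>, so the mean keeps its value at radius 0. Positive radii suffice because
  continuity covers the endpoint; this matters since \<open>mono_curl\<close> divides by the
  radius.\<close>

lemma bint_ray_const:
  assumes oU: "open U" and der: "\<And>p. p \<in> U \<Longrightarrow> has_grad v (\<lambda>j. dv j p) p"
    and cont: "\<And>j. continuous_on U (dv j)" and cq: "cb q"
    and d: "d > 0" and sub: "cball x d \<subseteq> U"
    and zero: "\<And>t. 0 < t \<Longrightarrow> t \<le> d \<Longrightarrow> bint (\<lambda>y. (\<Sum>j\<in>UNIV. of_real (y$j) * dv j (x + t *\<^sub>R y)) * q y) = 0"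
  shows "bint (\<lambda>y. v (x + d *\<^sub>R y) * q y) = v x * bint q"
proof -
  obtain e where e: "e > 0" "(\<Union>z\<in>cball x d. ball z e) \<subseteq> U"
    using compact_subset_open_imp_ball_epsilon_subset[OF compact_cball oU sub] by blast
  \<comment> \<open>Differentiating at the final radius \<open>d\<close> requires an open ball
    reaching beyond it. A point outside the closed ball is compared with its radial projection
    \<open>z\<close>.\<close>
  have subD: "ball x (d + e) \<subseteq> U"
  proof
    fix p assume p: "p \<in> ball x (d + e)"
    show "p \<in> U"
    proof (cases "dist x p \<le> d")
      case True then show ?thesis using sub by auto
    next
      case False
      define z where "z = x + (d / dist x p) *\<^sub>R (p - x)"
      have xp: "x \<noteq> p" using False d by auto
      then have "z \<in> cball x d" using False d by (simp add: z_def dist_norm norm_minus_commute)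
      moreover have "p \<in> ball z e"
      proof -
        have "p - z = (1 - d / dist x p) *\<^sub>R (p - x)" by (simp add: z_def algebra_simps)
        then have "dist z p = \<bar>1 - d / dist x p\<bar> * dist x p" by (simp add: dist_norm norm_minus_commute)
        also have "\<dots> = dist x p - d" using False d xp by (simp add: abs_if field_simps)
        finally show ?thesis using p by simp
      qed
      ultimately show ?thesis using e(2) by blast
    qed
  qed
  let ?M = "\<lambda>t. bint (\<lambda>y. v (x + t *\<^sub>R y) * q y)"
  let ?M' = "\<lambda>t. bint (\<lambda>y. (\<Sum>j\<in>UNIV. of_real (y$j) * dv j (x + t *\<^sub>R y)) * q y)"
  have M: "(?M has_vector_derivative ?M' t) (at t)" if "t \<in> {0..d}" for t
    by (rule bint_ray_derivative[where D="d + e"])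
       (use der subD cont cq that e in \<open>auto intro: continuous_on_subset\<close>)
  have "?M d = ?M 0"
  proof (rule has_derivative_zero_unique_strong_interval[where k="{0}" and a=0 and b=d])
    show "continuous_on {0..d} ?M"
      by (intro continuous_at_imp_continuous_on ballI has_vector_derivative_continuous[OF M]) auto
    fix t assume t: "t \<in> {0..d} - {0}"
    then have "?M' t = 0" by (intro zero) auto
    then show "(?M has_derivative (\<lambda>h. 0)) (at t within {0..d})"
      using M[of t] t by (auto simp: has_vector_derivative_def intro: has_derivative_at_withinI)
  qed (use d in auto)
  then show ?thesis by (simp add: bint_cmult)
qed

lemma mean_value_onI:
  assumes oU: "open U" and der: "\<And>p. p \<in> U \<Longrightarrow> has_grad v (\<lambda>j. dv j p) p"
    and cont: "\<And>j. continuous_on U (dv j)"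
    and zero: "\<And>x t. cball x \<bar>t\<bar> \<subseteq> U \<Longrightarrow> t \<noteq> 0 \<Longrightarrow> bint (\<lambda>y. (\<Sum>j\<in>UNIV. of_real (y$j) * dv j (x + t *\<^sub>R y)) * uc y ^ 2) = 0"
  shows "mean_value_on U v"
  unfolding mean_value_on_def
proof (intro conjI allI impI oU)
  show "continuous_on U v" using der by (rule has_grad_imp_continuous_on)
  fix x d assume d: "d > 0" and sub: "cball x d \<subseteq> U"
  show "bint (\<lambda>y. v (x + d *\<^sub>R y) * uc y ^ 2) = v x * bint (\<lambda>y. uc y ^ 2)"
  proof (rule bint_ray_const[OF oU der cont _ d sub zero])
    fix t :: real assume "0 < t" "t \<le> d"
    then show "cball x \<bar>t\<bar> \<subseteq> U" using sub by (auto simp: subset_iff)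
  qed (auto intro!: continuous_intros)
qed

lemma mean_value_on_lin:
  assumes v: "mean_value_on U v" and w: "mean_value_on U w"
  shows "mean_value_on U (\<lambda>x. a * v x + b * w x)"
  unfolding mean_value_on_def
proof (intro conjI allI impI)
  show "open U" using v by (simp add: mean_value_on_def)
  show "continuous_on U (\<lambda>x. a * v x + b * w x)" using v w by (auto simp: mean_value_on_def intro!: continuous_intros)
  fix x d assume d: "d > 0" "cball x d \<subseteq> U"
  then have d0: "d \<ge> 0" by simp
  have "bint (\<lambda>y. (a * v (x + d *\<^sub>R y) + b * w (x + d *\<^sub>R y)) * uc y ^ 2)
      = bint (\<lambda>y. a * (v (x + d *\<^sub>R y) * uc y ^ 2) + b * (w (x + d *\<^sub>R y) * uc y ^ 2))"
    by (simp add: algebra_simps)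
  also have "\<dots> = a * bint (\<lambda>y. v (x + d *\<^sub>R y) * uc y ^ 2) + b * bint (\<lambda>y. w (x + d *\<^sub>R y) * uc y ^ 2)"
    by (subst bint_add) (intro continuous_intros mean_value_on_affine_grad[OF v d(2) d0] mean_value_on_affine_grad[OF w d(2) d0] | simp add: bint_cmult)+
  also have "\<dots> = (a * v x + b * w x) * bint (\<lambda>y. uc y ^ 2)"
    using v w d by (simp add: mean_value_on_def algebra_simps)
  finally show "bint (\<lambda>y. (a * v (x + d *\<^sub>R y) + b * w (x + d *\<^sub>R y)) * uc y ^ 2) = (a * v x + b * w x) * bint (\<lambda>y. uc y ^ 2)" .
qed

lemma partial_lin:
  assumes "mean_value_on U v" "mean_value_on U w" "x \<in> U"
  shows "partial j (\<lambda>x. a * v x + b * w x) x = a * partial j v x + b * partial j w x"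
  by (rule has_grad_partial[OF has_grad_add[OF has_grad_cmult has_grad_cmult]])
     (use assms mean_value_on_has_grad in auto)

lemma partial_partial_lin:
  assumes "mean_value_on U v" "mean_value_on U w" "x \<in> U"
  shows "partial i (partial j (\<lambda>x. a * v x + b * w x)) x = a * partial i (partial j v) x + b * partial i (partial j w) x"
proof -
  have "open U" using assms by (simp add: mean_value_on_def)
  then have "partial i (partial j (\<lambda>x. a * v x + b * w x)) x = partial i (\<lambda>x. a * partial j v x + b * partial j w x) x"
    by (rule partial_cong_open) (use assms in \<open>auto simp: partial_lin\<close>)
  then show ?thesis using partial_lin[OF mean_value_on_partial mean_value_on_partial] assms by simp
qed

text \<open>The mean value clause carries the regularity: it guarantees that the iterated
  \<open>partial\<close> values in the Laplace equation are genuine derivatives and not values of a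
  choice operator.\<close>

definition harmonic_on :: "(real^3) set \<Rightarrow> (real^3 \<Rightarrow> complex) \<Rightarrow> bool" where
  "harmonic_on U v \<longleftrightarrow> mean_value_on U v \<and> (\<forall>x\<in>U. (\<Sum>j\<in>UNIV. partial j (partial j v) x) = 0)"

lemma harmonic_on_mean_value: "harmonic_on U v \<Longrightarrow> mean_value_on U v" by (simp add: harmonic_on_def)
lemma harmonic_on_open: "harmonic_on U v \<Longrightarrow> open U" by (simp add: harmonic_on_def mean_value_on_def)
lemma harmonic_on_continuous: "harmonic_on U v \<Longrightarrow> continuous_on U v" by (simp add: harmonic_on_def mean_value_on_def)

lemma harmonic_on_lin:
  assumes "harmonic_on U v" "harmonic_on U w"
  shows "harmonic_on U (\<lambda>x. a * v x + b * w x)"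
proof -
  have "(\<Sum>j\<in>UNIV. partial j (partial j (\<lambda>x. a * v x + b * w x)) x) = 0" if "x \<in> U" for x
  proof -
    have "(\<Sum>j\<in>UNIV. partial j (partial j (\<lambda>x. a * v x + b * w x)) x)
        = a * (\<Sum>j\<in>UNIV. partial j (partial j v) x) + b * (\<Sum>j\<in>UNIV. partial j (partial j w) x)"
      using assms that by (simp add: partial_partial_lin[OF harmonic_on_mean_value harmonic_on_mean_value] sum.distrib sum_distrib_left)
    then show ?thesis using assms that by (simp add: harmonic_on_def)
  qed
  then show ?thesis using assms by (simp add: harmonic_on_def mean_value_on_lin)
qed

lemma harmonic_on_partial:
  assumes h: "harmonic_on U v" shows "harmonic_on U (partial i v)"
  unfolding harmonic_on_def
proof (intro conjI ballI)
  have MV: "mean_value_on U v" by (rule harmonic_on_mean_value[OF h])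
  have oU: "open U" by (rule harmonic_on_open[OF h])
  show "mean_value_on U (partial i v)" by (rule mean_value_on_partial[OF MV])
  fix x assume x: "x \<in> U"
  have "partial j (partial j (partial i v)) x = partial i (partial j (partial j v)) x" for j
  proof -
    have "partial j (partial j (partial i v)) x = partial j (partial i (partial j v)) x"
      by (rule partial_cong_open[OF oU x]) (rule partial_commute[OF MV])
    also have "\<dots> = partial i (partial j (partial j v)) x" by (rule partial_commute[OF mean_value_on_partial[OF MV] x])
    finally show ?thesis .
  qed
  then have "(\<Sum>j\<in>UNIV. partial j (partial j (partial i v)) x) = (\<Sum>j\<in>UNIV. partial i (partial j (partial j v)) x)" by simp
  also have "\<dots> = partial i (\<lambda>x. \<Sum>j\<in>UNIV. partial j (partial j v) x) x"
    by (rule has_grad_partial[OF has_grad_sum, symmetric]) (rule mean_value_on_has_grad[OF mean_value_on_partial[OF mean_value_on_partial[OF MV]] x])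
  also have "\<dots> = partial i (\<lambda>x. 0) x"
    by (rule partial_cong_open[OF oU x]) (use h in \<open>simp add: harmonic_on_def\<close>)
  also have "\<dots> = 0" by (rule has_grad_partial[OF has_grad_const])
  finally show "(\<Sum>j\<in>UNIV. partial j (partial j (partial i v)) x) = 0" .
qed

lemma harmonic_onI:
  assumes oU: "open U" and der: "\<And>p. p \<in> U \<Longrightarrow> has_grad v (\<lambda>j. dv j p) p"
    and dder: "\<And>j p. p \<in> U \<Longrightarrow> has_grad (dv j) (\<lambda>i. ddv i j p) p"
    and cont: "\<And>i j. continuous_on U (ddv i j)"
    and zero: "\<And>p. p \<in> U \<Longrightarrow> (\<Sum>j\<in>UNIV. ddv j j p) = 0"
  shows "harmonic_on U v"
proof -
  have cdv: "continuous_on U (dv j)" for j using dder by (rule has_grad_imp_continuous_on)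
  have "mean_value_on U v"
  proof (rule mean_value_onI[OF oU der cdv])
    fix x :: "real^3" and t :: real assume sub: "cball x \<bar>t\<bar> \<subseteq> U" and t: "t \<noteq> 0"
    have mem: "x + t *\<^sub>R y \<in> U" if "y \<in> cball 0 1" for y
    proof -
      have "\<bar>t\<bar> * norm y \<le> \<bar>t\<bar>" using that by (simp add: mult_left_le)
      then show ?thesis using sub by (auto simp: subset_iff dist_norm)
    qed
    \<comment> \<open>Green's identity for the constant function 1: its left side is 0, so the
      weighted mean of the radial derivative vanishes.\<close>
    have "bint (\<lambda>y. (\<Sum>j\<in>UNIV. 0 * dv j (x + t *\<^sub>R y)) * uc y ^ Suc 2) =
       2 * of_nat (Suc 2) * bint (\<lambda>y. 1 * (\<Sum>j\<in>UNIV. of_real (y$j) * dv j (x + t *\<^sub>R y)) * uc y ^ 2)"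
    proof (rule bint_green[where ddq="\<lambda>j i y. of_real t * ddv i j (x + t *\<^sub>R y)"])
      show "cb (\<lambda>y. of_real t * ddv i j (x + t *\<^sub>R y))" for i j
        by (intro continuous_intros continuous_on_compose2[OF cont]) (use mem in auto)
    qed (auto intro!: has_grad_affine dder mem has_grad_const simp: zero[OF mem] simp flip: sum_distrib_left)
    then show "bint (\<lambda>y. (\<Sum>j\<in>UNIV. of_real (y$j) * dv j (x + t *\<^sub>R y)) * uc y ^ 2) = 0"
      by (simp add: bint_def set_lebesgue_integral_def)
  qed auto
  moreover have "partial j (partial j v) x = ddv j j x" if "x \<in> U" for x j
  proof -
    have "partial j (partial j v) x = partial j (dv j) x"
      by (rule partial_cong_open[OF oU that]) (rule has_grad_partial[OF der])
    then show ?thesis using has_grad_partial[OF dder[OF that]] by simp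
  qed
  ultimately show ?thesis by (simp add: harmonic_on_def zero)
qed

lemma harmonic_on_subset: assumes "harmonic_on U v" "open V" "V \<subseteq> U" shows "harmonic_on V v"
  using assms unfolding harmonic_on_def mean_value_on_def by (auto intro: continuous_on_subset)

section \<open>Iterated directional derivatives and homogeneous Taylor parts\<close>

primrec iter_deriv :: "nat \<Rightarrow> (real^3 \<Rightarrow> complex) \<Rightarrow> real^3 \<Rightarrow> real^3 \<Rightarrow> complex" where
  "iter_deriv 0 v y x = v x"
| "iter_deriv (Suc k) v y x = (\<Sum>j\<in>UNIV. of_real (y$j) * iter_deriv k (partial j v) y x)"

lemma iter_deriv_continuous: "mean_value_on U v \<Longrightarrow> continuous_on (U \<times> UNIV) (\<lambda>p. iter_deriv k v (snd p) (fst p))"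
proof (induction k arbitrary: v)
  case 0
  then show ?case by (auto simp: mean_value_on_def intro!: continuous_on_compose2[of U v] continuous_intros)
next
  case (Suc k)
  show ?case by (auto intro!: continuous_intros Suc mean_value_on_partial)
qed

lemma iter_deriv_cong: "open U \<Longrightarrow> x \<in> U \<Longrightarrow> (\<And>p. p \<in> U \<Longrightarrow> v p = w p) \<Longrightarrow> iter_deriv k v y x = iter_deriv k w y x"
proof (induction k arbitrary: v w)
  case (Suc k)
  have "iter_deriv k (partial j v) y x = iter_deriv k (partial j w) y x" for j
    using Suc.prems by (intro Suc.IH) (auto intro: partial_cong_open)
  then show ?case by simp
qed simp

lemma iter_deriv_lin: "mean_value_on U v \<Longrightarrow> mean_value_on U w \<Longrightarrow> x \<in> U \<Longrightarrow> iter_deriv k (\<lambda>x. a * v x + b * w x) y x = a * iter_deriv k v y x + b * iter_deriv k w y x"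
proof (induction k arbitrary: v w)
  case (Suc k)
  have "open U" using Suc.prems by (simp add: mean_value_on_def)
  then have "iter_deriv k (partial j (\<lambda>x. a * v x + b * w x)) y x = iter_deriv k (\<lambda>x. a * partial j v x + b * partial j w x) y x" for j
    using Suc.prems by (intro iter_deriv_cong) (auto intro: partial_lin)
  then have "iter_deriv k (partial j (\<lambda>x. a * v x + b * w x)) y x = a * iter_deriv k (partial j v) y x + b * iter_deriv k (partial j w) y x" for j
    using Suc.IH[OF mean_value_on_partial mean_value_on_partial] Suc.prems by simp
  then show ?case by (simp add: algebra_simps sum.distrib sum_distrib_left)
qed simp

lemma iter_deriv_derivative:
  "mean_value_on U v \<Longrightarrow> x + t *\<^sub>R y \<in> U \<Longrightarrow> ((\<lambda>t. iter_deriv k v y (x + t *\<^sub>R y)) has_vector_derivative iter_deriv (Suc k) v y (x + t *\<^sub>R y)) (at t)"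
proof (induction k arbitrary: v)
  case 0 then show ?case by (simp add: has_grad_ray[OF mean_value_on_has_grad])
next
  case (Suc k)
  have "((\<lambda>t. iter_deriv k (partial j v) y (x + t *\<^sub>R y)) has_vector_derivative iter_deriv (Suc k) (partial j v) y (x + t *\<^sub>R y)) (at t)" for j
    by (rule Suc.IH) (use Suc.prems mean_value_on_partial in auto)
  then show ?case unfolding iter_deriv.simps(2)[of "Suc k"] iter_deriv.simps(2)[of k v]
    by (intro has_vector_derivative_sum has_vector_derivative_mult_right) 
qed

lemma iter_deriv_homogeneous: "iter_deriv k v (s *\<^sub>R y) x = of_real s ^ k * iter_deriv k v y x"
  by (induction k arbitrary: v) (simp_all add: sum_distrib_left mult_ac)

text \<open>The homogeneous Taylor polynomial of degree \<open>n\<close> at the origin,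
  \<open>(y . grad)^n v(0) / n!\<close>.\<close>

definition hom_part :: "nat \<Rightarrow> (real^3 \<Rightarrow> complex) \<Rightarrow> real^3 \<Rightarrow> complex" where
  "hom_part n v y = iter_deriv n v y 0 / fact n"

lemma hom_part_0: "hom_part 0 v y = v 0" by (simp add: hom_part_def)

text \<open>Euler's identity for the Taylor parts. It reduces degree \<open>n + 1\<close> to degree
  \<open>n\<close> of the partials and drives the inductions on the degree below.\<close>

lemma hom_part_Suc: "of_nat (Suc n) * hom_part (Suc n) v y = (\<Sum>j\<in>UNIV. of_real (y$j) * hom_part n (partial j v) y)"
proof -
  have "of_nat (Suc n) * hom_part (Suc n) v y = iter_deriv (Suc n) v y 0 / fact n"
    by (simp add: hom_part_def del: iter_deriv.simps of_nat_Suc)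
  then show ?thesis by (simp add: hom_part_def sum_divide_distrib)
qed

lemma hom_part_homogeneous: "hom_part n v (s *\<^sub>R y) = of_real s ^ n * hom_part n v y"
  by (simp add: hom_part_def iter_deriv_homogeneous)

text \<open>Taking Taylor parts commutes with differentiation and lowers the degree by one. In the
  step, the product rule in Euler's identity yields \<open>n\<close> copies from the inner
  derivatives, merged by \<open>partial_commute\<close>, and one from the coordinate factor; the sum
  \<open>n + 1\<close> cancels the denominator.\<close>

lemma hom_part_grad: "mean_value_on U v \<Longrightarrow> 0 \<in> U \<Longrightarrow> has_grad (hom_part n v) (\<lambda>j. case n of 0 \<Rightarrow> 0 | Suc m \<Rightarrow> hom_part m (partial j v) y) y"
proof (induction n arbitrary: v)
  case 0 then show ?case by (simp add: hom_part_0[abs_def] has_grad_const)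
next
  case (Suc n)
  have oU: "open U" using Suc.prems by (simp add: mean_value_on_def)
  have TS: "hom_part (Suc n) v = (\<lambda>y. (1 / of_nat (Suc n)) * (\<Sum>i\<in>UNIV. of_real (y$i) * hom_part n (partial i v) y))"
    by (simp add: fun_eq_iff del: of_nat_Suc flip: hom_part_Suc)
  have sw: "(\<Sum>i\<in>UNIV. of_real (y$i) * (case n of 0 \<Rightarrow> 0 | Suc m \<Rightarrow> hom_part m (partial j (partial i v)) y)) = of_nat n * hom_part n (partial j v) y" for j
  proof (cases n)
    case (Suc m)
    have "hom_part m (partial j (partial i v)) y = hom_part m (partial i (partial j v)) y" for i
      unfolding hom_part_def using iter_deriv_cong[OF oU Suc.prems(2) partial_commute[OF Suc.prems(1)]] by simp
    then show ?thesis using Suc hom_part_Suc[of m "partial j v" y] by simp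
  qed simp
  show ?case
    unfolding TS
  proof (rule has_grad_eq)
    show "has_grad (\<lambda>y. (1 / of_nat (Suc n)) * (\<Sum>i\<in>UNIV. of_real (y$i) * hom_part n (partial i v) y))
      (\<lambda>j. (1 / of_nat (Suc n)) * (\<Sum>i\<in>UNIV. of_real (y$i) * (case n of 0 \<Rightarrow> 0 | Suc m \<Rightarrow> hom_part m (partial j (partial i v)) y)
          + (if j = i then 1 else 0) * hom_part n (partial i v) y)) y"
      by (intro has_grad_cmult has_grad_sum has_grad_mult has_grad_coord Suc.IH mean_value_on_partial Suc.prems)
    fix j
    have "(\<Sum>i\<in>UNIV. (if j = i then 1 else 0) * hom_part n (partial i v) y) = (\<Sum>i\<in>UNIV. if j = i then hom_part n (partial i v) y else 0)"
      by (rule sum.cong) auto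
    then have "(\<Sum>i\<in>UNIV. (if j = i then 1 else 0) * hom_part n (partial i v) y) = hom_part n (partial j v) y" by simp
    then show "(1 / of_nat (Suc n)) * (\<Sum>i\<in>UNIV. of_real (y$i) * (case n of 0 \<Rightarrow> 0 | Suc m \<Rightarrow> hom_part m (partial j (partial i v)) y)
          + (if j = i then 1 else 0) * hom_part n (partial i v) y) = (case Suc n of 0 \<Rightarrow> 0 | Suc m \<Rightarrow> hom_part m (partial j v) y)"
      using of_nat_neq_0[of n, where 'a=complex]
      unfolding sum.distrib sw by (simp add: divide_simps) (simp add: algebra_simps)
  qed
qed

lemma hom_part_Suc_grad: "mean_value_on U v \<Longrightarrow> 0 \<in> U \<Longrightarrow> has_grad (hom_part (Suc n) v) (\<lambda>j. hom_part n (partial j v) y) y"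
  using hom_part_grad[of U v "Suc n"] by simp

lemma hom_part_lin: "mean_value_on U v \<Longrightarrow> mean_value_on U w \<Longrightarrow> 0 \<in> U \<Longrightarrow> hom_part k (\<lambda>x. a * v x + b * w x) y = a * hom_part k v y + b * hom_part k w y"
  by (simp add: hom_part_def iter_deriv_lin add_divide_distrib)

lemma hom_part_cong: "open U \<Longrightarrow> 0 \<in> U \<Longrightarrow> (\<And>p. p \<in> U \<Longrightarrow> v p = w p) \<Longrightarrow> hom_part k v y = hom_part k w y"
  unfolding hom_part_def using iter_deriv_cong by metis

lemma iter_deriv_zero: "iter_deriv k (\<lambda>x. 0) y x = 0"
proof (induction k)
  case (Suc k)
  have "partial j (\<lambda>x::real^3. 0::complex) = (\<lambda>x. 0)" for j
    by (rule ext) (rule has_grad_partial[OF has_grad_const])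
  with Suc show ?case by simp
qed simp

lemma hom_part_continuous: "mean_value_on U v \<Longrightarrow> 0 \<in> U \<Longrightarrow> continuous_on S (hom_part n v)"
  by (rule has_grad_imp_continuous_on) (rule hom_part_grad)

text \<open>Total in the degree: the constant part receives the zero gradient, so that Green's
  identity applies to all degrees uniformly.\<close>

definition hom_grad :: "nat \<Rightarrow> 3 \<Rightarrow> (real^3 \<Rightarrow> complex) \<Rightarrow> real^3 \<Rightarrow> complex" where
  "hom_grad n j v = (case n of 0 \<Rightarrow> (\<lambda>y. 0) | Suc m \<Rightarrow> hom_part m (partial j v))"

definition hom_hess :: "nat \<Rightarrow> 3 \<Rightarrow> 3 \<Rightarrow> (real^3 \<Rightarrow> complex) \<Rightarrow> real^3 \<Rightarrow> complex" where
  "hom_hess n i j v = (case n of 0 \<Rightarrow> (\<lambda>y. 0) | Suc m \<Rightarrow> hom_grad m i (partial j v))"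

lemma hom_grad_simps [simp]: "hom_grad 0 j v = (\<lambda>y. 0)" "hom_grad (Suc m) j v = hom_part m (partial j v)"
  by (simp_all add: hom_grad_def)

lemma hom_hess_simps [simp]: "hom_hess 0 i j v = (\<lambda>y. 0)" "hom_hess (Suc m) i j v = hom_grad m i (partial j v)"
  by (simp_all add: hom_hess_def)

lemma hom_part_TG: "mean_value_on U v \<Longrightarrow> 0 \<in> U \<Longrightarrow> has_grad (hom_part n v) (\<lambda>j. hom_grad n j v y) y"
  using hom_part_grad[of U v n y] by (cases n) (auto simp: hom_grad_def)

lemma hom_grad_TH: "mean_value_on U v \<Longrightarrow> 0 \<in> U \<Longrightarrow> has_grad (hom_grad n j v) (\<lambda>i. hom_hess n i j v y) y"
  by (cases n) (auto simp: has_grad_const intro!: hom_part_TG[of U] mean_value_on_partial)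

lemma hom_grad_continuous: "mean_value_on U v \<Longrightarrow> 0 \<in> U \<Longrightarrow> continuous_on S (hom_grad n j v)"
  by (rule has_grad_imp_continuous_on) (rule hom_grad_TH)

lemma hom_hess_continuous: "mean_value_on U v \<Longrightarrow> 0 \<in> U \<Longrightarrow> continuous_on S (hom_hess n i j v)"
  by (cases n) (auto simp: hom_hess_def intro!: hom_grad_continuous mean_value_on_partial continuous_intros)

text \<open>The Laplacian of the degree \<open>n\<close> Taylor part is the degree
  \<open>n - 2\<close> Taylor part of the Laplacian of \<open>v\<close>; degrees 0 and 1 have zero
  Hessian by definition.\<close>

lemma hom_hess_trace: assumes "harmonic_on U v" "0 \<in> U" shows "(\<Sum>j\<in>UNIV. hom_hess n j j v y) = 0"
proof (cases n)
  case (Suc m)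
  show ?thesis
  proof (cases m)
    case (Suc k)
    have MV: "mean_value_on U v" and oU: "open U" using assms(1) by (auto simp: harmonic_on_mean_value harmonic_on_open)
    have MV2: "mean_value_on U (partial j (partial j v))" for j by (intro mean_value_on_partial MV)
    have "hom_part k (partial 1 (partial 1 v)) y + hom_part k (partial 2 (partial 2 v)) y + hom_part k (partial 3 (partial 3 v)) y
        = hom_part k (\<lambda>x. 1 * (1 * partial 1 (partial 1 v) x + 1 * partial 2 (partial 2 v) x) + 1 * partial 3 (partial 3 v) x) y"
      by (subst hom_part_lin[OF mean_value_on_lin[OF MV2 MV2] MV2 assms(2)], subst hom_part_lin[OF MV2 MV2 assms(2)]) simp
    also have "\<dots> = hom_part k (\<lambda>x. 0) y"
      by (rule hom_part_cong[OF oU assms(2)]) (use assms in \<open>simp add: harmonic_on_def sum_3\<close>)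
    also have "\<dots> = 0" by (simp add: hom_part_def iter_deriv_zero)
    finally show ?thesis using Suc \<open>n = Suc m\<close> by (simp add: hom_hess_def hom_grad_def sum_3)
  qed (simp add: hom_hess_def hom_grad_def Suc)
qed (simp add: hom_hess_def)

lemma harmonic_on_hom_part: assumes "harmonic_on U v" "0 \<in> U" shows "harmonic_on UNIV (hom_part n v)"
  by (rule harmonic_onI[where dv="\<lambda>j. hom_grad n j v" and ddv="\<lambda>i j. hom_hess n i j v"])
     (use assms harmonic_on_mean_value[OF assms(1)] in \<open>auto intro: hom_part_TG hom_grad_TH hom_hess_continuous hom_hess_trace\<close>)

lemma hom_part_euler: "(\<Sum>j\<in>UNIV. of_real (y$j) * hom_grad n j v y) = of_nat n * hom_part n v y"
  using hom_part_Suc[of _ v y] by (cases n) (auto simp: hom_grad_def)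

text \<open>With the Laplace equation at hand, Green's identity against the constant 1 works for
  every exponent, not just 2. Exponent 0 is the plain volume mean behind the pointwise bounds,
  exponent 1 enters the gradient estimate.\<close>

lemma harmonic_on_mean:
  assumes h: "harmonic_on U v" and sub: "cball x d \<subseteq> U" and d: "d > 0"
  shows "bint (\<lambda>y. v (x + d *\<^sub>R y) * uc y ^ k) = v x * bint (\<lambda>y. uc y ^ k)"
proof (rule bint_ray_const[OF harmonic_on_open[OF h] mean_value_on_has_grad[OF harmonic_on_mean_value[OF h]] mean_value_on_continuous_partial[OF harmonic_on_mean_value[OF h]] _ d sub])
  have MV: "mean_value_on U v" by (rule harmonic_on_mean_value[OF h])
  show "cb (\<lambda>y. uc y ^ k)" by (intro continuous_intros)
  fix t :: real assume t: "0 < t" "t \<le> d"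
  have t0: "t \<ge> 0" using t by simp
  have subt: "cball x t \<subseteq> U" using sub t by (auto simp: subset_iff)
  have "bint (\<lambda>y. (\<Sum>j\<in>UNIV. 0 * partial j v (x + t *\<^sub>R y)) * uc y ^ Suc k) =
       2 * of_nat (Suc k) * bint (\<lambda>y. 1 * (\<Sum>j\<in>UNIV. of_real (y$j) * partial j v (x + t *\<^sub>R y)) * uc y ^ k)"
  proof (rule bint_green[where ddq="\<lambda>j i y. of_real t * partial i (partial j v) (x + t *\<^sub>R y)"])
    fix y :: "real^3" assume "y \<in> cball 0 1"
    then have "x + t *\<^sub>R y \<in> U" using cball_affine_mem[OF subt t0] by simp
    then show "(\<Sum>j\<in>UNIV. of_real t * partial j (partial j v) (x + t *\<^sub>R y)) = 0"
      using h by (simp add: harmonic_on_def flip: sum_distrib_left)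
  qed (auto intro!: has_grad_const mean_value_on_affine_grad[OF mean_value_on_partial[OF MV] subt t0])
  then show "bint (\<lambda>y. (\<Sum>j\<in>UNIV. of_real (y$j) * partial j v (x + t *\<^sub>R y)) * uc y ^ k) = 0"
    by (simp add: bint_def set_lebesgue_integral_def del: of_nat_Suc)
qed

lemma bint_W_derivative:
  assumes MV: "mean_value_on (ball 0 R) v" and cq: "cb q" and t0: "\<bar>t0\<bar> < R"
  shows "((\<lambda>t. bint (\<lambda>y. iter_deriv k v y (t *\<^sub>R y) * q y)) has_vector_derivative
     bint (\<lambda>y. iter_deriv (Suc k) v y (t0 *\<^sub>R y) * q y)) (at t0)"
proof (rule bint_has_vector_derivative')
  define e where "e = (R - \<bar>t0\<bar>) / 2"
  show e: "e > 0" using t0 by (simp add: e_def)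
  have tD: "\<bar>t\<bar> < R" if "t \<in> cball t0 e" for t
    using that t0 by (auto simp: e_def dist_real_def field_simps abs_if split: if_splits)
  have mem: "t *\<^sub>R y \<in> ball 0 R" if "t \<in> cball t0 e" "norm y \<le> 1" for t y
  proof -
    have "\<bar>t\<bar> * norm y \<le> \<bar>t\<bar>" using that by (simp add: mult_left_le)
    then show ?thesis using tD[OF that(1)] by (simp add: dist_norm)
  qed
  have c: "continuous_on (cball t0 e \<times> cball 0 1) (\<lambda>p. iter_deriv k v (snd p) (fst p *\<^sub>R snd p))" for k
  proof -
    have img: "(\<lambda>p::real \<times> (real^3). (fst p *\<^sub>R snd p, snd p)) ` (cball t0 e \<times> cball 0 1) \<subseteq> ball 0 R \<times> UNIV"
      using mem by (auto simp: dist_norm)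
    have "continuous_on (cball t0 e \<times> cball 0 1) (\<lambda>p::real \<times> (real^3). (fst p *\<^sub>R snd p, snd p))"
      by (intro continuous_intros)
    from continuous_on_compose2[OF iter_deriv_continuous[OF MV, of k] this img] show ?thesis by simp
  qed
  have cqs: "continuous_on (cball t0 e \<times> cball 0 1) (\<lambda>p. q (snd p))"
    by (rule continuous_on_compose2[OF cq]) (auto intro!: continuous_intros)
  show "continuous_on (cball t0 e \<times> cball 0 1) (\<lambda>(t, y). iter_deriv (Suc k) v y (t *\<^sub>R y) * q y)"
    unfolding case_prod_unfold by (intro continuous_on_mult c cqs)
  show "cb (\<lambda>y. iter_deriv k v y (t *\<^sub>R y) * q y)" if "t \<in> ball t0 e" for t
    by (intro continuous_intros cq continuous_on_compose2[OF c[of k], of _ "\<lambda>y. (t, y)", simplified]) (use that in auto)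
  show "((\<lambda>t. iter_deriv k v y (t *\<^sub>R y) * q y) has_vector_derivative iter_deriv (Suc k) v y (t *\<^sub>R y) * q y) (at t)"
    if "t \<in> ball t0 e" "norm y < 1" for t y
    using iter_deriv_derivative[OF MV, of 0 t y k] mem[of t y] that
    by (intro has_vector_derivative_mult_left) simp
qed

text \<open>Two applications of Green's identity give the Euler equation $t J' = n J$ for
  $J(t) = \int v(ty)\,q(y)$; hence $J = c\,t^n$, and $c$ is read off the $n$-th derivative at $0$.\<close>

lemma bint_homogeneous_harmonic:
  fixes q :: "real^3 \<Rightarrow> complex" and dq :: "3 \<Rightarrow> real^3 \<Rightarrow> complex"
  assumes h: "harmonic_on (ball 0 R) v" and t: "0 < t" "t < R"
    and q: "\<And>y. has_grad q (\<lambda>j. dq j y) y" "\<And>j y. has_grad (dq j) (\<lambda>i. ddq j i y) y"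
    and cq: "\<And>i j. cb (ddq i j)" and trace: "\<And>y. (\<Sum>j\<in>UNIV. ddq j j y) = 0"
    and euler: "\<And>y. (\<Sum>j\<in>UNIV. of_real (y$j) * dq j y) = of_nat n * q y"
  shows "bint (\<lambda>y. v (t *\<^sub>R y) * q y) = of_real t ^ n * bint (\<lambda>y. hom_part n v y * q y)"
proof -
  have MV: "mean_value_on (ball 0 R) v" by (rule harmonic_on_mean_value[OF h])
  have ccq: "cb q" by (rule has_grad_imp_continuous_on[OF q(1)])
  have cdq: "cb (dq j)" for j by (rule has_grad_imp_continuous_on[OF q(2)])
  define J where "J k t = bint (\<lambda>y. iter_deriv k v y (t *\<^sub>R y) * q y)" for k t
  have dJ: "((J k) has_vector_derivative J (Suc k) t) (at t)" if "\<bar>t\<bar> < R" for k t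
    unfolding J_def[abs_def] by (rule bint_W_derivative[OF MV ccq that])
  have ode: "of_real t * J 1 t = of_nat n * J 0 t" if t: "0 < t" "t < R" for t
  proof -
    have t0: "t \<ge> 0" and sub: "cball 0 t \<subseteq> ball 0 R" using t by auto
    have "bint (\<lambda>y. (\<Sum>j\<in>UNIV. of_real t * partial j v (0 + t *\<^sub>R y) * dq j y) * uc y ^ Suc 0) =
       2 * of_nat (Suc 0) * bint (\<lambda>y. v (0 + t *\<^sub>R y) * (\<Sum>j\<in>UNIV. of_real (y$j) * dq j y) * uc y ^ 0)"
      by (rule bint_green) (rule mean_value_on_affine_grad[OF MV sub t0] q cq trace; assumption?)+
    also have "bint (\<lambda>y. v (0 + t *\<^sub>R y) * (\<Sum>j\<in>UNIV. of_real (y$j) * dq j y) * uc y ^ 0) = of_nat n * J 0 t"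
      unfolding euler J_def by (simp add: mult.left_commute mult.assoc bint_cmult)
    finally have 1: "bint (\<lambda>y. (\<Sum>j\<in>UNIV. of_real t * partial j v (t *\<^sub>R y) * dq j y) * uc y) = 2 * (of_nat n * J 0 t)"
      by simp
    have "bint (\<lambda>y. (\<Sum>j\<in>UNIV. dq j y * (of_real t * partial j v (0 + t *\<^sub>R y))) * uc y ^ Suc 0) =
       2 * of_nat (Suc 0) * bint (\<lambda>y. q y * (\<Sum>j\<in>UNIV. of_real (y$j) * (of_real t * partial j v (0 + t *\<^sub>R y))) * uc y ^ 0)"
    proof (rule bint_green[where ddq="\<lambda>j i y. of_real t * (of_real t * partial i (partial j v) (0 + t *\<^sub>R y))"])
      fix y :: "real^3" assume "y \<in> cball 0 1"
      then have "0 + t *\<^sub>R y \<in> ball 0 R" by (intro cball_affine_mem[OF sub t0]) simp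
      then show "(\<Sum>j\<in>UNIV. of_real t * (of_real t * partial j (partial j v) (0 + t *\<^sub>R y))) = 0"
        using h by (simp add: harmonic_on_def flip: sum_distrib_left)
    next
      fix j and y :: "real^3" assume "y \<in> cball 0 1"
      then show "has_grad (\<lambda>y. of_real t * partial j v (0 + t *\<^sub>R y)) (\<lambda>i. of_real t * (of_real t * partial i (partial j v) (0 + t *\<^sub>R y))) y"
        by (intro has_grad_cmult mean_value_on_affine_grad[OF mean_value_on_partial[OF MV] sub t0])
    next
      show "cb (\<lambda>y. of_real t * (of_real t * partial i (partial j v) (0 + t *\<^sub>R y)))" for i j
        by (intro continuous_intros mean_value_on_affine_grad[OF mean_value_on_partial[OF MV] sub t0])
    qed (use q cdq in auto)
    also have "bint (\<lambda>y. q y * (\<Sum>j\<in>UNIV. of_real (y$j) * (of_real t * partial j v (0 + t *\<^sub>R y))) * uc y ^ 0) = of_real t * J 1 t"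
      unfolding J_def
      by (simp add: sum_distrib_left sum_distrib_right mult_ac flip: bint_cmult)
    finally have 2: "bint (\<lambda>y. (\<Sum>j\<in>UNIV. of_real t * partial j v (t *\<^sub>R y) * dq j y) * uc y) = 2 * (of_real t * J 1 t)"
      by (simp add: mult_ac)
    from 1 2 show ?thesis by simp
  qed
  obtain c where c: "\<And>t. t \<in> {0<..<R} \<Longrightarrow> inverse t ^ n *\<^sub>R J 0 t = c"
  proof (rule has_vector_derivative_zero_constant[of "{0<..<R}" "\<lambda>t. inverse t ^ n *\<^sub>R J 0 t"])
    fix t assume t: "t \<in> {0<..<R}"
    have "((\<lambda>t. inverse t ^ n) has_field_derivative (- (of_nat n * inverse t ^ Suc n))) (at t)"
      using DERIV_power[OF DERIV_inverse[of t UNIV], of n] t by (cases n) (auto simp: algebra_simps)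
    from has_vector_derivative_scaleR[OF this dJ[of t 0]]
    have "((\<lambda>t. inverse t ^ n *\<^sub>R J 0 t) has_vector_derivative
        (inverse t ^ n *\<^sub>R J 1 t + (- (of_nat n * inverse t ^ Suc n)) *\<^sub>R J 0 t)) (at t)"
      using t by simp
    also have "inverse t ^ n *\<^sub>R J 1 t + (- (of_nat n * inverse t ^ Suc n)) *\<^sub>R J 0 t
        = inverse t ^ Suc n *\<^sub>R (of_real t * J 1 t - of_nat n * J 0 t)"
      using t by (simp add: scaleR_conv_of_real algebra_simps)
    also have "\<dots> = 0" using ode[of t] t by simp
    finally show "((\<lambda>t. inverse t ^ n *\<^sub>R J 0 t) has_vector_derivative 0) (at t within {0<..<R})"
      by (rule has_vector_derivative_at_within)
  qed auto
  have J0: "J 0 t = c * of_real t ^ n" if "t \<in> {0<..<R}" for t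
    using c[OF that] that by (auto simp: scaleR_conv_of_real field_simps)
  \<comment> \<open>Each \<open>J (Suc k)\<close> is the derivative of \<open>J k\<close>, so on the
    open interval \<open>J k\<close> is the k-th derivative of \<open>c t^n\<close>.\<close>
  have Jk: "\<forall>t\<in>{0<..<R}. J k t = c * of_real (fact n / fact (n - k)) * of_real t ^ (n - k)" if "k \<le> n" for k
    using that
  proof (induction k)
    case 0 then show ?case using J0 by simp
  next
    case (Suc k)
    show ?case
    proof
      fix t assume t: "t \<in> {0<..<R}"
      define m where "m = n - Suc k"
      have m: "n - k = Suc m" using Suc.prems by (simp add: m_def)
      have "((\<lambda>t. c * of_real (fact n / fact (Suc m)) * of_real (t ^ Suc m)) has_vector_derivative
          c * of_real (fact n / fact (Suc m)) * of_real (real (Suc m) * t ^ m)) (at t)"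
        by (intro has_vector_derivative_mult_right has_vector_derivative_of_real)
           (use DERIV_pow[of "Suc m" t] in \<open>simp add: has_real_derivative_iff_has_vector_derivative del: power_Suc\<close>)
      then have "((J k) has_vector_derivative c * of_real (fact n / fact (Suc m)) * of_real (real (Suc m) * t ^ m)) (at t)"
        by (rule has_vector_derivative_transform_within_open[of _ _ _ "{0<..<R}"])
           (use Suc t m in auto)
      with dJ[of t k] t have "J (Suc k) t = c * of_real (fact n / fact (Suc m)) * of_real (real (Suc m) * t ^ m)"
        by (auto intro: vector_derivative_unique_at)
      moreover have "fact n / fact (Suc m) * (real (Suc m) * t ^ m) = (fact n / fact m) * t ^ m"
        unfolding fact_Suc by (simp del: of_nat_Suc)
      ultimately show "J (Suc k) t = c * of_real (fact n / fact (n - Suc k)) * of_real t ^ (n - Suc k)"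
        unfolding m_def[symmetric] by (metis (no_types, lifting) mult.assoc of_real_mult of_real_power)
    qed
  qed
  have Jn: "J n t = c * fact n" if "t \<in> {0<..<R}" for t
    using Jk[of n] that by simp
  \<comment> \<open>\<open>J n\<close> is constant for small positive \<open>t\<close> and
    continuous at 0, where it is \<open>n!\<close> times the integral of the Taylor part against
    \<open>q\<close>.\<close>
  have "J n 0 = c * fact n"
  proof (rule tendsto_unique[of "at_right 0"])
    have "continuous (at 0) (J n)"
      using dJ[of 0 n] t by (intro has_vector_derivative_continuous) auto
    then show "(J n \<longlongrightarrow> J n 0) (at_right 0)"
      unfolding isCont_def by (rule filterlim_mono) (auto simp: at_within_le_at)
    have "\<forall>\<^sub>F t in at_right 0. J n t = c * fact n"
      unfolding eventually_at_right_field using t Jn by (intro exI[of _ R]) auto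
    then show "(J n \<longlongrightarrow> c * fact n) (at_right 0)" by (rule tendsto_eventually)
  qed auto
  moreover have "(\<lambda>y. hom_part n v y * q y) = (\<lambda>y. inverse (fact n) * (iter_deriv n v y 0 * q y))"
    by (simp add: hom_part_def divide_inverse mult_ac fun_eq_iff)
  ultimately have "c = bint (\<lambda>y. hom_part n v y * q y)"
    by (simp add: J_def bint_cmult)
  moreover have "J 0 t = bint (\<lambda>y. v (t *\<^sub>R y) * q y)" by (simp add: J_def)
  ultimately show ?thesis using J0[of t] t by (simp add: mult.commute)
qed

section \<open>Estimates for the homogeneous parts\<close>

lemma bint_nonneg:
  fixes f :: "real^3 \<Rightarrow> real"
  assumes "cb f" "\<And>y. norm y < 1 \<Longrightarrow> 0 \<le> f y"
  shows "0 \<le> bint f"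
  using bint_mono[of "\<lambda>y. 0" f] assms by (simp add: bint_const_real)

text \<open>The variance of \<open>f\<close> about its mean \<open>bint f / W0\<close> is
  nonnegative.\<close>

lemma bint_cauchy_schwarz:
  fixes f :: "real^3 \<Rightarrow> real"
  assumes "cb f" shows "(bint f)\<^sup>2 \<le> W0 * bint (\<lambda>y. (f y)\<^sup>2)"
proof -
  define c where "c = bint f / W0"
  have "0 \<le> bint (\<lambda>y. (f y - c)\<^sup>2)"
    by (intro bint_nonneg continuous_intros assms) auto
  also have "bint (\<lambda>y. (f y - c)\<^sup>2) = bint (\<lambda>y. (f y)\<^sup>2 + (c\<^sup>2 - 2 * c * f y))"
    by (simp add: power2_eq_square algebra_simps)
  also have "\<dots> = bint (\<lambda>y. (f y)\<^sup>2) + bint (\<lambda>y. c\<^sup>2 - 2 * c * f y)"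
    by (rule bint_add) (intro continuous_intros assms)+
  also have "bint (\<lambda>y. c\<^sup>2 - 2 * c * f y) = bint (\<lambda>y. c\<^sup>2) - bint (\<lambda>y. 2 * c * f y)"
    by (rule bint_diff) (intro continuous_intros assms)+
  also have "\<dots> = W0 * c\<^sup>2 - 2 * c * bint f" by (simp add: bint_const_real bint_cmult)
  finally have "0 \<le> W0 * (bint (\<lambda>y. (f y)\<^sup>2) + W0 * c\<^sup>2 - 2 * c * bint f)"
    using W0_pos by simp
  also have "\<dots> = W0 * bint (\<lambda>y. (f y)\<^sup>2) - (bint f)\<^sup>2"
    using W0_pos by (simp add: c_def field_simps power2_eq_square)
  finally show ?thesis by simp
qed

lemma bint_cauchy_schwarz_complex:
  fixes g :: "real^3 \<Rightarrow> complex"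
  assumes "cb g" shows "(norm (bint g))\<^sup>2 \<le> W0 * bint (\<lambda>y. (norm (g y))\<^sup>2)"
proof -
  have "(norm (bint g))\<^sup>2 \<le> (bint (\<lambda>y. norm (g y)))\<^sup>2"
    by (intro power_mono bint_norm_le assms) auto
  also have "\<dots> \<le> W0 * bint (\<lambda>y. (norm (g y))\<^sup>2)"
    by (intro bint_cauchy_schwarz continuous_intros assms)
  finally show ?thesis .
qed

lemma bint_subball:
  fixes g :: "real^3 \<Rightarrow> real"
  assumes c: "continuous_on UNIV g" and nn: "\<And>y. norm y < 1 \<Longrightarrow> 0 \<le> g y"
    and d: "d > 0" and sub: "norm x + d \<le> 1"
  shows "d^3 * bint (\<lambda>y. g (x + d *\<^sub>R y)) \<le> bint g"
proof -
  have in1: "y \<in> ball 0 1" if "y \<in> ball x d" for y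
  proof -
    have "norm y \<le> norm x + norm (y - x)" by (metis norm_triangle_sub)
    then show ?thesis using that sub by (simp add: dist_norm norm_minus_commute)
  qed
  have b: "integrable lborel (\<lambda>y. indicator (ball z e) y *\<^sub>R g y)" for z e
  proof -
    have "set_integrable lborel (cball z e) g"
      using borel_integrable_compact[OF compact_cball continuous_on_subset[OF c]]
      by (simp add: set_integrable_def indicator_scaleR_eq_if)
    then have "set_integrable lborel (ball z e) g" by (rule set_integrable_subset) auto
    then show ?thesis by (simp add: set_integrable_def)
  qed
  have "d^3 * bint (\<lambda>y. g (x + d *\<^sub>R y)) = (LINT y|lborel. indicator (ball x d) y *\<^sub>R g y)"
  proof (subst lborel_scale_integral_scaleR[OF _ d, of _ x])
    show "(\<lambda>y. indicator (ball x d) y *\<^sub>R g y) \<in> borel_measurable borel"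
      by (intro borel_measurable_continuous_on_indicator continuous_on_subset[OF c]) auto
    have "x + d *\<^sub>R y \<in> ball x d \<longleftrightarrow> y \<in> ball 0 1" for y using d by (auto simp: dist_norm)
    then show "d^3 * bint (\<lambda>y. g (x + d *\<^sub>R y)) = d^3 *\<^sub>R (LINT y|lborel. indicator (ball x d) (x + d *\<^sub>R y) *\<^sub>R g (x + d *\<^sub>R y))"
      by (simp add: bint_def set_lebesgue_integral_def indicator_def)
  qed
  also have "\<dots> \<le> (LINT y|lborel. indicator (ball 0 1) y *\<^sub>R g y)"
  proof (rule integral_mono[OF b b])
    show "indicator (ball x d) y *\<^sub>R g y \<le> indicator (ball 0 1) y *\<^sub>R g y" for y
      using in1[of y] nn[of y] by (auto simp: indicator_def)
  qed
  finally show ?thesis by (simp add: bint_def set_lebesgue_integral_def)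
qed

text \<open>Testing \<open>v(t y)\<close> against the conjugate of its own Taylor part gives
  \<open>t^n I\<close>, with \<open>I\<close> the squared norm of that part. Cauchy-Schwarz and |v|
  <= S give \<open>(t^n I)^2 <= W0 S^2 I\<close>; one factor \<open>I\<close> cancels, and
  \<open>t\<close> tends to \<open>R\<close>, where \<open>v\<close> itself need not be
  defined.\<close>

lemma bint_T_norm:
  assumes h: "harmonic_on (ball 0 R) v" and bd: "\<And>x. x \<in> ball 0 R \<Longrightarrow> norm (v x) \<le> S" and R: "R > 0"
  shows "bint (\<lambda>y. (norm (hom_part n v y))\<^sup>2) \<le> W0 * (S / R ^ n)\<^sup>2"
proof -
  have MV: "mean_value_on (ball 0 R) v" by (rule harmonic_on_mean_value[OF h])
  have z: "0 \<in> ball (0::real^3) R" using R by simp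
  have S0: "S \<ge> 0" using order_trans[OF norm_ge_zero bd[OF z]] .
  define I where "I = bint (\<lambda>y. (norm (hom_part n v y))\<^sup>2)"
  have cT: "cb (hom_part n v)" by (rule hom_part_continuous[OF MV z])
  have I0: "I \<ge> 0"
    unfolding I_def by (intro bint_nonneg continuous_intros cT) auto
  have cI: "of_real I = bint (\<lambda>y. hom_part n v y * cnj (hom_part n v y))"
    unfolding I_def by (simp only: complex_norm_square flip: bint_of_real)
  have main: "I * (t ^ n)\<^sup>2 \<le> W0 * S\<^sup>2" if t: "0 < t" "t < R" for t
  proof (cases "I = 0")
    case False
    have "bint (\<lambda>y. v (t *\<^sub>R y) * cnj (hom_part n v y)) = of_real t ^ n * bint (\<lambda>y. hom_part n v y * cnj (hom_part n v y))"
    proof (rule bint_homogeneous_harmonic[OF h t])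
      show "has_grad (\<lambda>y. cnj (hom_part n v y)) (\<lambda>j. cnj (hom_grad n j v y)) y" for y
        by (rule has_grad_cnj[OF hom_part_TG[OF MV z]])
      show "has_grad (\<lambda>y. cnj (hom_grad n j v y)) (\<lambda>i. cnj (hom_hess n i j v y)) y" for j y
        by (rule has_grad_cnj[OF hom_grad_TH[OF MV z]])
      show "cb (\<lambda>y. cnj (hom_hess n i j v y))" for i j
        by (intro continuous_intros hom_hess_continuous[OF MV z])
      show "(\<Sum>j\<in>UNIV. cnj (hom_hess n j j v y)) = 0" for y
        using hom_hess_trace[OF h z, of n y] by (metis cnj_sum complex_cnj_zero)
      show "(\<Sum>j\<in>UNIV. of_real (y$j) * cnj (hom_grad n j v y)) = of_nat n * cnj (hom_part n v y)" for y
        using arg_cong[OF hom_part_euler[of y n v], of cnj] by simp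
    qed
    then have "of_real (t ^ n * I) = bint (\<lambda>y. v (t *\<^sub>R y) * cnj (hom_part n v y))" by (simp add: cI)
    then have "t ^ n * I = norm (bint (\<lambda>y. v (t *\<^sub>R y) * cnj (hom_part n v y)))"
      using t I0 by (metis norm_of_real abs_of_nonneg mult_nonneg_nonneg zero_le_power less_imp_le)
    then have "(t ^ n * I)\<^sup>2 = (norm (bint (\<lambda>y. v (t *\<^sub>R y) * cnj (hom_part n v y))))\<^sup>2" by simp
    also have "\<dots> \<le> W0 * bint (\<lambda>y. (norm (v (t *\<^sub>R y) * cnj (hom_part n v y)))\<^sup>2)"
    proof (rule bint_cauchy_schwarz_complex)
      have "cb (\<lambda>y. v (0 + t *\<^sub>R y))" by (rule mean_value_on_affine_grad[OF MV]) (use t in auto)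
      then show "cb (\<lambda>y. v (t *\<^sub>R y) * cnj (hom_part n v y))" by (auto intro!: continuous_intros cT)
    qed
    also have "\<dots> \<le> W0 * bint (\<lambda>y. S\<^sup>2 * (norm (hom_part n v y))\<^sup>2)"
    proof (intro mult_left_mono bint_mono)
      have "cb (\<lambda>y. v (0 + t *\<^sub>R y))" by (rule mean_value_on_affine_grad[OF MV]) (use t in auto)
      then show "cb (\<lambda>y. (norm (v (t *\<^sub>R y) * cnj (hom_part n v y)))\<^sup>2)" by (auto intro!: continuous_intros cT)
      fix y :: "real^3" assume y: "norm y < 1"
      have "norm (t *\<^sub>R y) \<le> t" using y t by (simp add: mult_left_le)
      then have "norm (t *\<^sub>R y) < R" using t by linarith
      then have "norm (v (t *\<^sub>R y)) \<le> S" using t by (intro bd) simp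
      then show "(norm (v (t *\<^sub>R y) * cnj (hom_part n v y)))\<^sup>2 \<le> S\<^sup>2 * (norm (hom_part n v y))\<^sup>2"
        by (simp add: norm_mult power_mult_distrib mult_right_mono power_mono)
    qed (use W0_pos in \<open>auto intro!: continuous_intros cT\<close>)
    also have "\<dots> = W0 * S\<^sup>2 * I" by (simp add: bint_cmult I_def)
    finally have "I * (t ^ n)\<^sup>2 * I \<le> W0 * S\<^sup>2 * I" by (simp add: power2_eq_square mult_ac)
    then show ?thesis using False I0 by (simp add: mult_le_cancel_right)
  qed (use W0_pos in simp)
  have "I * (R ^ n)\<^sup>2 \<le> W0 * S\<^sup>2"
  proof (rule tendsto_upperbound[of "\<lambda>t. I * (t ^ n)\<^sup>2" _ "at_left R"])
    show "((\<lambda>t. I * (t ^ n)\<^sup>2) \<longlongrightarrow> I * (R ^ n)\<^sup>2) (at_left R)" by (intro tendsto_intros)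
    show "\<forall>\<^sub>F t in at_left R. I * (t ^ n)\<^sup>2 \<le> W0 * S\<^sup>2"
      unfolding eventually_at_left_field using R main by (intro exI[of _ 0]) auto
  qed auto
  then show ?thesis using R by (simp add: I_def power_divide field_simps)
qed

text \<open>Cauchy-Schwarz in the volume mean value identity: |p|^2 is subharmonic.\<close>

lemma harmonic_on_mean_square:
  assumes h: "harmonic_on UNIV p" and d: "d > 0"
  shows "W0 * (norm (p x))\<^sup>2 \<le> bint (\<lambda>y. (norm (p (x + d *\<^sub>R y)))\<^sup>2)"
proof -
  have "bint (\<lambda>y. p (x + d *\<^sub>R y)) = p x * of_real W0"
    using harmonic_on_mean[OF h _ d, of x 0] by (simp add: bint_const)
  then have "(W0 * norm (p x))\<^sup>2 = (norm (bint (\<lambda>y. p (x + d *\<^sub>R y))))\<^sup>2"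
    using W0_pos by (simp add: norm_mult)
  also have "\<dots> \<le> W0 * bint (\<lambda>y. (norm (p (x + d *\<^sub>R y)))\<^sup>2)"
    by (rule bint_cauchy_schwarz_complex) (rule cb_affine[OF harmonic_on_continuous[OF h]], use d in auto)
  finally have "W0 * (W0 * (norm (p x))\<^sup>2) \<le> W0 * bint (\<lambda>y. (norm (p (x + d *\<^sub>R y)))\<^sup>2)"
    by (simp add: power_mult_distrib power2_eq_square mult_ac)
  then show ?thesis using W0_pos by simp
qed

text \<open>A mean over a ball of radius \<open>d\<close> inside the unit ball costs the factor
  \<open>d^3\<close> against the full L^2 norm. The result is used only for geometric decay, where
  the dependence on \<open>d\<close> is harmless.\<close>

lemma hom_part_bound:
  assumes h: "harmonic_on (ball 0 R) v" and bd: "\<And>x. x \<in> ball 0 R \<Longrightarrow> norm (v x) \<le> S" and R: "R > 0"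
    and d: "d > 0" and x: "norm x + d \<le> 1"
  shows "d^3 * (norm (hom_part n v x))\<^sup>2 \<le> (S / R ^ n)\<^sup>2"
proof -
  have z: "0 \<in> ball (0::real^3) R" using R by simp
  have "d^3 * (W0 * (norm (hom_part n v x))\<^sup>2) \<le> d^3 * bint (\<lambda>y. (norm (hom_part n v (x + d *\<^sub>R y)))\<^sup>2)"
    using d by (intro mult_left_mono harmonic_on_mean_square harmonic_on_hom_part[OF h z]) auto
  also have "\<dots> \<le> bint (\<lambda>y. (norm (hom_part n v y))\<^sup>2)"
    by (rule bint_subball[OF _ _ d x]) (auto intro!: continuous_intros hom_part_continuous[OF harmonic_on_mean_value[OF h] z])
  also have "\<dots> \<le> W0 * (S / R ^ n)\<^sup>2" by (rule bint_T_norm[OF h bd R])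
  finally have "W0 * (d^3 * (norm (hom_part n v x))\<^sup>2) \<le> W0 * (S / R ^ n)\<^sup>2" by (simp add: mult_ac)
  then show ?thesis using W0_pos by simp
qed

text \<open>For the Taylor part p of degree n = \<open>Suc m\<close>, Green's identity with the
  conjugate gradient of p and Euler's identity give: the integral of |grad p|^2 (1 - |y|^2) equals
  2n times the integral of |p|^2. On the ball of radius \<open>d\<close> around \<open>x\<close> the
  weight is at least 1 - (|x| + d)^2, and subharmonicity of the squared partial localizes the bound
  at \<open>x\<close>.\<close>

lemma hom_part_partial_bound:
  assumes h: "harmonic_on (ball 0 R) v" and bd: "\<And>x. x \<in> ball 0 R \<Longrightarrow> norm (v x) \<le> S" and R: "R > 0"
    and d: "d > 0" and x: "norm x + d < 1"
  shows "d^3 * (1 - (norm x + d)\<^sup>2) * (norm (hom_part m (partial j v) x))\<^sup>2 \<le> 2 * real (Suc m) * (S / R ^ Suc m)\<^sup>2"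
proof -
  have MV: "mean_value_on (ball 0 R) v" by (rule harmonic_on_mean_value[OF h])
  have z: "0 \<in> ball (0::real^3) R" using R by simp
  define p where "p = hom_part (Suc m) v"
  define dp where "dp j = hom_part m (partial j v)" for j
  define c where "c = 1 - (norm x + d)\<^sup>2"
  have "(norm x + d)\<^sup>2 < 1" using x d by (subst abs_square_less_1) (simp add: add_nonneg_pos)
  then have c: "c > 0" by (simp add: c_def)
  have cdp: "continuous_on A (dp j)" for A j unfolding dp_def by (rule hom_part_continuous[OF mean_value_on_partial[OF MV] z])
  have cp: "continuous_on A p" for A unfolding p_def by (rule hom_part_continuous[OF MV z])
  have "bint (\<lambda>y. (\<Sum>j\<in>UNIV. dp j y * cnj (hom_grad (Suc m) j v y)) * uc y ^ Suc 0) =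
     2 * of_nat (Suc 0) * bint (\<lambda>y. p y * (\<Sum>j\<in>UNIV. of_real (y$j) * cnj (hom_grad (Suc m) j v y)) * uc y ^ 0)"
  proof (rule bint_green[where ddq="\<lambda>j i y. cnj (hom_hess (Suc m) i j v y)"])
    show "has_grad p (\<lambda>j. dp j y) y" for y
      unfolding p_def dp_def by (rule hom_part_Suc_grad[OF MV z])
    show "has_grad (\<lambda>y. cnj (hom_grad (Suc m) j v y)) (\<lambda>i. cnj (hom_hess (Suc m) i j v y)) y" for j y
      by (rule has_grad_cnj[OF hom_grad_TH[OF MV z]])
    show "cb (\<lambda>y. cnj (hom_hess (Suc m) i j v y))" for i j
      by (intro continuous_intros hom_hess_continuous[OF MV z])
    show "(\<Sum>j\<in>UNIV. cnj (hom_hess (Suc m) j j v y)) = 0" for y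
      using hom_hess_trace[OF h z, of "Suc m" y] by (metis cnj_sum complex_cnj_zero)
  qed (rule cdp)
  moreover have "(\<Sum>j\<in>UNIV. of_real (y$j) * cnj (hom_grad (Suc m) j v y)) = of_nat (Suc m) * cnj (p y)" for y
    using arg_cong[OF hom_part_euler[of y "Suc m" v], of cnj] by (simp add: p_def)
  ultimately have "bint (\<lambda>y. (\<Sum>j\<in>UNIV. dp j y * cnj (dp j y)) * uc y) = 2 * of_nat (Suc m) * bint (\<lambda>y. p y * cnj (p y))"
    by (simp add: dp_def mult.left_commute[of _ "1 + complex_of_nat m"] bint_cmult del: of_nat_Suc)
      (simp add: mult.assoc mult.left_commute[of _ "complex_of_nat (Suc m)"] bint_cmult del: of_nat_Suc)
  then have "complex_of_real (bint (\<lambda>y. (\<Sum>j\<in>UNIV. (norm (dp j y))\<^sup>2) * (1 - y \<bullet> y)))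
      = complex_of_real (2 * real (Suc m) * bint (\<lambda>y. (norm (p y))\<^sup>2))"
    by (simp add: uc_def complex_norm_square[unfolded of_real_power] del: of_nat_Suc flip: bint_of_real)
  then have green: "bint (\<lambda>y. (\<Sum>j\<in>UNIV. (norm (dp j y))\<^sup>2) * (1 - y \<bullet> y)) = 2 * real (Suc m) * bint (\<lambda>y. (norm (p y))\<^sup>2)"
    by (simp only: of_real_eq_iff)
  have "d^3 * c * (W0 * (norm (dp j x))\<^sup>2) \<le> d^3 * c * bint (\<lambda>y. (norm (dp j (x + d *\<^sub>R y)))\<^sup>2)"
    unfolding dp_def using d c by (intro mult_left_mono harmonic_on_mean_square harmonic_on_hom_part[OF harmonic_on_partial[OF h] z]) auto
  also have "\<dots> = d^3 * bint (\<lambda>y. c * (norm (dp j (x + d *\<^sub>R y)))\<^sup>2)" by (simp add: bint_cmult)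
  also have "\<dots> \<le> d^3 * bint (\<lambda>y. (norm (dp j (x + d *\<^sub>R y)))\<^sup>2 * (1 - (x + d *\<^sub>R y) \<bullet> (x + d *\<^sub>R y)))"
  proof (intro mult_left_mono bint_mono)
    fix y :: "real^3" assume y: "norm y < 1"
    have "norm (x + d *\<^sub>R y) \<le> norm x + norm (d *\<^sub>R y)" by (rule norm_triangle_ineq)
    also have "\<dots> \<le> norm x + d" using y d by (simp add: mult_left_le)
    finally have "(norm (x + d *\<^sub>R y))\<^sup>2 \<le> (norm x + d)\<^sup>2" by (rule power_mono) simp
    then have "c \<le> 1 - (x + d *\<^sub>R y) \<bullet> (x + d *\<^sub>R y)" by (simp add: c_def dot_square_norm)
    then show "c * (norm (dp j (x + d *\<^sub>R y)))\<^sup>2 \<le> (norm (dp j (x + d *\<^sub>R y)))\<^sup>2 * (1 - (x + d *\<^sub>R y) \<bullet> (x + d *\<^sub>R y))"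
      by (subst mult.commute) (rule mult_left_mono, simp_all)
  next
    have *: "cb (\<lambda>y. dp j (x + d *\<^sub>R y))" by (rule cb_affine[of UNIV]) (use d cdp in auto)
    show "cb (\<lambda>y. c * (norm (dp j (x + d *\<^sub>R y)))\<^sup>2)" by (intro continuous_intros *)
    show "cb (\<lambda>y. (norm (dp j (x + d *\<^sub>R y)))\<^sup>2 * (1 - (x + d *\<^sub>R y) \<bullet> (x + d *\<^sub>R y)))" by (intro continuous_intros *)
  qed (use d in auto)
  also have "\<dots> \<le> bint (\<lambda>y. (norm (dp j y))\<^sup>2 * (1 - y \<bullet> y))"
  proof (rule bint_subball[OF _ _ d])
    show "0 \<le> (norm (dp j y))\<^sup>2 * (1 - y \<bullet> y)" if "norm y < 1" for y
      using that by (simp add: dot_square_norm power_le_one)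
  qed (use x in \<open>auto intro!: continuous_intros cdp\<close>)
  also have "\<dots> \<le> bint (\<lambda>y. (\<Sum>j\<in>UNIV. (norm (dp j y))\<^sup>2) * (1 - y \<bullet> y))"
  proof (rule bint_mono)
    fix y :: "real^3" assume "norm y < 1"
    then have "1 - y \<bullet> y \<ge> 0" by (simp add: dot_square_norm power_le_one)
    moreover have "(norm (dp j y))\<^sup>2 \<le> (\<Sum>j\<in>UNIV. (norm (dp j y))\<^sup>2)"
      by (rule member_le_sum) auto
    ultimately show "(norm (dp j y))\<^sup>2 * (1 - y \<bullet> y) \<le> (\<Sum>j\<in>UNIV. (norm (dp j y))\<^sup>2) * (1 - y \<bullet> y)"
      by (rule mult_right_mono[rotated])
  qed (intro continuous_intros cdp)+
  also have "\<dots> \<le> 2 * real (Suc m) * (W0 * (S / R ^ Suc m)\<^sup>2)"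
    unfolding green p_def by (intro mult_left_mono bint_T_norm[OF h bd R]) auto
  finally have "W0 * (d^3 * c * (norm (dp j x))\<^sup>2) \<le> W0 * (2 * real (Suc m) * (S / R ^ Suc m)\<^sup>2)"
    by (simp add: mult_ac)
  then show ?thesis using W0_pos unfolding c_def dp_def by (simp only: mult_le_cancel_left_pos)
qed

text \<open>Green's identity for the coordinate function y_j gives \<open>bint uc\<close> = 2 *
  integral of y_j^2 for each of the three j. Inserting this in uc = 1 - y_1^2 - y_2^2 - y_3^2 leaves
  the equation U = W0 - (3/2) U.\<close>

lemma bint_uc: "bint uc = of_real (2/5 * W0)"
  and bint_coord_sq: "bint (\<lambda>y. (y$j)\<^sup>2) = W0 / 5"
proof -
  have green: "bint uc = 2 * bint (\<lambda>y. of_real ((y$j)\<^sup>2))" for j :: 3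
  proof -
    have "bint (\<lambda>y. (\<Sum>i\<in>UNIV. (if i = j then 1 else 0) * (if i = j then 1 else 0)) * uc y ^ Suc 0) =
       2 * of_nat (Suc 0) * bint (\<lambda>y. of_real (y$j) * (\<Sum>i\<in>UNIV. of_real (y$i) * (if i = j then 1 else 0)) * uc y ^ 0)"
      by (rule bint_green[where ddq="\<lambda>i j y. 0"])
         (auto intro!: has_grad_coord has_grad_const continuous_intros)
    moreover have "(\<Sum>i\<in>UNIV. (if i = j then 1 else 0) * (if i = j then 1 else 0::complex)) = (\<Sum>i\<in>UNIV. (if i = j then 1 else 0))"
      by (rule sum.cong) auto
    moreover have "(\<Sum>i\<in>UNIV. complex_of_real (y$i) * (if i = j then 1 else 0)) = (\<Sum>i\<in>UNIV. (if i = j then complex_of_real (y$i) else 0))" for y :: "real^3"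
      by (rule sum.cong) auto
    ultimately show ?thesis by (simp add: power2_eq_square)
  qed
  have "uc = (\<lambda>y. 1 - (\<Sum>i\<in>UNIV. of_real ((y$i)\<^sup>2)))"
    by (simp add: uc_def fun_eq_iff inner_vec_def power2_eq_square)
  then have "bint uc = bint (\<lambda>y. 1 - (\<Sum>i\<in>UNIV. complex_of_real ((y$i)\<^sup>2)))" by simp
  also have "\<dots> = bint (\<lambda>y. 1) - bint (\<lambda>y. \<Sum>i\<in>UNIV. complex_of_real ((y$i)\<^sup>2))"
    by (rule bint_diff; intro continuous_intros)
  also have "bint (\<lambda>y. \<Sum>i\<in>UNIV. complex_of_real ((y$i)\<^sup>2)) = (\<Sum>i\<in>UNIV. bint (\<lambda>y. complex_of_real ((y$i)\<^sup>2)))"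
    by (rule bint_sum) (simp, intro continuous_intros)
  also have "\<dots> = (\<Sum>i\<in>(UNIV::3 set). bint uc / 2)"
  proof (rule sum.cong)
    show "bint (\<lambda>y. complex_of_real ((y$i)\<^sup>2)) = bint uc / 2" for i unfolding green[of i] by simp
  qed simp
  finally show u: "bint uc = of_real (2/5 * W0)" by (simp add: bint_const field_simps)
  have "complex_of_real (bint (\<lambda>y. (y$j)\<^sup>2)) = of_real (W0 / 5)"
    using green[of j] u by (simp add: bint_of_real del: of_real_power)
  then show "bint (\<lambda>y. (y$j)\<^sup>2) = W0 / 5" by (simp only: of_real_eq_iff)
qed

text \<open>Green's identity with the constant field in direction \<open>j\<close> turns the mean of
  the partial into a moment of \<open>v\<close>: (2/5) d |d_j v| W0 is at most 2 times the norm of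
  the integral of v y_j. Cauchy-Schwarz with the second moment W0 / 5 bounds the latter by S W0 /
  sqrt 5, whence the constant sqrt 5.\<close>

lemma gradient_estimate:
  assumes h: "harmonic_on U v" and sub: "ball x D \<subseteq> U" and D: "D > 0"
    and bd: "\<And>p. p \<in> ball x D \<Longrightarrow> norm (v p) \<le> S"
  shows "norm (partial j v x) \<le> sqrt 5 * S / D"
proof -
  have MV: "mean_value_on U v" by (rule harmonic_on_mean_value[OF h])
  have S0: "S \<ge> 0" using order_trans[OF norm_ge_zero bd[of x]] D by simp
  have main: "norm (partial j v x) * d \<le> sqrt 5 * S" if d: "0 < d" "d < D" for d
  proof -
    have d0: "d \<ge> 0" and subd: "cball x d \<subseteq> U" using sub d by (auto simp: subset_iff)
    have "bint (\<lambda>y. (\<Sum>i\<in>UNIV. of_real d * partial i v (x + d *\<^sub>R y) * (if i = j then 1 else 0)) * uc y ^ Suc 0) =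
       2 * of_nat (Suc 0) * bint (\<lambda>y. v (x + d *\<^sub>R y) * (\<Sum>i\<in>UNIV. of_real (y$i) * (if i = j then 1 else 0)) * uc y ^ 0)"
      by (rule bint_green[where ddq="\<lambda>i j y. 0"])
         (auto intro!: has_grad_const continuous_intros mean_value_on_affine_grad[OF MV subd d0])
    moreover have "(\<Sum>i\<in>UNIV. of_real d * partial i v (x + d *\<^sub>R y) * (if i = j then 1 else 0)) = (\<Sum>i\<in>UNIV. (if i = j then of_real d * partial i v (x + d *\<^sub>R y) else 0))" for y
      by (rule sum.cong) auto
    moreover have "(\<Sum>i\<in>UNIV. complex_of_real (y$i) * (if i = j then 1 else 0)) = (\<Sum>i\<in>UNIV. (if i = j then complex_of_real (y$i) else 0))" for y :: "real^3"
      by (rule sum.cong) auto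
    ultimately have "of_real d * bint (\<lambda>y. partial j v (x + d *\<^sub>R y) * uc y) = 2 * bint (\<lambda>y. v (x + d *\<^sub>R y) * of_real (y$j))"
      by (simp add: mult.assoc bint_cmult)
    moreover have "bint (\<lambda>y. partial j v (x + d *\<^sub>R y) * uc y) = partial j v x * of_real (2/5 * W0)"
      using harmonic_on_mean[OF harmonic_on_partial[OF h] subd d(1), of j 1] by (simp add: bint_uc)
    moreover have "of_real (d * (2/5 * W0)) * partial j v x = of_real d * (partial j v x * of_real (2/5 * W0))"
      by (simp only: of_real_mult mult_ac)
    ultimately have "of_real (d * (2/5 * W0)) * partial j v x = 2 * bint (\<lambda>y. v (x + d *\<^sub>R y) * of_real (y$j))"
      by simp
    from arg_cong[OF this, of norm]
    have "(d * (2/5 * W0)) * norm (partial j v x) = 2 * norm (bint (\<lambda>y. v (x + d *\<^sub>R y) * of_real (y$j)))"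
      using d W0_pos by (simp add: norm_mult)
    also have "\<dots> \<le> 2 * (S * W0 / sqrt 5)"
    proof -
      have "(norm (bint (\<lambda>y. v (x + d *\<^sub>R y) * of_real (y$j))))\<^sup>2 \<le> W0 * bint (\<lambda>y. (norm (v (x + d *\<^sub>R y) * of_real (y$j)))\<^sup>2)"
        by (rule bint_cauchy_schwarz_complex) (intro continuous_intros mean_value_on_affine_grad[OF MV subd d0])
      also have "\<dots> \<le> W0 * bint (\<lambda>y. S\<^sup>2 * (y$j)\<^sup>2)"
      proof (intro mult_left_mono bint_mono)
        fix y :: "real^3" assume y: "norm y < 1"
        have "norm (d *\<^sub>R y) \<le> d" using y d by (simp add: mult_left_le)
        then have "norm (d *\<^sub>R y) < D" using d by linarith
        then have "norm (v (x + d *\<^sub>R y)) \<le> S" using d by (intro bd) (simp add: dist_norm)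
        then show "(norm (v (x + d *\<^sub>R y) * of_real (y$j)))\<^sup>2 \<le> S\<^sup>2 * (y$j)\<^sup>2"
          by (simp add: norm_mult power_mult_distrib mult_right_mono power_mono)
      qed (use W0_pos in \<open>auto intro!: continuous_intros mean_value_on_affine_grad[OF MV subd d0]\<close>)
      also have "\<dots> = (S * W0 / sqrt 5)\<^sup>2"
        unfolding bint_cmult bint_coord_sq power_divide power_mult_distrib by (simp add: power2_eq_square)
      finally have "norm (bint (\<lambda>y. v (x + d *\<^sub>R y) * of_real (y$j))) \<le> S * W0 / sqrt 5"
        by (rule power2_le_imp_le) (use S0 W0_pos in simp)
      then show ?thesis by simp
    qed
    finally have "2/5 * (W0 * (norm (partial j v x) * d)) \<le> 2/5 * (W0 * (5 * S / sqrt 5))"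
      by (simp add: mult_ac)
    then have "W0 * (norm (partial j v x) * d) \<le> W0 * (5 * S / sqrt 5)"
      by (rule mult_left_le_imp_le) simp
    then have "norm (partial j v x) * d \<le> 5 * S / sqrt 5" using W0_pos by (simp only: mult_le_cancel_left_pos)
    also have "5 * S / sqrt 5 = sqrt 5 * S"
      using real_div_sqrt[of 5] by (metis divide_divide_eq_right mult.commute times_divide_eq_right zero_le_numeral)
    finally show ?thesis .
  qed
  have "norm (partial j v x) * D \<le> sqrt 5 * S"
  proof (rule tendsto_upperbound[of "\<lambda>t. norm (partial j v x) * t" _ "at_left D"])
    show "((\<lambda>t. norm (partial j v x) * t) \<longlongrightarrow> norm (partial j v x) * D) (at_left D)" by (intro tendsto_intros)
    show "\<forall>\<^sub>F t in at_left D. norm (partial j v x) * t \<le> sqrt 5 * S"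
      unfolding eventually_at_left_field using D main by (intro exI[of _ 0]) auto
  qed auto
  then show ?thesis using D by (simp add: field_simps)
qed

section \<open>Expansion into homogeneous parts\<close>

lemma hom_part_geometric:
  assumes h: "harmonic_on (ball 0 R) v" and \<rho>: "0 < \<rho>" "\<rho> < R"
  obtains C q where "0 \<le> q" "q < 1" "\<And>n x. norm x \<le> \<rho> \<Longrightarrow> norm (hom_part n v x) \<le> C * q ^ n"
proof -
  define R' where "R' = (\<rho> + R) / 2"
  have R': "\<rho> < R'" "R' < R" "R' > 0" using \<rho> by (auto simp: R'_def)
  \<comment> \<open>\<open>\<kappa>\<close> lies strictly between \<open>\<rho> / R'\<close> and 1.
    Being below 1 it leaves the room \<open>d = 1 - \<kappa>\<close> asked for by
    \<open>hom_part_bound\<close>; being above \<open>\<rho> / R'\<close> it keeps the ratio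
    \<open>\<rho> / (\<kappa> * R')\<close> below 1 after rescaling by homogeneity.\<close>
  define \<kappa> where "\<kappa> = (1 + \<rho> / R') / 2"
  have k: "0 < \<kappa>" "\<kappa> < 1" "\<rho> < \<kappa> * R'"
    using \<rho> R' by (auto simp: \<kappa>_def field_simps)
  have h': "harmonic_on (ball 0 R') v" by (rule harmonic_on_subset[OF h]) (use R' in auto)
  have "compact (v ` cball 0 R')"
    by (intro compact_continuous_image continuous_on_subset[OF harmonic_on_continuous[OF h]]) (use R' in auto)
  then obtain S where S: "\<And>x. x \<in> cball 0 R' \<Longrightarrow> norm (v x) \<le> S"
    by (meson bounded_iff compact_imp_bounded image_eqI)
  have S0: "S \<ge> 0" using order_trans[OF norm_ge_zero S[of 0]] R' by simp
  define d where "d = 1 - \<kappa>"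
  have d: "d > 0" using k by (simp add: d_def)
  have bound: "norm (hom_part n v x) \<le> (S / sqrt (d^3)) * (\<rho> / (\<kappa> * R')) ^ n" if x: "norm x \<le> \<rho>" for n x
  proof -
    define w where "w = (\<kappa> / \<rho>) *\<^sub>R x"
    have w: "norm w + d \<le> 1" using x \<rho> k by (simp add: w_def d_def field_simps)
    have "d^3 * (norm (hom_part n v w))\<^sup>2 \<le> (S / R' ^ n)\<^sup>2"
      by (rule hom_part_bound[OF h' _ R'(3) d w]) (use S in auto)
    then have "(norm (hom_part n v w))\<^sup>2 \<le> (S / R' ^ n)\<^sup>2 / d^3" using d by (simp add: pos_le_divide_eq mult.commute)
    also have "\<dots> = (S / R' ^ n / sqrt (d^3))\<^sup>2" using d by (simp add: power_divide power_mult_distrib)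
    finally have Tw: "norm (hom_part n v w) \<le> S / R' ^ n / sqrt (d^3)"
      by (rule power2_le_imp_le) (use S0 R' d in simp)
    have xw: "(\<rho> / \<kappa>) *\<^sub>R w = x" using \<rho> k by (simp add: w_def)
    have "norm (hom_part n v x) = (\<rho> / \<kappa>) ^ n * norm (hom_part n v w)"
      using hom_part_homogeneous[of n v "\<rho> / \<kappa>" w] \<rho> k unfolding xw by (simp add: norm_mult norm_power norm_divide)
    also have "\<dots> \<le> (\<rho> / \<kappa>) ^ n * (S / R' ^ n / sqrt (d^3))"
      using \<rho> k by (intro mult_left_mono Tw) auto
    also have "\<dots> = (S / sqrt (d^3)) * (\<rho> / (\<kappa> * R')) ^ n"
      by (simp add: power_divide power_mult_distrib mult_ac)
    finally show ?thesis .
  qed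
  show ?thesis
    by (rule that[OF _ _ bound]) (use \<rho> k R' in auto)
qed

text \<open>Uniform convergence on smaller balls passes the mean value identity from the partial
  sums to the sum. That the sum equals \<open>v\<close> is not yet known here; this property is what
  makes unique continuation applicable to the difference.\<close>

lemma mean_value_on_suminf_T:
  assumes h: "harmonic_on (ball 0 R) v" and R: "R > 0"
  shows "mean_value_on (ball 0 R) (\<lambda>x. \<Sum>n. hom_part n v x)"
proof -
  have z: "0 \<in> ball (0::real^3) R" using R by simp
  have MV: "mean_value_on (ball 0 R) v" by (rule harmonic_on_mean_value[OF h])
  have unif: "uniform_limit (cball 0 \<rho>) (\<lambda>N x. \<Sum>n<N. hom_part n v x) (\<lambda>x. \<Sum>n. hom_part n v x) sequentially"
    if \<rho>: "0 < \<rho>" "\<rho> < R" for \<rho>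
  proof -
    obtain C q where "0 \<le> q" "q < 1" and b: "\<And>n x. norm x \<le> \<rho> \<Longrightarrow> norm (hom_part n v x) \<le> C * q ^ n"
      by (rule hom_part_geometric[OF h \<rho>]) (rule that)
    have "summable (\<lambda>n. C * q ^ n)"
      using \<open>0 \<le> q\<close> \<open>q < 1\<close> by (intro summable_mult summable_geometric) simp
    then show ?thesis by (rule Weierstrass_m_test[rotated]) (use b in simp)
  qed
  have cont: "continuous_on (cball 0 \<rho>) (\<lambda>x. \<Sum>n. hom_part n v x)" if \<rho>: "0 < \<rho>" "\<rho> < R" for \<rho>
    by (rule uniform_limit_theorem[OF _ unif[OF \<rho>]])
       (auto intro!: always_eventually continuous_on_sum hom_part_continuous[OF MV z])
  show ?thesis
    unfolding mean_value_on_def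
  proof (intro conjI allI impI)
    show "continuous_on (ball 0 R) (\<lambda>x. \<Sum>n. hom_part n v x)"
    proof (rule continuous_at_imp_continuous_on, rule ballI)
      fix x :: "real^3" assume x: "x \<in> ball 0 R"
      define \<rho> where "\<rho> = (norm x + R) / 2"
      have \<rho>: "0 < \<rho>" "\<rho> < R" "norm x < \<rho>" using x R by (auto simp: \<rho>_def add_nonneg_pos)
      have "continuous_on (ball 0 \<rho>) (\<lambda>x. \<Sum>n. hom_part n v x)"
        by (rule continuous_on_subset[OF cont[OF \<rho>(1,2)]]) auto
      then show "isCont (\<lambda>x. \<Sum>n. hom_part n v x) x" using \<rho>(3) by (simp add: continuous_on_eq_continuous_at)
    qed
    fix x d assume d: "0 < d" and sub: "cball x d \<subseteq> ball (0::real^3) R"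
    have d0: "d \<ge> 0" using d by simp
    have mem: "norm (x + d *\<^sub>R y) < R" if "norm y \<le> 1" for y
      using cball_affine_mem[OF sub d0 that] by simp
    \<comment> \<open>The largest norm on the closed ball is attained, hence smaller than R, so the
      ball lies in a region of uniform convergence.\<close>
    have "compact ((\<lambda>y. norm (x + d *\<^sub>R y)) ` cball 0 1)"
      by (intro compact_continuous_image continuous_intros compact_cball)
    moreover have "(\<lambda>y. norm (x + d *\<^sub>R y)) ` cball 0 1 \<noteq> {}" by auto
    ultimately obtain m where m: "m \<in> (\<lambda>y. norm (x + d *\<^sub>R y)) ` cball 0 1"
        "\<And>u. u \<in> (\<lambda>y. norm (x + d *\<^sub>R y)) ` cball 0 1 \<Longrightarrow> u \<le> m"
      using compact_attains_sup by metis
    have mR: "0 \<le> m" "m < R" using m(1) mem by auto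
    define \<rho> where "\<rho> = (m + R) / 2"
    have \<rho>: "0 < \<rho>" "\<rho> < R" "m \<le> \<rho>" using mR R by (auto simp: \<rho>_def)
    have mem2: "x + d *\<^sub>R y \<in> cball 0 \<rho>" if "norm y \<le> 1" for y
      using m(2)[of "norm (x + d *\<^sub>R y)"] that \<rho> by auto
    have cS: "cb (\<lambda>y. \<Sum>n. hom_part n v (x + d *\<^sub>R y))"
      by (rule continuous_on_compose2[OF cont[OF \<rho>(1,2)]]) (use mem2 in \<open>auto intro!: continuous_intros\<close>)
    have cP: "cb (\<lambda>y. \<Sum>n<N. hom_part n v (x + d *\<^sub>R y))" for N
      by (rule cb_affine[of UNIV "\<lambda>x. \<Sum>n<N. hom_part n v x"]) (use d in \<open>auto intro!: continuous_on_sum hom_part_continuous[OF MV z]\<close>)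
    have "(\<lambda>N. bint (\<lambda>y. (\<Sum>n<N. hom_part n v (x + d *\<^sub>R y)) * uc y ^ 2)) \<longlonglongrightarrow> bint (\<lambda>y. (\<Sum>n. hom_part n v (x + d *\<^sub>R y)) * uc y ^ 2)"
      unfolding tendsto_iff
    proof (intro allI impI)
      fix e :: real assume e: "e > 0"
      define e' where "e' = e / (2 * W0)"
      have e': "e' > 0" using e W0_pos by (simp add: e'_def)
      have "\<forall>\<^sub>F N in sequentially. \<forall>p\<in>cball 0 \<rho>. dist (\<Sum>n<N. hom_part n v p) (\<Sum>n. hom_part n v p) < e'"
        using unif[OF \<rho>(1,2)] e' by (simp add: uniform_limit_iff)
      then show "\<forall>\<^sub>F N in sequentially. dist (bint (\<lambda>y. (\<Sum>n<N. hom_part n v (x + d *\<^sub>R y)) * uc y ^ 2)) (bint (\<lambda>y. (\<Sum>n. hom_part n v (x + d *\<^sub>R y)) * uc y ^ 2)) < e"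
      proof eventually_elim
        case (elim N)
        have "dist (bint (\<lambda>y. (\<Sum>n<N. hom_part n v (x + d *\<^sub>R y)) * uc y ^ 2)) (bint (\<lambda>y. (\<Sum>n. hom_part n v (x + d *\<^sub>R y)) * uc y ^ 2))
          = norm (bint (\<lambda>y. (\<Sum>n<N. hom_part n v (x + d *\<^sub>R y)) * uc y ^ 2 - (\<Sum>n. hom_part n v (x + d *\<^sub>R y)) * uc y ^ 2))"
          unfolding dist_norm by (subst bint_diff) (intro continuous_on_mult cP cS continuous_intros refl)+
        also have "\<dots> \<le> W0 * e'"
        proof (rule bint_bound)
          show "cb (\<lambda>y. (\<Sum>n<N. hom_part n v (x + d *\<^sub>R y)) * uc y ^ 2 - (\<Sum>n. hom_part n v (x + d *\<^sub>R y)) * uc y ^ 2)"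
            by (intro continuous_on_diff continuous_on_mult cP cS continuous_on_power continuous_on_uc)
          fix y :: "real^3" assume y: "norm y < 1"
          have u: "norm (uc y ^ 2) \<le> 1"
            using y by (simp add: uc_def norm_power dot_square_norm power_le_one abs_le_iff del: of_real_diff of_real_1)
          have "norm ((\<Sum>n<N. hom_part n v (x + d *\<^sub>R y)) * uc y ^ 2 - (\<Sum>n. hom_part n v (x + d *\<^sub>R y)) * uc y ^ 2)
            = norm ((\<Sum>n<N. hom_part n v (x + d *\<^sub>R y)) - (\<Sum>n. hom_part n v (x + d *\<^sub>R y))) * norm (uc y ^ 2)"
            by (simp add: left_diff_distrib[symmetric] norm_mult)
          also have "\<dots> \<le> e' * 1"
            using elim mem2[of y] y u e' by (intro mult_mono) (auto simp: dist_norm intro: less_imp_le)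
          finally show "norm ((\<Sum>n<N. hom_part n v (x + d *\<^sub>R y)) * uc y ^ 2 - (\<Sum>n. hom_part n v (x + d *\<^sub>R y)) * uc y ^ 2) \<le> e'" by simp
        qed
        also have "\<dots> < e" using e W0_pos by (simp add: e'_def)
        finally show ?case .
      qed
    qed
    moreover have "bint (\<lambda>y. (\<Sum>n<N. hom_part n v (x + d *\<^sub>R y)) * uc y ^ 2) = (\<Sum>n<N. hom_part n v x) * bint (\<lambda>y. uc y ^ 2)" for N
    proof -
      have "bint (\<lambda>y. (\<Sum>n<N. hom_part n v (x + d *\<^sub>R y)) * uc y ^ 2) = bint (\<lambda>y. \<Sum>n<N. hom_part n v (x + d *\<^sub>R y) * uc y ^ 2)"
        by (simp add: sum_distrib_right)
      also have "\<dots> = (\<Sum>n<N. bint (\<lambda>y. hom_part n v (x + d *\<^sub>R y) * uc y ^ 2))"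
        by (rule bint_sum) (use d in \<open>auto intro!: continuous_on_mult continuous_intros cb_affine[of UNIV] hom_part_continuous[OF MV z]\<close>)
      also have "\<dots> = (\<Sum>n<N. hom_part n v x * bint (\<lambda>y. uc y ^ 2))"
        by (intro sum.cong refl harmonic_on_mean[OF harmonic_on_hom_part[OF h z]]) (use d in auto)
      finally show ?thesis by (simp add: sum_distrib_right)
    qed
    moreover have "(\<lambda>N. (\<Sum>n<N. hom_part n v x) * bint (\<lambda>y. uc y ^ 2)) \<longlonglongrightarrow> (\<Sum>n. hom_part n v x) * bint (\<lambda>y. uc y ^ 2)"
      using tendsto_uniform_limitI[OF unif[OF \<rho>(1,2)], of x] mem2[of 0] by (intro tendsto_intros) auto
    ultimately show "bint (\<lambda>y. (\<Sum>n. hom_part n v (x + d *\<^sub>R y)) * uc y ^ 2) = (\<Sum>n. hom_part n v x) * bint (\<lambda>y. uc y ^ 2)"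
      using LIMSEQ_unique by simp
  qed simp
qed

section \<open>Analyticity and unique continuation from the mean value property\<close>

definition mv_grad_const :: real where "mv_grad_const = 4 * W0 / norm (bint (\<lambda>y. uc y ^ 2))"

lemma mv_grad_const_pos: "mv_grad_const > 0"
  using W0_pos N2_nz by (simp add: mv_grad_const_def)

text \<open>A cruder gradient bound than \<open>gradient_estimate\<close>, resting on the weighted
  mean alone: it must serve the difference of \<open>v\<close> and its Taylor sum, for which only
  that property has been established.\<close>

lemma mean_value_on_gradient:
  assumes MV: "mean_value_on U v" and sub: "cball x d \<subseteq> U" and d: "d > 0"
    and bd: "\<And>p. p \<in> cball x d \<Longrightarrow> norm (v p) \<le> S"
  shows "norm (partial j v x) \<le> mv_grad_const * S / d"
proof -
  have d0: "d \<ge> 0" using d by simp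
  have "bint (\<lambda>y. of_real d * partial j v (x + d *\<^sub>R y) * uc y ^ Suc 1)
      = 2 * of_nat (Suc 1) * bint (\<lambda>y. v (x + d *\<^sub>R y) * of_real (y$j) * uc y ^ 1)"
    by (rule bint_by_parts) (rule mean_value_on_affine_grad[OF MV sub d0]; assumption)+
  moreover have "bint (\<lambda>y. of_real d * partial j v (x + d *\<^sub>R y) * uc y ^ Suc 1)
     = of_real d * (partial j v x * bint (\<lambda>y. uc y ^ 2))"
    using mean_value_on_partial[OF MV, of j] d sub by (simp add: mean_value_on_def mult.assoc bint_cmult numeral_2_eq_2)
  ultimately have "of_real d * (partial j v x * bint (\<lambda>y. uc y ^ 2)) = 4 * bint (\<lambda>y. v (x + d *\<^sub>R y) * of_real (y$j) * uc y)"
    by simp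
  from arg_cong[OF this, of norm]
  have "d * (norm (partial j v x) * norm (bint (\<lambda>y. uc y ^ 2))) = 4 * norm (bint (\<lambda>y. v (x + d *\<^sub>R y) * of_real (y$j) * uc y))"
    using d by (simp add: norm_mult)
  also have "\<dots> \<le> 4 * (W0 * S)"
  proof (intro mult_left_mono bint_bound)
    show "cb (\<lambda>y. v (x + d *\<^sub>R y) * of_real (y$j) * uc y)"
      by (intro continuous_intros mean_value_on_affine_grad[OF MV sub d0])
    fix y :: "real^3" assume y: "norm y < 1"
    have 1: "norm (v (x + d *\<^sub>R y)) \<le> S" using y d by (intro bd) (simp add: dist_norm mult_left_le)
    have 2: "norm (complex_of_real (y$j)) \<le> 1" using component_le_norm_cart[of y j] y by simp
    have 3: "norm (uc y) \<le> 1"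
      using y by (simp add: uc_def dot_square_norm power_le_one abs_le_iff del: of_real_diff of_real_1)
    have "norm (v (x + d *\<^sub>R y)) * norm (complex_of_real (y$j)) * norm (uc y) \<le> S * 1 * 1"
      using 1 2 3 order_trans[OF norm_ge_zero 1] by (intro mult_mono) auto
    then show "norm (v (x + d *\<^sub>R y) * of_real (y$j) * uc y) \<le> S" by (simp add: norm_mult)
  qed simp
  finally show ?thesis using d N2_nz by (simp add: mv_grad_const_def field_simps)
qed

text \<open>One shell of width \<open>d\<close> is spent per derivative, so the gradient bound can
  be applied \<open>k\<close> times in succession; the factor 3 counts the coordinates.\<close>

lemma iter_deriv_bound:
  "mean_value_on U v \<Longrightarrow> d > 0 \<Longrightarrow> cball x (real k * d) \<subseteq> U \<Longrightarrow> (\<And>p. p \<in> cball x (real k * d) \<Longrightarrow> norm (v p) \<le> S)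
    \<Longrightarrow> norm (iter_deriv k v y x) \<le> (3 * mv_grad_const * norm y / d) ^ k * S"
proof (induction k arbitrary: v S)
  case 0 then show ?case by simp
next
  case (Suc k)
  have sub: "cball p d \<subseteq> cball x (real (Suc k) * d)" if "p \<in> cball x (real k * d)" for p
    using that by (subst cball_subset_cball_iff) (auto simp: dist_commute algebra_simps)
  have S0: "S \<ge> 0" using order_trans[OF norm_ge_zero Suc.prems(4)[of x]] Suc.prems(2) by simp
  have iter_deriv: "norm (iter_deriv k (partial j v) y x) \<le> (3 * mv_grad_const * norm y / d) ^ k * (mv_grad_const * S / d)" for j
  proof (rule Suc.IH[OF mean_value_on_partial[OF Suc.prems(1)] Suc.prems(2)])
    show "cball x (real k * d) \<subseteq> U" using Suc.prems(2,3) by (auto simp: algebra_simps)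
    show "norm (partial j v p) \<le> mv_grad_const * S / d" if "p \<in> cball x (real k * d)" for p
      by (rule mean_value_on_gradient[OF Suc.prems(1) _ Suc.prems(2)]) (use sub[OF that] Suc.prems(3,4) in auto)
  qed
  have "norm (iter_deriv (Suc k) v y x) \<le> (\<Sum>j\<in>(UNIV::3 set). norm y * ((3 * mv_grad_const * norm y / d) ^ k * (mv_grad_const * S / d)))"
    unfolding iter_deriv.simps
  proof (rule sum_norm_le)
    fix j :: 3
    show "norm (of_real (y$j) * iter_deriv k (partial j v) y x) \<le> norm y * ((3 * mv_grad_const * norm y / d) ^ k * (mv_grad_const * S / d))"
      using component_le_norm_cart[of y j] iter_deriv[of j] unfolding norm_mult by (intro mult_mono) auto
  qed
  also have "\<dots> = (3 * mv_grad_const * norm y / d) ^ Suc k * S" by simp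
  finally show ?case .
qed

text \<open>The derivative of the remainder of order \<open>n + 1\<close> is the remainder of order
  \<open>n\<close> for the shifted family, and its bound is integrated by comparison with
  \<open>B t^(n+1) / (n+1)!\<close>.\<close>

lemma taylor_bound:
  fixes \<phi> :: "nat \<Rightarrow> real \<Rightarrow> complex"
  assumes "\<And>k t. t \<in> {0..1} \<Longrightarrow> (\<phi> k has_vector_derivative \<phi> (Suc k) t) (at t)"
    and "\<And>t. t \<in> {0..1} \<Longrightarrow> norm (\<phi> n t) \<le> B" and "t \<in> {0..1}"
  shows "norm (\<phi> 0 t - (\<Sum>i<n. \<phi> i 0 * of_real (t ^ i / fact i))) \<le> B * t ^ n / fact n"
  using assms
proof (induction n arbitrary: \<phi> t)
  case 0 then show ?case by simp
next
  case (Suc n)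
  define f where "f t = \<phi> 0 t - (\<Sum>i<Suc n. \<phi> i 0 * of_real (t ^ i / fact i))" for t
  define f' where "f' t = \<phi> 1 t - (\<Sum>i<n. \<phi> (Suc i) 0 * of_real (t ^ i / fact i))" for t
  have f: "f t = \<phi> 0 t - (\<phi> 0 0 + (\<Sum>i<n. \<phi> (Suc i) 0 * of_real (t ^ Suc i / fact (Suc i))))" for t
    by (simp add: f_def sum.lessThan_Suc_shift del: sum.lessThan_Suc fact_Suc power_Suc)
  have df: "(f has_vector_derivative f' t) (at t)" if "t \<in> {0..1}" for t
  proof -
    have "((\<lambda>t. t ^ Suc i / fact (Suc i)) has_real_derivative t ^ i / fact i) (at t)" for i
      using DERIV_cdivide[OF DERIV_pow[of "Suc i" t], of "fact (Suc i)"]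
      by (simp add: fact_Suc del: power_Suc of_nat_Suc)
    then have "((\<lambda>t. \<phi> (Suc i) 0 * of_real (t ^ Suc i / fact (Suc i))) has_vector_derivative \<phi> (Suc i) 0 * of_real (t ^ i / fact i)) (at t)" for i
      by (intro has_vector_derivative_mult_right has_vector_derivative_of_real)
         (simp add: has_real_derivative_iff_has_vector_derivative)
    then have "(f has_vector_derivative \<phi> 1 t - (0 + (\<Sum>i<n. \<phi> (Suc i) 0 * of_real (t ^ i / fact i)))) (at t)"
      unfolding f[abs_def] using Suc.prems(1)[OF that, of 0]
      by (intro has_vector_derivative_diff has_vector_derivative_add has_vector_derivative_sum has_vector_derivative_const) simp_all
    then show ?thesis by (simp add: f'_def)
  qed
  have bf: "norm (f' s) \<le> B * s ^ n / fact n" if "s \<in> {0..1}" for s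
    unfolding f'_def using Suc.IH[of "\<lambda>k. \<phi> (Suc k)" s] Suc.prems that by simp
  have "norm (f t - f 0) \<le> B * t ^ Suc n / fact (Suc n) - B * 0 ^ Suc n / fact (Suc n)"
  proof (cases "t = 0")
    case False
    then have t: "0 < t" "t \<le> 1" using Suc.prems by auto
    show ?thesis
    proof (rule differentiable_bound_general[OF t(1), where f'=f' and \<phi>'="\<lambda>s. B * s ^ n / fact n"])
      show "continuous_on {0..t} f"
        by (intro continuous_at_imp_continuous_on ballI has_vector_derivative_continuous[OF df]) (use t in auto)
      show "continuous_on {0..t} (\<lambda>t. B * t ^ Suc n / fact (Suc n))" by (intro continuous_intros) auto
      show "(f has_vector_derivative f' x) (at x)" if "0 < x" "x < t" for x using that t by (intro df) auto
      show "norm (f' x) \<le> B * x ^ n / fact n" if "0 < x" "x < t" for x using that t by (intro bf) auto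
      show "((\<lambda>t. B * t ^ Suc n / fact (Suc n)) has_vector_derivative B * x ^ n / fact n) (at x)" for x
        using DERIV_cmult[OF DERIV_cdivide[OF DERIV_pow[of "Suc n" x], of "fact (Suc n)"], of B]
        by (simp add: fact_Suc has_real_derivative_iff_has_vector_derivative del: power_Suc of_nat_Suc)
    qed
  qed simp
  moreover have "f 0 = 0" by (simp add: f)
  ultimately show ?case by (simp add: f_def)
qed

text \<open>The quotient k^k / k! is a single term of the series of e^k. This absorbs the k^k that
  arises when a fixed radius is cut into k shells.\<close>

lemma power_self_le_exp_fact: "real k ^ k \<le> exp 1 ^ k * fact k"
proof -
  have "real k ^ k / fact k \<le> exp (real k)"
  proof -
    have "(\<Sum>n\<in>{k}. real k ^ n /\<^sub>R fact n) \<le> (\<Sum>n. real k ^ n /\<^sub>R fact n)"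
      using summable_exp[of "real k"] by (intro sum_le_suminf) (auto simp: divide_inverse)
    then show ?thesis by (simp add: exp_def divide_inverse mult.commute)
  qed
  also have "exp (real k) = exp 1 ^ k" by (simp add: exp_of_nat_mult[symmetric])
  finally show ?thesis by (simp add: field_simps)
qed

text \<open>The fraction of the radius on which convergence of the Taylor series is proved: the
  first summand of the denominator makes the ratio \<open>r\<close> of
  \<open>local_expansion\<close> less than 1, the summand 2 keeps \<open>\<eta>\<close> at most
  1/2.\<close>

definition \<eta> :: real where "\<eta> = 1 / (6 * exp 1 * mv_grad_const + 2)"

lemma \<eta>_pos: "\<eta> > 0" and \<eta>_half: "\<eta> \<le> 1/2" and \<eta>_Cg: "6 * exp 1 * mv_grad_const * \<eta> < 1"
proof -
  have "mv_grad_const * (exp 1 * 6) > 0" using mv_grad_const_pos by simp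
  then show "\<eta> > 0" "\<eta> \<le> 1/2" "6 * exp 1 * mv_grad_const * \<eta> < 1"
    by (auto simp: \<eta>_def field_simps)
qed

text \<open>Cauchy-type estimates along the segment from \<open>x\<close> to \<open>x + y\<close>:
  the k-th directional derivative is at most \<open>r^k k! S\<close> with r < 1, so the Taylor
  remainder tends to 0.\<close>

lemma local_expansion:
  assumes MV: "mean_value_on U v" and sub: "cball x \<delta> \<subseteq> U" and d: "\<delta> > 0" and y: "norm y < \<eta> * \<delta>"
  shows "(\<lambda>k. iter_deriv k v y x / fact k) sums v (x + y)"
proof -
  have "compact (v ` cball x \<delta>)"
    using MV sub by (intro compact_continuous_image) (auto simp: mean_value_on_def intro: continuous_on_subset)
  then obtain S where S: "\<And>p. p \<in> cball x \<delta> \<Longrightarrow> norm (v p) \<le> S"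
    by (meson bounded_iff compact_imp_bounded image_eqI)
  have S0: "S \<ge> 0" using order_trans[OF norm_ge_zero S[of x]] d by simp
  have "\<eta> * \<delta> \<le> 1/2 * \<delta>" using d by (intro mult_right_mono \<eta>_half) auto
  then have yh: "norm y \<le> \<delta> / 2" using y by simp
  define r where "r = 6 * exp 1 * mv_grad_const * norm y / \<delta>"
  have r: "0 \<le> r" "r < 1"
  proof -
    show "0 \<le> r" using mv_grad_const_pos d by (simp add: r_def)
    have "r \<le> 6 * exp 1 * mv_grad_const * (\<eta> * \<delta>) / \<delta>"
      unfolding r_def using mv_grad_const_pos d y by (intro divide_right_mono mult_left_mono) auto
    also have "\<dots> < 1" using \<eta>_Cg d by simp
    finally show "r < 1" .
  qed
  define \<phi> where "\<phi> k t = iter_deriv k v y (x + t *\<^sub>R y)" for k t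
  have mem: "x + t *\<^sub>R y \<in> cball x (\<delta> / 2)" if "t \<in> {0..1}" for t
  proof -
    have "\<bar>t\<bar> * norm y \<le> 1 * (\<delta> / 2)" using that yh by (intro mult_mono) auto
    then show ?thesis by (simp add: dist_norm)
  qed
  have d\<phi>: "(\<phi> k has_vector_derivative \<phi> (Suc k) t) (at t)" if "t \<in> {0..1}" for k t
    unfolding \<phi>_def[abs_def] using mem[OF that] sub d by (intro iter_deriv_derivative[OF MV]) auto
  have b\<phi>: "norm (\<phi> k t) \<le> r ^ k * fact k * S" if "t \<in> {0..1}" "k > 0" for k t
  proof -
    \<comment> \<open>The k shells exhaust half the radius, the other half being taken up by the
      position on the segment. The power k^k this produces is paid for by
      \<open>power_self_le_exp_fact\<close>.\<close>
    define d' where "d' = \<delta> / (2 * real k)"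
    have d': "d' > 0" "real k * d' = \<delta> / 2" using d that by (auto simp: d'_def)
    have s: "cball (x + t *\<^sub>R y) (real k * d') \<subseteq> cball x \<delta>"
      unfolding d'(2) using mem[OF that(1)] by (subst cball_subset_cball_iff) (auto simp: dist_commute)
    have "norm (\<phi> k t) \<le> (3 * mv_grad_const * norm y / d') ^ k * S"
      unfolding \<phi>_def by (rule iter_deriv_bound[OF MV d'(1)]) (use s sub S in auto)
    also have "(3 * mv_grad_const * norm y / d') ^ k = (6 * mv_grad_const * norm y / \<delta>) ^ k * real k ^ k"
        unfolding power_mult_distrib[symmetric] using that d by (intro arg_cong[where f="\<lambda>x. x ^ k"]) (simp add: d'_def)
    also have "\<dots> \<le> (6 * mv_grad_const * norm y / \<delta>) ^ k * (exp 1 ^ k * fact k)"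
      using mv_grad_const_pos d by (intro mult_left_mono power_self_le_exp_fact) auto
    also have "\<dots> = r ^ k * fact k"
      by (simp add: r_def mult_ac flip: power_mult_distrib)
    finally show ?thesis using S0 by (simp add: mult_right_mono)
  qed
  have "norm (v (x + y) - (\<Sum>i<k. iter_deriv i v y x / fact i)) \<le> r ^ k * S" if "k > 0" for k
    using taylor_bound[of \<phi> k "r ^ k * fact k * S" 1, OF d\<phi> b\<phi>] that
    by (simp add: \<phi>_def field_simps)
  then have "\<forall>\<^sub>F k in sequentially. norm ((\<Sum>i<k. iter_deriv i v y x / fact i) - v (x + y)) \<le> r ^ k * S"
    unfolding eventually_sequentially by (intro exI[of _ 1]) (auto simp: norm_minus_commute)
  moreover have "(\<lambda>k. r ^ k * S) \<longlonglongrightarrow> 0"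
    using r by (intro tendsto_mult_left_zero LIMSEQ_power_zero) auto
  ultimately have "(\<lambda>k. (\<Sum>i<k. iter_deriv i v y x / fact i) - v (x + y)) \<longlonglongrightarrow> 0"
    by (rule Lim_null_comparison)
  then show ?thesis by (simp add: sums_def LIM_zero_iff)
qed

text \<open>A chain of balls along the segment from 0 to \<open>x\<close>. Where \<open>v\<close>
  vanishes near a point all its derivatives there are 0, so the local expansion clears a ball of
  radius \<open>\<eta> * \<delta>\<close>; this radius is the same along the whole segment, so
  finitely many steps suffice.\<close>

lemma mean_value_on_unique_continuation:
  assumes MV: "mean_value_on (ball 0 R) v" and e: "e > 0" and z: "\<And>p. p \<in> ball 0 e \<Longrightarrow> v p = 0" and x: "x \<in> ball 0 R"
  shows "v x = 0"
proof -
  define \<delta> where "\<delta> = (R - norm x) / 2"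
  have \<delta>: "\<delta> > 0" "norm x + \<delta> < R" using x by (auto simp: \<delta>_def field_simps)
  \<comment> \<open>The parameter step, chosen so that consecutive centres are less than
    \<open>\<eta> * \<delta>\<close> apart; the added 1 covers \<open>x = 0\<close>.\<close>
  define h where "h = \<eta> * \<delta> / (norm x + 1)"
  have "h > 0" using \<eta>_pos \<delta> by (simp add: h_def add_nonneg_pos)
  have hx: "h * norm x < \<eta> * \<delta>"
  proof -
    have "h * norm x < h * (norm x + 1)" using \<open>h > 0\<close> by simp
    also have "\<dots> = \<eta> * \<delta>" using add_nonneg_pos[OF norm_ge_zero zero_less_one, of x] by (simp add: h_def)
    finally show ?thesis .
  qed
  define van where "van p \<longleftrightarrow> (\<exists>e>0. \<forall>q\<in>ball p e. v q = 0)" for p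
  have step: "v q = 0" if p: "van (t *\<^sub>R x)" and t: "t \<in> {0..1}" and q: "q \<in> ball (t *\<^sub>R x) (\<eta> * \<delta>)" for t q
  proof -
    have "norm (t *\<^sub>R x) \<le> norm x" using t by (simp add: mult_left_le_one_le)
    then have sub: "cball (t *\<^sub>R x) \<delta> \<subseteq> ball 0 R"
      using \<delta> by (subst cball_subset_ball_iff) (simp add: dist_norm)
    obtain e where e: "e > 0" "\<And>q. q \<in> ball (t *\<^sub>R x) e \<Longrightarrow> v q = 0" using p by (auto simp: van_def)
    have "iter_deriv k v y (t *\<^sub>R x) = iter_deriv k (\<lambda>x. 0) y (t *\<^sub>R x)" for k y
      by (rule iter_deriv_cong[of "ball (t *\<^sub>R x) e"]) (use e in auto)
    then have "iter_deriv k v y (t *\<^sub>R x) = 0" for k y by (simp add: iter_deriv_zero)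
    moreover have "(\<lambda>k. iter_deriv k v (q - t *\<^sub>R x) (t *\<^sub>R x) / fact k) sums v (t *\<^sub>R x + (q - t *\<^sub>R x))"
      by (rule local_expansion[OF MV sub \<delta>(1)]) (use q in \<open>simp add: dist_norm norm_minus_commute\<close>)
    ultimately have "(\<lambda>k. 0) sums v q" by simp
    then show ?thesis using sums_unique2 sums_zero by metis
  qed
  have "\<forall>t\<in>{0..1}. t \<le> real n * h \<longrightarrow> van (t *\<^sub>R x)" for n
  proof (induction n)
    case 0
    show ?case using e z by (auto simp: van_def)
  next
    case (Suc n)
    show ?case
    proof (intro ballI impI)
      fix t :: real assume t: "t \<in> {0..1}" "t \<le> real (Suc n) * h"
      define t' where "t' = max 0 (t - h)"
      have t': "t' \<in> {0..1}" "t' \<le> real n * h" "0 \<le> t - t'" "t - t' \<le> h"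
        using t \<open>h > 0\<close> by (auto simp: t'_def algebra_simps)
      have "van (t' *\<^sub>R x)" using Suc t' by blast
      have "dist (t' *\<^sub>R x) (t *\<^sub>R x) = (t - t') * norm x"
        using t' by (simp add: dist_norm norm_minus_commute flip: scaleR_diff_left)
      also have "\<dots> \<le> h * norm x" using t' by (intro mult_right_mono) auto
      also note hx
      finally have "t *\<^sub>R x \<in> ball (t' *\<^sub>R x) (\<eta> * \<delta>)" by simp
      then obtain e where "e > 0" "ball (t *\<^sub>R x) e \<subseteq> ball (t' *\<^sub>R x) (\<eta> * \<delta>)"
        using open_contains_ball open_ball by blast
      then show "van (t *\<^sub>R x)"
        unfolding van_def using step[OF \<open>van (t' *\<^sub>R x)\<close> t'(1)] by blast
    qed
  qed
  moreover obtain n where "1 \<le> real n * h"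
    using \<open>h > 0\<close> by (metis real_arch_simple pos_divide_le_eq)
  ultimately have "van (1 *\<^sub>R x)" by fastforce
  then show ?thesis by (auto simp: van_def)
qed

text \<open>Cauchy estimates only give convergence to \<open>v\<close> on a fraction of the ball.
  The full ball is reached because the Taylor sum has the mean value property throughout, so its
  difference from \<open>v\<close>, zero near the origin, is zero everywhere.\<close>

theorem harmonic_expansion:
  assumes h: "harmonic_on (ball 0 R) v" and x: "x \<in> ball 0 R"
  shows "(\<lambda>n. hom_part n v x) sums v x"
proof -
  have R: "R > 0" using x by (metis ball_eq_empty empty_iff not_le)
  have MV: "mean_value_on (ball 0 R) v" by (rule harmonic_on_mean_value[OF h])
  let ?d = "\<lambda>x. 1 * v x + (- 1) * (\<Sum>n. hom_part n v x)"
  have "mean_value_on (ball 0 R) ?d" by (rule mean_value_on_lin[OF MV mean_value_on_suminf_T[OF h R]])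
  moreover have "?d p = 0" if "p \<in> ball 0 (\<eta> * (R / 2))" for p
  proof -
    have "(\<lambda>k. iter_deriv k v p 0 / fact k) sums v (0 + p)"
      by (rule local_expansion[OF MV, of _ "R / 2"]) (use R that in auto)
    then have "(\<lambda>k. hom_part k v p) sums v p" by (simp add: hom_part_def)
    then have "(\<Sum>k. hom_part k v p) = v p" by (rule sums_unique[symmetric])
    then show ?thesis by simp
  qed
  ultimately have "?d x = 0"
    using mean_value_on_unique_continuation[of R ?d "\<eta> * (R / 2)" x] R \<eta>_pos x by simp
  then have eq: "v x = (\<Sum>n. hom_part n v x)" by simp
  have "summable (\<lambda>n. hom_part n v x)"
  proof -
    have "0 < (norm x + R) / 2" "(norm x + R) / 2 < R" using x R by (auto simp: add_nonneg_pos)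
    then obtain C q where q: "0 \<le> q" "q < 1"
      and b: "\<And>n x'. norm x' \<le> (norm x + R) / 2 \<Longrightarrow> norm (hom_part n v x') \<le> C * q ^ n"
      by (rule hom_part_geometric[OF h]) (rule that)
    have "summable (\<lambda>n. C * q ^ n)" using q by (intro summable_mult summable_geometric) simp
    then show ?thesis
      by (rule summable_comparison_test') (use b x in auto)
  qed
  then show ?thesis unfolding eq by (rule summable_sums)
qed

section \<open>Sectoral coefficients\<close>

definition zc :: "real^3 \<Rightarrow> complex" where "zc y = Complex (y$2) (y$3)"

text \<open>The gradient of z = x_1 + i x_2. It is isotropic, 1 + i^2 = 0, which is why all powers
  of z and of its conjugate are harmonic.\<close>

definition zc_grad :: "3 \<Rightarrow> complex" where "zc_grad j = (if j = 2 then 1 else if j = 3 then \<i> else 0)"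

lemma zc_grad_simps [simp]: "zc_grad 1 = 0" "zc_grad 2 = 1" "zc_grad 3 = \<i>"
  by (simp_all add: zc_grad_def)

lemma zc_eq: "zc y = of_real (y$2) + \<i> * of_real (y$3)"
  by (simp add: zc_def complex_eq_iff)

lemma norm_zc_le: "norm (zc y) \<le> norm y"
proof (rule power2_le_imp_le)
  show "(norm (zc y))\<^sup>2 \<le> (norm y)\<^sup>2"
    unfolding power2_norm_eq_inner[of y] cmod_power2 by (simp add: zc_def inner_vec_def sum_3 power2_eq_square)
qed simp

lemma has_grad_zc: "has_grad zc zc_grad y"
proof -
  have "has_grad (\<lambda>y. of_real (y$2) + \<i> * of_real (y$3)) (\<lambda>j. (if j = 2 then 1 else 0) + \<i> * (if j = 3 then 1 else 0)) y"
    by (intro has_grad_add has_grad_cmult has_grad_coord)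
  then show ?thesis
    unfolding zc_eq[abs_def] by (rule has_grad_eq) (auto simp: zc_grad_def)
qed

lemma has_grad_cnj_zc: "has_grad (\<lambda>y. cnj (zc y)) (\<lambda>j. cnj (zc_grad j)) y"
  by (rule has_grad_cnj[OF has_grad_zc])

lemma continuous_on_zc [continuous_intros]: "continuous_on S zc"
  by (rule has_grad_imp_continuous_on) (rule has_grad_zc)

text \<open>This is (d/dz)^n v(0) / n! with d/dz = (d_1 - i d_2) / 2, the coefficient of z^n in the
  expansion of \<open>v\<close>.\<close>

primrec sectoral_coeff :: "nat \<Rightarrow> (real^3 \<Rightarrow> complex) \<Rightarrow> complex" where
  "sectoral_coeff 0 v = v 0"
| "sectoral_coeff (Suc n) v = (sectoral_coeff n (partial 2 v) - \<i> * sectoral_coeff n (partial 3 v)) / (2 * of_nat (Suc n))"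

definition zc_moment :: "nat \<Rightarrow> nat \<Rightarrow> complex" where "zc_moment n k = bint (\<lambda>y. (zc y * cnj (zc y)) ^ n * uc y ^ k)"

text \<open>Green's identity with the gradient of \<open>cnj z ^ (n+1) / (n+1)\<close>, whose radial
  part is \<open>cnj z ^ (n+1)\<close>. One factor \<open>cnj z\<close> is thereby traded for the
  derivative 2 d/dz of \<open>A\<close> and one more power of the weight.\<close>

lemma bint_green_null:
  assumes A: "\<And>y. y \<in> cball 0 1 \<Longrightarrow> has_grad A (\<lambda>j. dA j y) y"
    and cA: "\<And>j. cb (dA j)"
  shows "bint (\<lambda>y. (dA 2 y - \<i> * dA 3 y) * cnj (zc y) ^ n * uc y ^ Suc k)
    = 2 * of_nat (Suc k) * bint (\<lambda>y. A y * cnj (zc y) ^ Suc n * uc y ^ k)"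
proof -
  have g: "has_grad (\<lambda>y. cnj (zc y) ^ n * cnj (zc_grad j)) (\<lambda>i. of_nat n * cnj (zc y) ^ (n - 1) * cnj (zc_grad i) * cnj (zc_grad j)) y" for j y
    using has_grad_cmult[OF has_grad_pow[OF has_grad_cnj_zc, of n], of "cnj (zc_grad j)" y] by (simp add: mult_ac)
  have "bint (\<lambda>y. (\<Sum>j\<in>UNIV. dA j y * (cnj (zc y) ^ n * cnj (zc_grad j))) * uc y ^ Suc k) =
     2 * of_nat (Suc k) * bint (\<lambda>y. A y * (\<Sum>j\<in>UNIV. of_real (y$j) * (cnj (zc y) ^ n * cnj (zc_grad j))) * uc y ^ k)"
    by (rule bint_green[OF A cA g]) (auto intro!: continuous_intros simp: sum_3 mult.assoc)
  moreover have "(\<Sum>j\<in>UNIV. of_real (y$j) * (cnj (zc y) ^ n * cnj (zc_grad j))) = cnj (zc y) ^ Suc n" for y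
    by (simp add: sum_3 zc_eq algebra_simps)
  moreover have "(\<Sum>j\<in>UNIV. dA j y * (cnj (zc y) ^ n * cnj (zc_grad j))) = (dA 2 y - \<i> * dA 3 y) * cnj (zc y) ^ n" for y
    by (simp add: sum_3 algebra_simps)
  ultimately show ?thesis by (simp only: mult.assoc)
qed

text \<open>The same trade for A = z^(n+1). Its factors are exactly those that appear in the
  induction step of \<open>null_projection\<close>.\<close>

lemma zc_moment_Suc: "of_nat (Suc n) * zc_moment n (Suc k) = of_nat (Suc k) * zc_moment (Suc n) k"
proof -
  have "bint (\<lambda>y. (of_nat (Suc n) * zc y ^ n * zc_grad 2 - \<i> * (of_nat (Suc n) * zc y ^ n * zc_grad 3)) * cnj (zc y) ^ n * uc y ^ Suc k)
    = 2 * of_nat (Suc k) * bint (\<lambda>y. zc y ^ Suc n * cnj (zc y) ^ Suc n * uc y ^ k)"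
  proof (rule bint_green_null[where dA="\<lambda>j y. of_nat (Suc n) * zc y ^ n * zc_grad j"])
    show "has_grad (\<lambda>y. zc y ^ Suc n) (\<lambda>j. of_nat (Suc n) * zc y ^ n * zc_grad j) y" for y
      using has_grad_pow[OF has_grad_zc, of "Suc n" y] by simp
  qed (intro continuous_intros)
  also have "(\<lambda>y. (of_nat (Suc n) * zc y ^ n * zc_grad 2 - \<i> * (of_nat (Suc n) * zc y ^ n * zc_grad 3)) * cnj (zc y) ^ n * uc y ^ Suc k)
    = (\<lambda>y. 2 * of_nat (Suc n) * ((zc y * cnj (zc y)) ^ n * uc y ^ Suc k))"
    by (simp add: power_mult_distrib algebra_simps)
  finally have "2 * of_nat (Suc n) * zc_moment n (Suc k) = 2 * of_nat (Suc k) * zc_moment (Suc n) k"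
    unfolding bint_cmult zc_moment_def by (simp only: power_mult_distrib)
  then show ?thesis by (simp del: of_nat_Suc)
qed

text \<open>The factors \<open>cnj z\<close> are moved one by one onto \<open>v\<close> as
  derivatives until the mean value identity finishes. Each move raises the weight exponent, hence
  the generalization over \<open>k\<close>; \<open>zc_moment_Suc\<close> undoes the shift.\<close>

lemma null_projection:
  assumes "harmonic_on (ball 0 R) v" "0 < t" "t < R"
  shows "bint (\<lambda>y. v (t *\<^sub>R y) * cnj (zc y) ^ n * uc y ^ k) = of_real t ^ n * sectoral_coeff n v * zc_moment n k"
  using assms(1)
proof (induction n arbitrary: v k)
  case 0
  have "bint (\<lambda>y. v (0 + t *\<^sub>R y) * uc y ^ k) = v 0 * bint (\<lambda>y. uc y ^ k)"
    by (rule harmonic_on_mean[OF 0]) (use assms in auto)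
  then show ?case by (simp add: zc_moment_def)
next
  case (Suc n)
  have sub: "cball 0 t \<subseteq> ball 0 R" and t0: "t \<ge> 0" using assms by auto
  have MV: "mean_value_on (ball 0 R) v" by (rule harmonic_on_mean_value[OF Suc.prems])
  have "bint (\<lambda>y. (of_real t * partial 2 v (0 + t *\<^sub>R y) - \<i> * (of_real t * partial 3 v (0 + t *\<^sub>R y))) * cnj (zc y) ^ n * uc y ^ Suc k)
    = 2 * of_nat (Suc k) * bint (\<lambda>y. v (0 + t *\<^sub>R y) * cnj (zc y) ^ Suc n * uc y ^ k)"
    by (rule bint_green_null) (rule mean_value_on_affine_grad[OF MV sub t0]; assumption)+
  also have "bint (\<lambda>y. (of_real t * partial 2 v (0 + t *\<^sub>R y) - \<i> * (of_real t * partial 3 v (0 + t *\<^sub>R y))) * cnj (zc y) ^ n * uc y ^ Suc k)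
    = bint (\<lambda>y. of_real t * (partial 2 v (0 + t *\<^sub>R y) * cnj (zc y) ^ n * uc y ^ Suc k) - \<i> * of_real t * (partial 3 v (0 + t *\<^sub>R y) * cnj (zc y) ^ n * uc y ^ Suc k))"
    by (simp add: algebra_simps)
  also have "\<dots> = bint (\<lambda>y. of_real t * (partial 2 v (0 + t *\<^sub>R y) * cnj (zc y) ^ n * uc y ^ Suc k))
      - bint (\<lambda>y. \<i> * of_real t * (partial 3 v (0 + t *\<^sub>R y) * cnj (zc y) ^ n * uc y ^ Suc k))"
    by (rule bint_diff; intro continuous_on_mult continuous_intros mean_value_on_affine_grad[OF MV sub t0])
  also have "\<dots> = of_real t * (of_real t ^ n * sectoral_coeff n (partial 2 v) * zc_moment n (Suc k)) - \<i> * of_real t * (of_real t ^ n * sectoral_coeff n (partial 3 v) * zc_moment n (Suc k))"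
    unfolding bint_cmult add_0 Suc.IH[OF harmonic_on_partial[OF Suc.prems]] ..
  also have "\<dots> = of_real t ^ Suc n * sectoral_coeff (Suc n) v * (2 * (of_nat (Suc n) * zc_moment n (Suc k)))"
    by (simp add: field_simps del: of_nat_Suc)
  also have "\<dots> = 2 * of_nat (Suc k) * (of_real t ^ Suc n * sectoral_coeff (Suc n) v * zc_moment (Suc n) k)"
    unfolding zc_moment_Suc by (simp only: mult_ac)
  finally show ?case by (simp del: of_nat_Suc power_Suc sectoral_coeff.simps)
qed

text \<open>In the plane x_0 = 0 Euler's identity keeps only the partials 2 and 3, and x_1 d_1 + x_2
  d_2 = z d/dz + \<open>cnj z\<close> d/d(cnj z) makes it a recursion for coefficients. The
  coefficient of the pure power z^n is singled out because it belongs to h.\<close>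

lemma hom_part_disc:
  "\<exists>c. c 0 = sectoral_coeff n v \<and> (\<forall>y. y$1 = 0 \<longrightarrow> hom_part n v y = (\<Sum>l\<le>n. c l * zc y ^ (n - l) * cnj (zc y) ^ l))"
proof (induction n arbitrary: v)
  case 0
  show ?case by (rule exI[of _ "\<lambda>_. v 0"]) (simp add: hom_part_0)
next
  case (Suc n)
  obtain a where a: "a 0 = sectoral_coeff n (partial 2 v)"
    "\<And>y. y$1 = 0 \<Longrightarrow> hom_part n (partial 2 v) y = (\<Sum>l\<le>n. a l * zc y ^ (n - l) * cnj (zc y) ^ l)"
    using Suc[of "partial 2 v"] by blast
  obtain b where b: "b 0 = sectoral_coeff n (partial 3 v)"
    "\<And>y. y$1 = 0 \<Longrightarrow> hom_part n (partial 3 v) y = (\<Sum>l\<le>n. b l * zc y ^ (n - l) * cnj (zc y) ^ l)"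
    using Suc[of "partial 3 v"] by blast
  define s where "s = 1 / (2 * of_nat (Suc n) :: complex)"
  \<comment> \<open>\<open>e\<close> collects the products with z, which keep the exponent of
    \<open>cnj z\<close>; \<open>f\<close> collects those with \<open>cnj z\<close>, which raise it
    by one. Since \<open>f 0 = 0\<close>, the leading coefficient obeys the recursion of
    \<open>sectoral_coeff\<close>.\<close>
  define e where "e l = (if l \<le> n then a l - \<i> * b l else 0)" for l
  define f where "f l = (case l of 0 \<Rightarrow> 0 | Suc l \<Rightarrow> a l + \<i> * b l)" for l
  show ?case
  proof (intro exI[of _ "\<lambda>l. s * (e l + f l)"] conjI allI impI)
    show "s * (e 0 + f 0) = sectoral_coeff (Suc n) v" by (simp add: e_def f_def s_def a b del: of_nat_Suc)
    fix y :: "real^3" assume y: "y$1 = 0"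
    let ?z = "zc y"
    have y2: "complex_of_real (y$2) = (?z + cnj ?z) / 2" by (simp add: zc_def complex_eq_iff)
    have y3: "complex_of_real (y$3) = - \<i> * (?z - cnj ?z) / 2" by (simp add: zc_def complex_eq_iff)
    have "of_nat (Suc n) * hom_part (Suc n) v y = of_real (y$2) * hom_part n (partial 2 v) y + of_real (y$3) * hom_part n (partial 3 v) y"
      by (simp add: hom_part_Suc sum_3 y del: of_nat_Suc)
    also have "\<dots> = (?z * (hom_part n (partial 2 v) y - \<i> * hom_part n (partial 3 v) y) + cnj ?z * (hom_part n (partial 2 v) y + \<i> * hom_part n (partial 3 v) y)) / 2"
      unfolding y2 y3 by (simp add: algebra_simps add_divide_distrib diff_divide_distrib)
    also have "hom_part n (partial 2 v) y - \<i> * hom_part n (partial 3 v) y = (\<Sum>l\<le>n. (a l - \<i> * b l) * ?z ^ (n - l) * cnj ?z ^ l)"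
      by (simp add: a b y sum_distrib_left sum_subtractf algebra_simps)
    also have "hom_part n (partial 2 v) y + \<i> * hom_part n (partial 3 v) y = (\<Sum>l\<le>n. (a l + \<i> * b l) * ?z ^ (n - l) * cnj ?z ^ l)"
      by (simp add: a b y sum_distrib_left sum.distrib algebra_simps)
    also have "?z * (\<Sum>l\<le>n. (a l - \<i> * b l) * ?z ^ (n - l) * cnj ?z ^ l) = (\<Sum>l\<le>Suc n. e l * ?z ^ (Suc n - l) * cnj ?z ^ l)"
      by (auto simp: sum_distrib_left e_def Suc_diff_le mult_ac intro!: sum.cong)
    also have "cnj ?z * (\<Sum>l\<le>n. (a l + \<i> * b l) * ?z ^ (n - l) * cnj ?z ^ l) = (\<Sum>l\<le>Suc n. f l * ?z ^ (Suc n - l) * cnj ?z ^ l)"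
      by (subst sum.atMost_Suc_shift) (auto simp: sum_distrib_left f_def mult_ac intro!: sum.cong)
    also have "((\<Sum>l\<le>Suc n. e l * ?z ^ (Suc n - l) * cnj ?z ^ l) + (\<Sum>l\<le>Suc n. f l * ?z ^ (Suc n - l) * cnj ?z ^ l)) / 2
        = of_nat (Suc n) * (\<Sum>l\<le>Suc n. s * (e l + f l) * ?z ^ (Suc n - l) * cnj ?z ^ l)"
      unfolding sum.distrib[symmetric] sum_distrib_left sum_divide_distrib
      by (rule sum.cong) (simp_all add: s_def field_simps del: of_nat_Suc)
    finally show "hom_part (Suc n) v y = (\<Sum>l\<le>Suc n. s * (e l + f l) * ?z ^ (Suc n - l) * cnj ?z ^ l)"
      by (simp only: mult_cancel_left of_nat_eq_0_iff nat.distinct simp_thms)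
  qed
qed

section \<open>Taylor parts on the disc x_0 = 0\<close>

definition disc_point :: "complex \<Rightarrow> real^3" where "disc_point w = vector [0, Re w, Im w]"

lemma disc_point_simps [simp]: "disc_point w $ 1 = 0" "zc (disc_point w) = w"
  by (simp_all add: disc_point_def zc_def)

lemma norm_disc: "norm (disc_point w) = norm w"
  by (simp add: norm_vec_def L2_set_def sum_3 disc_point_def cmod_def)

lemma disc_point_zc: "y$1 = 0 \<Longrightarrow> disc_point (zc y) = y"
  by (simp add: disc_point_def zc_def vec_eq_iff forall_3)

lemma max_modulus_unit_disc:
  assumes "P holomorphic_on UNIV" "\<And>s. norm s = 1 \<Longrightarrow> norm (P s) \<le> M" "norm s \<le> 1"
  shows "norm (P s) \<le> M"
proof (rule maximum_modulus_frontier[of P "cball 0 1"])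
  show "P holomorphic_on interior (cball 0 1)" using assms(1) by (rule holomorphic_on_subset) auto
  show "continuous_on (closure (cball 0 1)) P"
    using assms(1) by (auto intro: holomorphic_on_imp_continuous_on continuous_on_subset)
qed (use assms in auto)

lemma unit_sqrt: assumes "norm (s::complex) = 1" obtains \<mu> where "norm \<mu> = 1" "s = \<mu> * \<mu>"
proof -
  have "norm (csqrt s) = 1" using assms by (simp add: norm_csqrt)
  moreover have "s = csqrt s * csqrt s" by (simp flip: power2_eq_square)
  ultimately show ?thesis by (rule that)
qed

text \<open>Rotating \<open>w\<close> by \<open>cnj \<mu>\<close> multiplies the term with exponents
  n - l and l by \<open>\<mu> ^ (2 l - n)\<close>. With s = \<open>\<mu>\<close>^2 the Taylor part
  on the circle is therefore, up to a unimodular factor, a polynomial \<open>P s\<close>, whose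
  value at 0 is the pure z^n term; the maximum principle does the rest.\<close>

lemma sectoral_coeff_bound:
  assumes bd: "\<And>y. y$1 = 0 \<Longrightarrow> norm (zc y) = norm w \<Longrightarrow> norm (hom_part n v y) \<le> M"
  shows "norm (sectoral_coeff n v * w ^ n) \<le> M"
proof -
  obtain c where c: "c 0 = sectoral_coeff n v" "\<And>y. y$1 = 0 \<Longrightarrow> hom_part n v y = (\<Sum>l\<le>n. c l * zc y ^ (n - l) * cnj (zc y) ^ l)"
    using hom_part_disc by blast
  define P where "P s = (\<Sum>l\<le>n. c l * w ^ (n - l) * cnj w ^ l * s ^ l)" for s
  have "norm (P 0) \<le> M"
  proof (rule max_modulus_unit_disc[where P=P and s=0])
    show "P holomorphic_on UNIV" unfolding P_def by (intro holomorphic_intros)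
    fix s :: complex assume "norm s = 1"
    then obtain \<mu> where l: "norm \<mu> = 1" "s = \<mu> * \<mu>" by (rule unit_sqrt)
    have ll: "\<mu> * cnj \<mu> = 1" using l by (simp add: complex_norm_square[symmetric] mult.commute)
    have "P s = \<mu> ^ n * hom_part n v (disc_point (cnj \<mu> * w))"
    proof -
      have "c l' * w ^ (n - l') * cnj w ^ l' * s ^ l' = \<mu> ^ n * (c l' * (cnj \<mu> * w) ^ (n - l') * cnj (cnj \<mu> * w) ^ l')" if "l' \<le> n" for l'
      proof -
        have "\<mu> ^ n * cnj \<mu> ^ (n - l') = \<mu> ^ l' * (\<mu> * cnj \<mu>) ^ (n - l')"
          using that by (simp add: power_mult_distrib mult.assoc[symmetric] flip: power_add)
        then have e1: "\<mu> ^ n * cnj \<mu> ^ (n - l') = \<mu> ^ l'" by (simp add: ll)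
        have "\<mu> ^ n * (c l' * (cnj \<mu> * w) ^ (n - l') * cnj (cnj \<mu> * w) ^ l') = c l' * w ^ (n - l') * cnj w ^ l' * \<mu> ^ l' * (\<mu> ^ n * cnj \<mu> ^ (n - l'))"
          by (simp add: power_mult_distrib mult_ac)
        then have "\<mu> ^ n * (c l' * (cnj \<mu> * w) ^ (n - l') * cnj (cnj \<mu> * w) ^ l') = c l' * w ^ (n - l') * cnj w ^ l' * \<mu> ^ l' * \<mu> ^ l'"
          unfolding e1 .
        moreover have "s ^ l' = \<mu> ^ l' * \<mu> ^ l'" by (simp add: l(2) power_mult_distrib)
        ultimately show ?thesis by (simp only: mult.assoc)
      qed
      then show ?thesis unfolding P_def by (subst c(2)) (auto simp: sum_distrib_left intro!: sum.cong)
    qed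
    then show "norm (P s) \<le> M"
      using bd[of "disc_point (cnj \<mu> * w)"] l by (simp add: norm_mult norm_power)
  qed simp
  moreover have "P 0 = sectoral_coeff n v * w ^ n"
    unfolding P_def by (subst sum.atMost_shift) (simp add: c)
  ultimately show ?thesis by simp
qed

text \<open>\<open>P\<close> interpolates between the sectoral term \<open>P 0\<close> and the full
  Taylor part \<open>P 1\<close>. On the unit circle |P'| is |w| / 2 times the modulus of (d_1 + i
  d_2) of the Taylor part at a rotated point, so the hypothesis and the maximum principle bound
  \<open>P'\<close> on the disc, and the mean value inequality bounds
  \<open>P 1 - P 0\<close>.\<close>

lemma disc_point_bound:
  assumes MV: "mean_value_on U F" "0 \<in> U"
    and bd: "\<And>y. y$1 = 0 \<Longrightarrow> norm (zc y) = norm w \<Longrightarrow> norm (hom_part m (partial 2 F) y + \<i> * hom_part m (partial 3 F) y) \<le> M"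
  shows "norm (hom_part (Suc m) F (disc_point w) - sectoral_coeff (Suc m) F * w ^ Suc m) \<le> norm w / 2 * M"
proof -
  define n where "n = Suc m"
  obtain c where c: "c 0 = sectoral_coeff n F" "\<And>y. y$1 = 0 \<Longrightarrow> hom_part n F y = (\<Sum>l\<le>n. c l * zc y ^ (n - l) * cnj (zc y) ^ l)"
    using hom_part_disc by blast
  define Q where "Q y = (\<Sum>l\<le>n. c l * (zc y ^ (n - l) * cnj (zc y) ^ l))" for y
  define dQ where "dQ j y = (\<Sum>l\<le>n. c l * (zc y ^ (n - l) * (of_nat l * cnj (zc y) ^ (l - 1) * cnj (zc_grad j))
      + (of_nat (n - l) * zc y ^ (n - l - 1) * zc_grad j) * cnj (zc y) ^ l))" for j y
  have gQ: "has_grad Q (\<lambda>j. dQ j y) y" for y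
    unfolding Q_def[abs_def] dQ_def
    by (intro has_grad_sum has_grad_cmult has_grad_mult has_grad_pow has_grad_zc has_grad_cnj_zc)
  \<comment> \<open>The expansion \<open>Q\<close> agrees with the Taylor part only in the plane
    where the first coordinate is 0, so derivatives are compared along axes 2 and 3, which remain in
    that plane.\<close>
  have part: "hom_part m (partial j F) y = dQ j y" if "y$1 = 0" "j \<noteq> 1" for j y
  proof -
    define E where "E = (axis j 1 :: real^3)"
    have E1: "E$1 = 0" using that by (simp add: E_def axis_def)
    have sE: "(\<Sum>i\<in>UNIV. of_real (E$i) * g i) = g j" for g :: "3 \<Rightarrow> complex"
    proof -
      have "(\<Sum>i\<in>UNIV. of_real (E$i) * g i) = (\<Sum>i\<in>UNIV. if i = j then g i else 0)"
        by (rule sum.cong) (auto simp: E_def axis_def)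
      then show ?thesis by simp
    qed
    have TQ: "hom_part n F (y + t *\<^sub>R E) = Q (y + t *\<^sub>R E)" for t
      using c(2)[of "y + t *\<^sub>R E"] that E1 by (simp add: Q_def mult.assoc)
    have "((\<lambda>t. hom_part n F (y + t *\<^sub>R E)) has_vector_derivative hom_part m (partial j F) (y + 0 *\<^sub>R E)) (at 0)"
    proof -
      have "has_grad (hom_part n F) (\<lambda>j. hom_part m (partial j F) (y + 0 *\<^sub>R E)) (y + 0 *\<^sub>R E)"
        unfolding n_def by (rule hom_part_Suc_grad[OF MV])
      from has_grad_ray[OF this] show ?thesis unfolding sE .
    qed
    moreover have "((\<lambda>t. Q (y + t *\<^sub>R E)) has_vector_derivative dQ j (y + 0 *\<^sub>R E)) (at 0)"
    proof -
      have "has_grad Q (\<lambda>j. dQ j (y + 0 *\<^sub>R E)) (y + 0 *\<^sub>R E)" by (rule gQ)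
      from has_grad_ray[OF this] show ?thesis unfolding sE .
    qed
    ultimately show ?thesis unfolding TQ by (auto dest: vector_derivative_unique_at)
  qed
  have dbar: "hom_part m (partial 2 F) y + \<i> * hom_part m (partial 3 F) y = 2 * (\<Sum>l\<le>n. of_nat l * c l * zc y ^ (n - l) * cnj (zc y) ^ (l - 1))" if "y$1 = 0" for y
  proof -
    have "dQ 2 y + \<i> * dQ 3 y = (\<Sum>l\<le>n. 2 * (of_nat l * c l * zc y ^ (n - l) * cnj (zc y) ^ (l - 1)))"
      unfolding dQ_def sum_distrib_left sum.distrib[symmetric]
      by (rule sum.cong) (auto simp: algebra_simps)
    then show ?thesis using part[OF that, of 2] part[OF that, of 3] by (simp add: sum_distrib_left)
  qed
  define P where "P s = (\<Sum>l\<le>n. c l * w ^ (n - l) * cnj w ^ l * s ^ l)" for s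
  define P' where "P' s = (\<Sum>l\<le>n. of_nat l * c l * w ^ (n - l) * cnj w ^ l * s ^ (l - 1))" for s
  have dP: "(P has_field_derivative P' s) (at s)" for s
    unfolding P_def[abs_def] P'_def
    by (auto intro!: derivative_eq_intros sum.cong simp: mult_ac)
  have bP': "norm (P' s) \<le> norm w / 2 * M" if "norm s \<le> 1" for s
  proof (rule max_modulus_unit_disc[where P=P', OF _ _ that])
    show "P' holomorphic_on UNIV" unfolding P'_def by (intro holomorphic_intros)
    fix s :: complex assume "norm s = 1"
    then obtain \<mu> where l: "norm \<mu> = 1" "s = \<mu> * \<mu>" by (rule unit_sqrt)
    have ll: "\<mu> * cnj \<mu> = 1" using l by (simp add: complex_norm_square[symmetric] mult.commute)
    let ?u = "cnj \<mu> * w"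
    have "P' s = cnj w * \<mu> ^ m * (\<Sum>l\<le>n. of_nat l * c l * ?u ^ (n - l) * cnj ?u ^ (l - 1))"
    proof -
      have "of_nat l' * c l' * w ^ (n - l') * cnj w ^ l' * s ^ (l' - 1) = cnj w * \<mu> ^ m * (of_nat l' * c l' * ?u ^ (n - l') * cnj ?u ^ (l' - 1))" if "l' \<le> n" for l'
      proof (cases l')
        case (Suc k)
        then have k: "n - Suc k = m - k" "k \<le> m" using that by (auto simp: n_def)
        have "\<mu> ^ m * cnj \<mu> ^ (m - k) = \<mu> ^ k * (\<mu> * cnj \<mu>) ^ (m - k)"
          using k by (simp add: power_mult_distrib mult.assoc[symmetric] flip: power_add)
        then have e: "\<mu> ^ m * cnj \<mu> ^ (m - k) = \<mu> ^ k" by (simp add: ll)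
        have "cnj w * \<mu> ^ m * (of_nat l' * c l' * ?u ^ (n - l') * cnj ?u ^ (l' - 1))
          = of_nat l' * c l' * w ^ (m - k) * (cnj w * cnj w ^ k) * \<mu> ^ k * (\<mu> ^ m * cnj \<mu> ^ (m - k))"
          unfolding Suc k by (simp add: power_mult_distrib mult_ac del: of_nat_Suc)
        also have "\<dots> = of_nat l' * c l' * w ^ (n - l') * cnj w ^ l' * s ^ (l' - 1)"
          unfolding e Suc k l(2) by (simp add: power_mult_distrib mult_ac del: of_nat_Suc)
        finally show ?thesis ..
      qed simp
      then show ?thesis unfolding P'_def by (auto simp: sum_distrib_left intro!: sum.cong)
    qed
    also have "(\<Sum>l\<le>n. of_nat l * c l * ?u ^ (n - l) * cnj ?u ^ (l - 1)) = (hom_part m (partial 2 F) (disc_point ?u) + \<i> * hom_part m (partial 3 F) (disc_point ?u)) / 2"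
      by (subst dbar) simp_all
    finally have e: "P' s = cnj w * \<mu> ^ m * ((hom_part m (partial 2 F) (disc_point ?u) + \<i> * hom_part m (partial 3 F) (disc_point ?u)) / 2)" .
    have "norm (P' s) = norm w / 2 * norm (hom_part m (partial 2 F) (disc_point ?u) + \<i> * hom_part m (partial 3 F) (disc_point ?u))"
      unfolding e using l(1) by (simp add: norm_mult norm_power norm_divide)
    also have "\<dots> \<le> norm w / 2 * M"
      using bd[of "disc_point ?u"] l by (intro mult_left_mono) (auto simp: norm_mult)
    finally show "norm (P' s) \<le> norm w / 2 * M" .
  qed
  have "norm (P 1 - P 0) \<le> norm w / 2 * M * norm (1 - 0 :: complex)"
  proof (rule field_differentiable_bound[OF convex_cball, of 0 1])
    show "(P has_field_derivative P' z) (at z within cball 0 1)" for z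
      by (rule has_field_derivative_at_within[OF dP])
  qed (use bP' in auto)
  moreover have "P 0 = sectoral_coeff n F * w ^ n"
    unfolding P_def by (subst sum.atMost_shift) (simp add: c)
  moreover have "P 1 = hom_part n F (disc_point w)" using c(2)[of "disc_point w"] by (simp add: P_def)
  ultimately show ?thesis by (simp add: n_def del: sectoral_coeff.simps)
qed

section \<open>Components of a monogenic function\<close>

definition component :: "4 \<Rightarrow> (real^3 \<Rightarrow> quat) \<Rightarrow> real^3 \<Rightarrow> complex" where
  "component a f x = of_real (f x $ a)"

lemma component_has_grad:
  assumes "f differentiable (at x)"
  shows "has_grad (component a f) (\<lambda>j. of_real (partial j f x $ a)) x"
proof -
  define D where "D = frechet_derivative f (at x)"
  have D: "(f has_derivative D) (at x)"
    using assms by (simp add: D_def frechet_derivative_works)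
  then have lin: "linear D" by (rule has_derivative_linear)
  have Dh: "complex_of_real (D h $ a) = (\<Sum>j\<in>UNIV. of_real (h$j) * of_real (D (axis j 1) $ a))" for h
  proof -
    have "D h = D (\<Sum>j\<in>UNIV. h$j *s axis j 1)" by (simp add: basis_expansion)
    also have "\<dots> = (\<Sum>j\<in>UNIV. h$j *\<^sub>R D (axis j 1))"
      using lin by (simp add: linear_sum linear_scale scalar_mult_eq_scaleR)
    finally show ?thesis by simp
  qed
  have "((\<lambda>x. complex_of_real (f x $ a)) has_derivative (\<lambda>h. of_real (D h $ a))) (at x)"
    by (rule has_derivative_compose[OF D, of "\<lambda>q. complex_of_real (q $ a)"])
       (rule bounded_linear_imp_has_derivative[OF bounded_linear_compose[OF bounded_linear_of_real bounded_linear_vec_nth]])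
  then have "((\<lambda>x. complex_of_real (f x $ a)) has_derivative (\<lambda>h. \<Sum>j\<in>UNIV. of_real (h$j) * of_real (D (axis j 1) $ a))) (at x)"
    by (rule has_derivative_eq_rhs) (rule ext, rule Dh)
  then show ?thesis
    unfolding has_grad_def component_def partial_def D_def[symmetric] .
qed

lemma vector_4 [simp]:
  "(vector [a, b, c, d] :: real^4) $ 1 = a" "(vector [a, b, c, d] :: real^4) $ 2 = b"
  "(vector [a, b, c, d] :: real^4) $ 3 = c" "(vector [a, b, c, d] :: real^4) $ 4 = d"
  by (simp_all add: vector_def)

lemma axis_4_nth [simp]:
  "qone $ 1 = 1" "qone $ 2 = 0" "qone $ 3 = 0" "qone $ 4 = 0"
  "qe1 $ 1 = 0" "qe1 $ 2 = 1" "qe1 $ 3 = 0" "qe1 $ 4 = 0"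
  "qe2 $ 1 = 0" "qe2 $ 2 = 0" "qe2 $ 3 = 1" "qe2 $ 4 = 0"
  by (simp_all add: qone_def qe1_def qe2_def axis_def)

context
  fixes R :: real and f :: "real^3 \<Rightarrow> quat"
  assumes mono: "monogenic_on_ball R f"
begin

lemma mono_has_grad: "x \<in> ball 0 R \<Longrightarrow> has_grad (component a f) (\<lambda>j. of_real (partial j f x $ a)) x"
  using mono by (intro component_has_grad) (simp add: monogenic_on_ball_def)

lemma mono_continuous: "continuous_on (ball 0 R) (\<lambda>x. complex_of_real (partial j f x $ a))"
  using mono by (auto simp: monogenic_on_ball_def intro!: continuous_intros)

text \<open>The components of \<open>Dop f x = 0\<close> after the partials of the vanishing
  e3-component have dropped out. Directions 1, 2, 3 are x_0, x_1, x_2; components 1, 2, 3 belong to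
  1, e1, e2.\<close>

lemma mono_riesz:
  assumes x: "x \<in> ball 0 R"
  shows "partial 1 f x $ 1 = partial 2 f x $ 2 + partial 3 f x $ 3"
    "partial 1 f x $ 2 = - partial 2 f x $ 1"
    "partial 1 f x $ 3 = - partial 3 f x $ 1"
    "partial 2 f x $ 3 = partial 3 f x $ 2"
proof -
  have p4: "partial j f x $ 4 = 0" for j
  proof -
    have "has_grad (component 4 f) (\<lambda>j. 0) x"
      by (rule has_grad_cong_open[OF has_grad_const[of 0] open_ball x])
         (use mono in \<open>simp add: monogenic_on_ball_def in_A_def component_def\<close>)
    from has_grad_unique[OF mono_has_grad[OF x] this] show ?thesis by simp
  qed
  have "Dop f x = 0" using mono x by (simp add: monogenic_on_ball_def)
  then have "Dop f x $ k = 0" for k by simp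
  from this[of 1] this[of 2] this[of 3] this[of 4] p4[of 1] p4[of 2] p4[of 3]
  show "partial 1 f x $ 1 = partial 2 f x $ 2 + partial 3 f x $ 3"
    "partial 1 f x $ 2 = - partial 2 f x $ 1"
    "partial 1 f x $ 3 = - partial 3 f x $ 1"
    "partial 2 f x $ 3 = partial 3 f x $ 2"
    by (simp_all add: Dop_def qmult_def)
qed

lemma mono_curl:
  assumes sub: "cball x \<bar>t\<bar> \<subseteq> ball 0 R" and t: "t \<noteq> 0"
  shows "bint (\<lambda>y. (of_real (partial m f (x + t *\<^sub>R y) $ a) * of_real (y$j) - of_real (partial j f (x + t *\<^sub>R y) $ a) * of_real (y$m)) * uc y ^ 2) = 0"
proof -
  have mem: "x + t *\<^sub>R y \<in> ball 0 R" if "y \<in> cball 0 1" for y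
  proof -
    have "\<bar>t\<bar> * norm y \<le> \<bar>t\<bar>" using that by (simp add: mult_left_le)
    then have "x + t *\<^sub>R y \<in> cball x \<bar>t\<bar>" by (simp add: dist_norm)
    then show ?thesis using sub by blast
  qed
  have cp: "cb (\<lambda>y. partial j f (x + t *\<^sub>R y))" for j
    by (rule continuous_on_compose2[of "ball 0 R" "partial j f"])
       (use mono mem in \<open>auto simp: monogenic_on_ball_def intro!: continuous_intros\<close>)
  have "bint (\<lambda>y. (of_real t * of_real (partial m f (x + t *\<^sub>R y) $ a) * of_real (y$j) - of_real t * of_real (partial j f (x + t *\<^sub>R y) $ a) * of_real (y$m)) * uc y ^ Suc 1) = 0"
  proof (rule bint_curl)
    show "has_grad (\<lambda>y. component a f (x + t *\<^sub>R y)) (\<lambda>j. of_real t * of_real (partial j f (x + t *\<^sub>R y) $ a)) y" if "y \<in> cball 0 1" for y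
      by (rule has_grad_affine[OF mono_has_grad[OF mem[OF that]]])
    show "cb (\<lambda>y. complex_of_real t * of_real (partial j f (x + t *\<^sub>R y) $ a))" for j
      by (intro continuous_intros cp)
  qed
  also have "(\<lambda>y. (of_real t * of_real (partial m f (x + t *\<^sub>R y) $ a) * of_real (y$j) - of_real t * of_real (partial j f (x + t *\<^sub>R y) $ a) * of_real (y$m)) * uc y ^ Suc 1)
     = (\<lambda>y. of_real t * ((of_real (partial m f (x + t *\<^sub>R y) $ a) * of_real (y$j) - of_real (partial j f (x + t *\<^sub>R y) $ a) * of_real (y$m)) * uc y ^ 2))"
    by (simp add: fun_eq_iff power2_eq_square algebra_simps)
  finally show ?thesis using t by (simp add: bint_cmult)
qed

text \<open>The step from C^1 to smoothness. By the Riesz system the radial derivative of each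
  component is a sum of two tangential expressions of the kind in \<open>mono_curl\<close>: for the
  scalar part, y_1 d_2 f_2 - y_2 d_1 f_2 plus y_1 d_3 f_3 - y_3 d_1 f_3 in code indices. Both have
  weighted mean zero.\<close>

lemma mono_MV: assumes a: "a \<noteq> 4" shows "mean_value_on (ball 0 R) (component a f)"
proof (rule mean_value_onI[OF open_ball mono_has_grad mono_continuous])
  fix x :: "real^3" and t :: real
  assume sub: "cball x \<bar>t\<bar> \<subseteq> ball 0 R" and t: "t \<noteq> 0"
  define C where "C b m j y = (complex_of_real (partial m f (x + t *\<^sub>R y) $ b) * of_real (y$j) - of_real (partial j f (x + t *\<^sub>R y) $ b) * of_real (y$m)) * uc y ^ 2" for b m j y
  have C0: "bint (C b m j) = 0" for b m j
    unfolding C_def[abs_def] by (rule mono_curl[OF sub t])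
  have mem: "x + t *\<^sub>R y \<in> ball 0 R" if "y \<in> cball 0 1" for y
  proof -
    have "\<bar>t\<bar> * norm y \<le> \<bar>t\<bar>" using that by (simp add: mult_left_le)
    then have "x + t *\<^sub>R y \<in> cball x \<bar>t\<bar>" by (simp add: dist_norm)
    then show ?thesis using sub by blast
  qed
  have cp: "cb (\<lambda>y. partial j f (x + t *\<^sub>R y))" for j
    by (rule continuous_on_compose2[of "ball 0 R" "partial j f"])
       (use mono mem in \<open>auto simp: monogenic_on_ball_def intro!: continuous_intros\<close>)
  have cC: "cb (C b m j)" for b m j
    unfolding C_def[abs_def]
    by (intro continuous_intros cp)
  have sum0: "bint (\<lambda>y. C b m j y + C b' m' j' y) = 0" for b m j b' m' j'
    by (simp add: bint_add cC C0)
  let ?g = "\<lambda>y. (\<Sum>j\<in>UNIV. of_real (y$j) * complex_of_real (partial j f (x + t *\<^sub>R y) $ a)) * uc y ^ 2"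
  have "a = 1 \<or> a = 2 \<or> a = 3" using a exhaust_4[of a] by blast
  then show "bint ?g = 0"
  proof (elim disjE)
    assume "a = 1"
    then have "bint ?g = bint (\<lambda>y. C 2 2 1 y + C 3 3 1 y)"
      by (intro bint_cong) (use mem mono_riesz in \<open>simp add: C_def sum_3 algebra_simps\<close>)
    then show ?thesis by (simp only: sum0)
  next
    assume "a = 2"
    then have "bint ?g = bint (\<lambda>y. C 1 1 2 y + C 3 2 3 y)"
      by (intro bint_cong) (use mem mono_riesz in \<open>simp add: C_def sum_3 algebra_simps\<close>)
    then show ?thesis by (simp only: sum0)
  next
    assume "a = 3"
    then have "bint ?g = bint (\<lambda>y. C 1 1 3 y + C 2 3 2 y)"
      by (intro bint_cong) (use mem mono_riesz in \<open>simp add: C_def sum_3 algebra_simps\<close>)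
    then show ?thesis by (simp only: sum0)
  qed
qed

lemma partial_comp: "x \<in> ball 0 R \<Longrightarrow> partial j (component a f) x = of_real (partial j f x $ a)"
  by (rule has_grad_partial[OF mono_has_grad])

text \<open>Now that second partials exist and commute, differentiating the Riesz system once gives
  the Laplace equation.\<close>

lemma mono_harm: assumes a: "a \<noteq> 4" shows "harmonic_on (ball 0 R) (component a f)"
  unfolding harmonic_on_def
proof (intro conjI ballI)
  show "mean_value_on (ball 0 R) (component a f)" by (rule mono_MV[OF a])
  fix x :: "real^3" assume x: "x \<in> ball 0 R"
  have M: "mean_value_on (ball 0 R) (partial j (component b f))" if "b \<noteq> 4" for b j by (intro mean_value_on_partial mono_MV that)
  have com: "partial i (partial j (component b f)) x = partial j (partial i (component b f)) x" if "b \<noteq> 4" for b i j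
    by (rule partial_commute[OF mono_MV[OF that] x])
  have lin: "partial i (partial j (component b f)) x = p * partial i (partial k (component c f)) x + q * partial i (partial l (component d f)) x"
    if "\<And>y. y \<in> ball 0 R \<Longrightarrow> partial j (component b f) y = p * partial k (component c f) y + q * partial l (component d f) y" "c \<noteq> 4" "d \<noteq> 4"
    for i j b p k c q l d
  proof -
    have "partial i (partial j (component b f)) x = partial i (\<lambda>y. p * partial k (component c f) y + q * partial l (component d f) y) x"
      by (rule partial_cong_open[OF open_ball x that(1)])
    also have "\<dots> = p * partial i (partial k (component c f)) x + q * partial i (partial l (component d f)) x"
      by (rule partial_lin[OF M M x]) fact+
    finally show ?thesis .
  qed
  have r11: "partial i (partial 1 (component 1 f)) x = 1 * partial i (partial 2 (component 2 f)) x + 1 * partial i (partial 3 (component 3 f)) x" for i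
    by (rule lin) (simp_all add: partial_comp mono_riesz)
  have r22: "partial i (partial 2 (component 2 f)) x = 1 * partial i (partial 1 (component 1 f)) x + (-1) * partial i (partial 3 (component 3 f)) x" for i
    by (rule lin) (simp_all add: partial_comp mono_riesz)
  have r33: "partial i (partial 3 (component 3 f)) x = 1 * partial i (partial 1 (component 1 f)) x + (-1) * partial i (partial 2 (component 2 f)) x" for i
    by (rule lin) (simp_all add: partial_comp mono_riesz)
  \<comment> \<open>One-term relations carry a dummy second summand with factor 0, to fit the
    two-term shape of \<open>lin\<close>.\<close>
  have r12: "partial i (partial 1 (component 2 f)) x = (-1) * partial i (partial 2 (component 1 f)) x + 0 * partial i (partial 2 (component 1 f)) x" for i
    by (rule lin) (simp_all add: partial_comp mono_riesz)
  have r13: "partial i (partial 1 (component 3 f)) x = (-1) * partial i (partial 3 (component 1 f)) x + 0 * partial i (partial 2 (component 1 f)) x" for i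
    by (rule lin) (simp_all add: partial_comp mono_riesz)
  have r23: "partial i (partial 2 (component 3 f)) x = 1 * partial i (partial 3 (component 2 f)) x + 0 * partial i (partial 2 (component 1 f)) x" for i
    by (rule lin) (simp_all add: partial_comp mono_riesz)
  have "a = 1 \<or> a = 2 \<or> a = 3" using a exhaust_4[of a] by blast
  then show "(\<Sum>j\<in>UNIV. partial j (partial j (component a f)) x) = 0"
  proof (elim disjE)
    assume "a = 1"
    then show ?thesis
      using r11[of 1] r12[of 2] r13[of 3] com[of 2 1 2] com[of 3 1 3] by (simp add: sum_3)
  next
    assume "a = 2"
    then show ?thesis
      using r12[of 1] r22[of 2] r23[of 3] com[of 1 1 2] com[of 3 2 3] by (simp add: sum_3)
  next
    assume "a = 3"
    then show ?thesis
      using r13[of 1] r23[of 2] r33[of 3] com[of 1 1 3] com[of 2 2 3] by (simp add: sum_3)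
  qed
qed

text \<open>The sign in F is chosen so that d_1 + i d_2 applied to F has the divergence equation as
  its real part and the vanishing of the curl in x_1, x_2 as its imaginary part. The two relations
  express all of F except its holomorphic part through the scalar component.\<close>

lemma mono_dbar:
  fixes F defines "F \<equiv> \<lambda>x. 1 * component 2 f x + (- \<i>) * component 3 f x"
  shows "harmonic_on (ball 0 R) F"
    and "x \<in> ball 0 R \<Longrightarrow> partial 2 F x + \<i> * partial 3 F x = partial 1 (component 1 f) x"
    and "x \<in> ball 0 R \<Longrightarrow> partial 1 F x = - partial 2 (component 1 f) x + \<i> * partial 3 (component 1 f) x"
proof -
  show "harmonic_on (ball 0 R) F" unfolding F_def by (intro harmonic_on_lin mono_harm) simp_all
  assume x: "x \<in> ball 0 R"
  have p: "partial j F x = 1 * partial j (component 2 f) x + (- \<i>) * partial j (component 3 f) x" for j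
    unfolding F_def by (rule partial_lin[OF mono_MV mono_MV x]) simp_all
  show "partial 2 F x + \<i> * partial 3 F x = partial 1 (component 1 f) x"
    unfolding p by (simp add: partial_comp[OF x] mono_riesz[OF x] algebra_simps)
  show "partial 1 F x = - partial 2 (component 1 f) x + \<i> * partial 3 (component 1 f) x"
    unfolding p by (simp add: partial_comp[OF x] mono_riesz[OF x] algebra_simps)
qed

end

section \<open>Estimate of the non-sectoral part\<close>

text \<open>Cauchy product with the geometric series: passing to partial sums of the coefficients
  divides the sum by 1 - q. Iteration yields the binomial series used next.\<close>

lemma sums_partial_sums:
  fixes a :: "nat \<Rightarrow> real"
  assumes a: "\<And>n. a n \<ge> 0" and q: "0 \<le> q" "q < 1" and A: "(\<lambda>n. a n * q ^ n) sums A"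
  shows "(\<lambda>n. (\<Sum>i\<le>n. a i) * q ^ n) sums (A / (1 - q))"
proof -
  have "(\<lambda>k. \<Sum>i\<le>k. (a i * q ^ i) * q ^ (k - i)) sums ((\<Sum>k. a k * q ^ k) * (\<Sum>k. q ^ k))"
    using a q A by (intro Cauchy_product_sums) (auto simp: sums_iff abs_mult intro: summable_geometric)
  moreover have "(\<Sum>i\<le>k. (a i * q ^ i) * q ^ (k - i)) = (\<Sum>i\<le>k. a i) * q ^ k" for k
    by (auto simp: sum_distrib_right mult.assoc simp flip: power_add intro!: sum.cong)
  moreover have "(\<Sum>k. a k * q ^ k) * (\<Sum>k. q ^ k) = A / (1 - q)"
    using A q by (simp add: sums_iff suminf_geometric)
  ultimately show ?thesis by simp
qed

lemma cubic_geometric_sums: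
  fixes q :: real
  assumes q: "0 \<le> q" "q < 1"
  shows "(\<lambda>n. (real n + 2) * (real n + 3) * (2 * real n + 3) * q ^ Suc n) sums (2 * q * (3 - q) * (3 - q + q\<^sup>2) / (1 - q)^4)"
proof -
  have s1: "(\<Sum>i\<le>n. (1::real)) = real n + 1" for n by simp
  have s2: "(\<Sum>i\<le>n. real i + 1) = (real n + 1) * (real n + 2) / 2" for n
    by (induction n) (auto simp: field_simps)
  have s3: "(\<Sum>i\<le>n. (real i + 1) * (real i + 2) / 2) = (real n + 1) * (real n + 2) * (real n + 3) / 6" for n
    by (induction n) (auto simp: field_simps)
  have 1: "(\<lambda>n. 1 * q ^ n) sums (1 / (1 - q))" using q by (simp add: geometric_sums)
  have 2: "(\<lambda>n. (real n + 1) * q ^ n) sums (1 / (1 - q) / (1 - q))"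
    using sums_partial_sums[OF _ q 1] unfolding s1 by simp
  have 3: "(\<lambda>n. (real n + 1) * (real n + 2) / 2 * q ^ n) sums (1 / (1 - q) / (1 - q) / (1 - q))"
    using sums_partial_sums[OF _ q 2] unfolding s2 by simp
  have 4: "(\<lambda>n. (real n + 1) * (real n + 2) * (real n + 3) / 6 * q ^ n) sums (1 / (1 - q) / (1 - q) / (1 - q) / (1 - q))"
    using sums_partial_sums[OF _ q 3] unfolding s3 by simp
  \<comment> \<open>The cubic (n+1)(n+2)(2n+1) is 12 binom(n+3, 3) - 10 binom(n+2, 2).\<close>
  have "(\<lambda>n. 12 * ((real n + 1) * (real n + 2) * (real n + 3) / 6 * q ^ n) - 10 * ((real n + 1) * (real n + 2) / 2 * q ^ n))
     sums (12 * (1 / (1 - q) / (1 - q) / (1 - q) / (1 - q)) - 10 * (1 / (1 - q) / (1 - q) / (1 - q)))"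
    by (intro sums_diff sums_mult 3 4)
  moreover have "12 * ((real n + 1) * (real n + 2) * (real n + 3) / 6 * q ^ n) - 10 * ((real n + 1) * (real n + 2) / 2 * q ^ n)
     = (real n + 1) * (real n + 2) * (2 * real n + 1) * q ^ n" for n
    by (simp add: algebra_simps)
  ultimately have "(\<lambda>n. (real n + 1) * (real n + 2) * (2 * real n + 1) * q ^ n)
     sums (12 * (1 / (1 - q) / (1 - q) / (1 - q) / (1 - q)) - 10 * (1 / (1 - q) / (1 - q) / (1 - q)))" by simp
  \<comment> \<open>The series for g starts in degree 1; the discarded term of degree 0 is
    2.\<close>
  then have "(\<lambda>n. (real (Suc n) + 1) * (real (Suc n) + 2) * (2 * real (Suc n) + 1) * q ^ Suc n)
     sums (12 * (1 / (1 - q) / (1 - q) / (1 - q) / (1 - q)) - 10 * (1 / (1 - q) / (1 - q) / (1 - q)) - 2)"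
    by (subst sums_Suc_iff) simp
  moreover have "12 * (1 / (1 - q) / (1 - q) / (1 - q) / (1 - q)) - 10 * (1 / (1 - q) / (1 - q) / (1 - q)) - 2
     = 2 * q * (3 - q) * (3 - q + q\<^sup>2) / (1 - q)^4"
  proof -
    define p where "p = 1 - q"
    have p: "p \<noteq> 0" "q = 1 - p" using q by (auto simp: p_def)
    have "12 * (1 / p / p / p / p) - 10 * (1 / p / p / p) - 2 = (12 - 10 * p - 2 * p^4) / p^4"
      using p(1) by (simp add: divide_simps power4_eq_xxxx)
    also have "12 - 10 * p - 2 * p^4 = 2 * (1 - p) * (3 - (1 - p)) * (3 - (1 - p) + (1 - p)\<^sup>2)"
      by (simp add: power4_eq_xxxx power2_eq_square algebra_simps)
    finally show ?thesis unfolding p(2) by simp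
  qed
  ultimately show ?thesis by (simp add: algebra_simps)
qed

text \<open>What \<open>hom_part_partial_bound\<close> yields at |x| = n / (n+2) with d = 3 / (2
  (n+2)), carried to the unit sphere by homogeneity of degree n - 1, which accounts for the power of
  (n+2) / n.\<close>

definition grad_const :: "nat \<Rightarrow> real" where
  "grad_const n = sqrt (64 * real n * (real n + 2)^5 / (27 * (4 * real n + 7)) * (((real n + 2) / real n) ^ (n - 1))\<^sup>2)"

section \<open>Numerical comparison of the constants\<close>

lemma sqrt_23: "sqrt (2/3) \<ge> 0.8164"
  by (rule real_le_rsqrt) (simp add: power2_eq_square)

text \<open>The summand 8.35 is the reserve spent in \<open>riesz_pair_estimate\<close>.
  \<open>grad_const\<close> grows like n^(5/2) against a cubic, so only small degrees are delicate:
  n = 1 is computed directly, and for n >= 2 the estimate (1 + 2/n)^n <= e^2 is sharp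
  enough.\<close>

lemma grad_const_bound:
  assumes "n \<ge> 1"
  shows "8.35 + grad_const n / 2 \<le> sqrt (2/3) * ((real n + 1) * (real n + 2) * (2 * real n + 1))"
proof (cases "n = 1")
  case True
  have "grad_const n \<le> 7.25" unfolding grad_const_def True by (rule real_le_lsqrt) (simp_all add: power2_eq_square)
  then show ?thesis using sqrt_23 True by simp
next
  case False
  define x where "x = real n"
  have x: "x \<ge> 2" using assms False by (simp add: x_def)
  have e2: "exp 2 \<le> (7.3984::real)"
  proof -
    have "exp 2 = exp 1 * (exp 1 :: real)" by (simp flip: exp_add)
    also have "\<dots> \<le> (272/100) * (272/100)" using e_less_272 by (intro mult_mono) auto
    finally show ?thesis by simp
  qed
  have "((x + 2) / x) ^ n \<le> exp (2 / x) ^ n"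
    using x exp_ge_add_one_self[of "2 / x"] by (intro power_mono) (auto simp: field_simps)
  also have "exp (2 / x) ^ n = exp 2"
    using x by (simp add: x_def flip: exp_of_nat_mult)
  also note e2
  finally have "((x + 2) / x) ^ n \<le> 7.3984" .
  moreover have "((x + 2) / x) ^ n = ((x + 2) / x) ^ (n - 1) * ((x + 2) / x)"
    using assms by (cases n) auto
  ultimately have "((x + 2) / x) ^ (n - 1) * ((x + 2) / x) \<le> 7.3984" by simp
  then have p: "((x + 2) / x) ^ (n - 1) \<le> 7.3984 * x / (x + 2)"
    using x by (simp add: field_simps)
  have "(((x + 2) / x) ^ (n - 1))\<^sup>2 \<le> (7.3984 * x / (x + 2))\<^sup>2"
    using x by (intro power_mono p) auto
  then have "64 * x * (x + 2)^5 / (27 * (4 * x + 7)) * (((x + 2) / x) ^ (n - 1))\<^sup>2 \<le> 64 * x * (x + 2)^5 / (27 * (4 * x + 7)) * (7.3984 * x / (x + 2))\<^sup>2"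
    by (rule mult_left_mono) (use x in simp)
  moreover have "(grad_const n)\<^sup>2 = 64 * x * (x + 2)^5 / (27 * (4 * x + 7)) * (((x + 2) / x) ^ (n - 1))\<^sup>2"
    unfolding grad_const_def x_def[symmetric] by (rule real_sqrt_pow2) (use x in simp)
  ultimately have "(grad_const n)\<^sup>2 \<le> 64 * x * (x + 2)^5 / (27 * (4 * x + 7)) * (7.3984 * x / (x + 2))\<^sup>2" by simp
  also have "\<dots> = (64 * 7.3984\<^sup>2 / 27) * (x^3 * (x + 2)^3) / (4 * x + 7)"
  proof -
    have gen: "64 * x * s^5 / (27 * t) * (k * x / s)\<^sup>2 = (64 * k\<^sup>2 / 27) * (x^3 * s^3) / t" if "s \<noteq> 0" "t \<noteq> 0" for s t k :: real
      using that by (simp add: field_simps power2_eq_square power3_eq_cube numeral_eq_Suc)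
    show ?thesis by (rule gen) (use x in auto)
  qed
  also have "\<dots> \<le> 129.8 * (x^3 * (x + 2)^3) / (4 * x + 7)"
    using x by (intro divide_right_mono mult_right_mono) (auto simp: power2_eq_square)
  \<comment> \<open>The quadratic factor is chosen so that its product with x + 2 lies just below
    twice (0.8164 times the cubic minus 8.35); the comparison of squares here removes the root from
    \<open>grad_const\<close>.\<close>
  also have "\<dots> \<le> ((x + 2) * ((26 * x\<^sup>2 + 39 * x - 20) / 8))\<^sup>2"
  proof -
    define m where "m = x - 2"
    have m: "m \<ge> 0" "x = m + 2" using x by (auto simp: m_def)
    \<comment> \<open>Shifting by x = m + 2 makes every coefficient positive, which settles the sign
      for x >= 2. The number 8308 rounds up 64 * 129.8, where 64 is the squared denominator
      8.\<close>
    have "(4 * x + 7) * (26 * x\<^sup>2 + 39 * x - 20)\<^sup>2 - 8308 * (x^3 * (x + 2)) = 127804 + 334708 * m^1 + 319335 * m^2 + 143952 * m^3 + 31576 * m^4 + 2704 * m^5"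
      unfolding m(2) by (simp add: numeral_eq_Suc algebra_simps)
    also have "\<dots> \<ge> 0" using m(1) by (intro add_nonneg_nonneg mult_nonneg_nonneg zero_le_power) auto
    finally have "8308 * (x^3 * (x + 2)) \<le> (4 * x + 7) * (26 * x\<^sup>2 + 39 * x - 20)\<^sup>2" by simp
    moreover have "0 \<le> x^3 * (x + 2)" using x by simp
    ultimately have "129.8 * (x^3 * (x + 2)) \<le> (4 * x + 7) * ((26 * x\<^sup>2 + 39 * x - 20) / 8)\<^sup>2"
      by (simp add: power_divide)
    then have "(x + 2)\<^sup>2 * (129.8 * (x^3 * (x + 2))) \<le> (x + 2)\<^sup>2 * ((4 * x + 7) * ((26 * x\<^sup>2 + 39 * x - 20) / 8)\<^sup>2)"
      by (rule mult_left_mono) simp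
    moreover have "s\<^sup>2 * (129.8 * (x^3 * s)) = 129.8 * (x^3 * s^3)" "s\<^sup>2 * (t * u\<^sup>2) = (s * u)\<^sup>2 * t" for s t u :: real
      by (simp_all add: power2_eq_square power3_eq_cube)
    ultimately have "129.8 * (x^3 * (x + 2)^3) \<le> ((x + 2) * ((26 * x\<^sup>2 + 39 * x - 20) / 8))\<^sup>2 * (4 * x + 7)"
      by (simp only:)
    then show ?thesis using x by (subst pos_divide_le_eq) auto
  qed
  finally have "grad_const n \<le> (x + 2) * ((26 * x\<^sup>2 + 39 * x - 20) / 8)"
  proof (rule power2_le_imp_le)
    have "x\<^sup>2 \<ge> 0" by simp
    then have "0 \<le> 26 * x\<^sup>2 + 39 * x - 20" using x by linarith
    then show "0 \<le> (x + 2) * ((26 * x\<^sup>2 + 39 * x - 20) / 8)" using x by simp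
  qed
  also have "\<dots> \<le> 2 * (0.8164 * ((x + 1) * (x + 2) * (2 * x + 1)) - 8.35)"
  proof -
    define m where "m = x - 2"
    have m: "m \<ge> 0" "x = m + 2" using x by (auto simp: m_def)
    have "2 * (0.8164 * ((x + 1) * (x + 2) * (2 * x + 1)) - 8.35) - (x + 2) * ((26 * x\<^sup>2 + 39 * x - 20) / 8)
      = 0.268 + 4.5852 * m + 0.1482 * m^2 + 0.0156 * m^3"
      unfolding m(2) by (simp add: power2_eq_square power3_eq_cube field_simps)
    also have "\<dots> \<ge> 0" using m(1) by (intro add_nonneg_nonneg mult_nonneg_nonneg zero_le_power) auto
    finally show ?thesis by simp
  qed
  finally have "8.35 + grad_const n / 2 \<le> 0.8164 * ((x + 1) * (x + 2) * (2 * x + 1))" by simp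
  also have "\<dots> \<le> sqrt (2/3) * ((x + 1) * (x + 2) * (2 * x + 1))"
    using x by (intro mult_right_mono sqrt_23) auto
  finally show ?thesis by (simp add: x_def)
qed

text \<open>The bound is taken at an interior point on the ray through \<open>y\<close>, since it
  degenerates at the unit sphere, and then rescaled. A gap of order 1/n to the sphere keeps the
  rescaling factor bounded in n.\<close>

lemma hom_part_partial_grad_const:
  assumes h: "harmonic_on (ball 0 R) v" and bd: "\<And>x. x \<in> ball 0 R \<Longrightarrow> norm (v x) \<le> S" and R: "R > 0"
  shows "norm (hom_part m (partial j v) y) \<le> grad_const (Suc m) * norm y ^ m * S / R ^ Suc m"
proof -
  define n where "n = Suc m"
  define a where "a = real n / (real n + 2)"
  \<comment> \<open>Three quarters of the gap \<open>1 - a\<close>, the choice maximizing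
    \<open>d^3 (1 - a - d)\<close>.\<close>
  define d where "d = 3 / (2 * (real n + 2))"
  define C where "C = 64 * real n * (real n + 2)^5 / (27 * (4 * real n + 7))"
  have C: "C \<ge> 0" by (simp add: C_def)
  have n1: "real n \<ge> 1" by (simp add: n_def)
  have a: "a > 0" using n1 by (simp add: a_def)
  have d: "d > 0" using n1 by (simp add: d_def add_pos_pos)
  have S0: "S \<ge> 0" using order_trans[OF norm_ge_zero bd[of 0]] R by simp
  obtain e :: "real^3" where e: "norm e = 1" "y = norm y *\<^sub>R e"
  proof (cases "y = 0")
    case True then show ?thesis using that[of "axis 1 1"] by (simp add: norm_axis_1)
  next
    case False then show ?thesis using that[of "y /\<^sub>R norm y"] by simp
  qed
  define x where "x = a *\<^sub>R e"
  have nx: "norm x = a" using e a by (simp add: x_def)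
  have ad: "a + d = (2 * real n + 3) / (2 * (real n + 2))" 
  proof -
    have "a = (2 * real n) / (2 * (real n + 2))"
      unfolding a_def by (rule mult_divide_mult_cancel_left[symmetric]) simp
    then show ?thesis by (simp only: d_def add_divide_distrib)
  qed
  have ad1: "norm x + d < 1" unfolding nx ad using n1 by (simp add: field_simps)
  have eq1: "d^3 * (1 - (a + d)\<^sup>2) = 27 * (4 * real n + 7) / (32 * (real n + 2)^5)"
  proof -
    have nz: "real n + 2 \<noteq> 0" using n1 by simp
    have "1 - (a + d)\<^sup>2 = (4 * real n + 7) / (4 * (real n + 2)\<^sup>2)"
      unfolding ad using nz by (simp add: power_divide divide_simps power_mult_distrib) (simp add: power2_eq_square algebra_simps)
    moreover have "(3 / (2 * s))^3 * (t / (4 * s\<^sup>2)) = 27 * t / (32 * s^5)" if "s \<noteq> 0" for s t :: real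
      using that by (simp add: field_simps power2_eq_square power3_eq_cube numeral_eq_Suc)
    ultimately show ?thesis unfolding d_def using nz by (simp only:)
  qed
  have "d^3 * (1 - (a + d)\<^sup>2) * (norm (hom_part m (partial j v) x))\<^sup>2 \<le> 2 * real n * (S / R ^ n)\<^sup>2"
    using hom_part_partial_bound[OF h bd R d ad1, of m j] unfolding nx n_def .
  then have "(norm (hom_part m (partial j v) x))\<^sup>2 \<le> 2 * real n * (S / R ^ n)\<^sup>2 / (27 * (4 * real n + 7) / (32 * (real n + 2)^5))"
    unfolding eq1 using n1 by (subst pos_le_divide_eq) (auto simp: mult.commute)
  also have "\<dots> = C * (S / R ^ n)\<^sup>2"
    using n1 by (simp add: C_def divide_simps)
  also have "\<dots> = (sqrt C * (S / R ^ n))\<^sup>2"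
    using C by (simp only: power_mult_distrib real_sqrt_pow2)
  finally have Tx: "norm (hom_part m (partial j v) x) \<le> sqrt C * (S / R ^ n)"
    by (rule power2_le_imp_le) (use S0 R C in simp)
  have "y = (norm y / a) *\<^sub>R x" using e a by (simp add: x_def)
  then have "norm (hom_part m (partial j v) y) = norm (hom_part m (partial j v) ((norm y / a) *\<^sub>R x))" by simp
  also have "\<dots> = (norm y / a) ^ m * norm (hom_part m (partial j v) x)"
    using a by (simp add: hom_part_homogeneous norm_mult norm_power norm_divide)
  also have "\<dots> \<le> (norm y / a) ^ m * (sqrt C * (S / R ^ n))"
    using a by (intro mult_left_mono Tx) auto
  also have "\<dots> = grad_const n * norm y ^ m * S / R ^ n"
  proof -
    have nm: "n - 1 = m" by (simp add: n_def)
    have "0 \<le> ((real n + 2) / real n) ^ m" by simp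
    then have K: "grad_const n = sqrt C * ((real n + 2) / real n) ^ m"
      unfolding grad_const_def real_sqrt_mult nm C_def by (simp only: real_sqrt_abs abs_of_nonneg)
    have "(norm y / a) ^ m = norm y ^ m * ((real n + 2) / real n) ^ m"
      by (simp add: a_def flip: power_mult_distrib)
    then show ?thesis unfolding K by (simp only: mult_ac times_divide_eq_right times_divide_eq_left)
  qed
  finally show ?thesis by (simp add: n_def)
qed

lemma sectoral_coeff_summable:
  assumes h: "harmonic_on (ball 0 R) F" and w: "norm w < R"
  shows "summable (\<lambda>n. norm (sectoral_coeff n F * w ^ n))"
proof -
  define \<rho> where "\<rho> = (norm w + R) / 2"
  have R: "R > 0" using w norm_ge_zero[of w] by linarith
  have \<rho>: "0 < \<rho>" "\<rho> < R" "norm w \<le> \<rho>" using w R by (auto simp: \<rho>_def add_nonneg_pos)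
  obtain C q where q: "0 \<le> q" "q < 1" and b: "\<And>n x. norm x \<le> \<rho> \<Longrightarrow> norm (hom_part n F x) \<le> C * q ^ n"
    by (rule hom_part_geometric[OF h \<rho>(1,2)]) (rule that)
  have bound: "norm (sectoral_coeff n F * w ^ n) \<le> C * q ^ n" for n
  proof (rule sectoral_coeff_bound)
    fix y :: "real^3" assume y: "y$1 = 0" "norm (zc y) = norm w"
    have "norm y = norm w" using y disc_point_zc[of y] norm_disc[of "zc y"] by simp
    then show "norm (hom_part n F y) \<le> C * q ^ n" using b \<rho> by simp
  qed
  have "summable (\<lambda>n. C * q ^ n)" using q by (intro summable_mult summable_geometric) simp
  then show ?thesis by (rule summable_comparison_test') (use bound in simp)
qed

text \<open>The sum starts in degree 1: the constant term belongs to f(0), as in the definition of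
  h.\<close>

definition sectoral_sum :: "(real^3 \<Rightarrow> complex) \<Rightarrow> complex \<Rightarrow> complex" where
  "sectoral_sum F w = (\<Sum>n. sectoral_coeff (Suc n) F * w ^ Suc n)"

lemma sectoral_sum_sums:
  assumes "harmonic_on (ball 0 R) F" "norm w < R"
  shows "(\<lambda>n. sectoral_coeff (Suc n) F * w ^ Suc n) sums sectoral_sum F w"
  unfolding sectoral_sum_def
  by (rule summable_sums, rule summable_norm_cancel)
     (use sectoral_coeff_summable[OF assms] in \<open>simp only: summable_Suc_iff[where f="\<lambda>n. norm (sectoral_coeff n F * w ^ n)"]\<close>)

text \<open>sqrt 15 = sqrt 5 * sqrt 3: each partial is bounded by \<open>gradient_estimate\<close>
  on balls of radius R - r, and |h_1| + |h_2| + |h_3| <= sqrt 3 |h|.\<close>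

lemma gradient_lipschitz:
  assumes h: "harmonic_on (ball 0 R) V" and bd: "\<And>x. x \<in> ball 0 R \<Longrightarrow> norm (V x) \<le> S"
    and x: "norm x \<le> r" and r: "r < R"
  shows "norm (V x - V 0) \<le> sqrt 15 * S / (R - r) * norm x"
proof -
  have MV: "mean_value_on (ball 0 R) V" by (rule harmonic_on_mean_value[OF h])
  define M where "M = sqrt 5 * S / (R - r)"
  have gr: "norm (partial j V p) \<le> M" if "p \<in> cball 0 r" for p j
  proof -
    have sub: "ball p (R - r) \<subseteq> ball 0 R" using that by (subst ball_subset_ball_iff) auto
    show ?thesis unfolding M_def by (rule gradient_estimate[OF h sub]) (use r sub bd in auto)
  qed
  have r0: "r \<ge> 0" using x norm_ge_zero[of x] by linarith
  have M0: "M \<ge> 0" using gr[of 0] r0 by (meson centre_in_cball norm_ge_zero order_trans)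
  have "norm (V x - V 0) \<le> (sqrt 3 * M) * norm (x - 0)"
  proof (rule differentiable_bound[OF convex_cball[of 0 r]])
    show "(V has_derivative (\<lambda>h. \<Sum>j\<in>UNIV. of_real (h$j) * partial j V p)) (at p within cball 0 r)" if "p \<in> cball 0 r" for p
      by (rule has_derivative_at_withinI[OF has_gradD[OF mean_value_on_has_grad[OF MV]]]) (use that r in auto)
    show "onorm (\<lambda>h. \<Sum>j\<in>UNIV. of_real (h$j) * partial j V p) \<le> sqrt 3 * M" if p: "p \<in> cball 0 r" for p
    proof (rule onorm_le)
      fix h :: "real^3"
      have "norm (\<Sum>j\<in>UNIV. of_real (h$j) * partial j V p) \<le> (\<Sum>j\<in>UNIV. \<bar>h$j\<bar> * M)"
        by (rule sum_norm_le) (use gr[OF p] in \<open>auto simp: norm_mult intro: mult_left_mono\<close>)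
      also have "\<dots> = (\<bar>h$1\<bar> + \<bar>h$2\<bar> + \<bar>h$3\<bar>) * M" by (simp add: sum_3 algebra_simps)
      also have "\<dots> \<le> (sqrt 3 * norm h) * M"
      proof (rule mult_right_mono[OF _ M0])
        have n: "(norm h)\<^sup>2 = (h$1)\<^sup>2 + (h$2)\<^sup>2 + (h$3)\<^sup>2"
          unfolding power2_norm_eq_inner by (simp add: inner_vec_def sum_3 power2_eq_square)
        have "(\<bar>h$1\<bar> + \<bar>h$2\<bar> + \<bar>h$3\<bar>)\<^sup>2 + (\<bar>h$1\<bar> - \<bar>h$2\<bar>)\<^sup>2 + (\<bar>h$2\<bar> - \<bar>h$3\<bar>)\<^sup>2 + (\<bar>h$1\<bar> - \<bar>h$3\<bar>)\<^sup>2
            = 3 * (\<bar>h$1\<bar>\<^sup>2 + \<bar>h$2\<bar>\<^sup>2 + \<bar>h$3\<bar>\<^sup>2)"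
          by (simp only: power2_eq_square) (simp only: algebra_simps)
        then have "(\<bar>h$1\<bar> + \<bar>h$2\<bar> + \<bar>h$3\<bar>)\<^sup>2 \<le> 3 * (norm h)\<^sup>2"
          unfolding n power2_abs by (smt (verit) zero_le_power2)
        also have "\<dots> = (sqrt 3 * norm h)\<^sup>2" by (simp add: power_mult_distrib)
        finally show "\<bar>h$1\<bar> + \<bar>h$2\<bar> + \<bar>h$3\<bar> \<le> sqrt 3 * norm h"
          by (rule power2_le_imp_le) simp
      qed
      finally show "norm (\<Sum>j\<in>UNIV. of_real (h$j) * partial j V p) \<le> sqrt 3 * M * norm h" by (simp add: mult_ac)
    qed
  qed (use x r0 in auto)
  moreover have "sqrt 3 * M = sqrt 15 * S / (R - r)"
    by (simp add: M_def flip: real_sqrt_mult)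
  ultimately show ?thesis by simp
qed

text \<open>The part of $F$ orthogonal to the powers of $z = x_1 + i x_2$ is controlled by $V$: on the disc
  $x_0 = 0$ degree by degree, and off the disc by integrating in $x_0$.\<close>

lemma riesz_pair_estimate:
  assumes V: "harmonic_on (ball 0 R) V" and F: "harmonic_on (ball 0 R) F"
    and dbar: "\<And>x. x \<in> ball 0 R \<Longrightarrow> partial 2 F x + \<i> * partial 3 F x = partial 1 V x"
    and d1: "\<And>x. x \<in> ball 0 R \<Longrightarrow> partial 1 F x = - partial 2 V x + \<i> * partial 3 V x"
    and bd: "\<And>x. x \<in> ball 0 R \<Longrightarrow> norm (V x) \<le> S" and x: "norm x \<le> r" and r: "r < R"
  shows "norm (V x - V 0) + norm (F x - F 0 - sectoral_sum F (zc x))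
    \<le> S * (sqrt (2/3) * (2 * (r/R) * (3 - r/R) * (3 - r/R + (r/R)\<^sup>2) / (1 - r/R)^4))"
proof -
  have r0: "r \<ge> 0" using x norm_ge_zero[of x] by linarith
  have R: "R > 0" using r r0 by simp
  have S0: "S \<ge> 0" using order_trans[OF norm_ge_zero bd[of 0]] R by simp
  have MVF: "mean_value_on (ball 0 R) F" and MVV: "mean_value_on (ball 0 R) V" by (auto intro: harmonic_on_mean_value V F)
  define q where "q = r / R"
  have q: "0 \<le> q" "q < 1" using r r0 R by (auto simp: q_def)
  define w where "w = zc x"
  have nw: "norm w \<le> norm x" unfolding w_def by (rule norm_zc_le)
  \<comment> \<open>From the allowance for degree n + 1 the amount 8.35 q^(n+1) is withheld;
    altogether this leaves 8.35 q / (1 - q) for the two estimates that are not made degree by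
    degree.\<close>
  define u where "u n = S * (sqrt (2/3) * ((real n + 2) * (real n + 3) * (2 * real n + 3) * q ^ Suc n) - 8.35 * q ^ Suc n)" for n
  have su: "u sums (S * (sqrt (2/3) * (2 * q * (3 - q) * (3 - q + q\<^sup>2) / (1 - q)^4) - 8.35 * (q * (1 / (1 - q)))))"
    unfolding u_def
    by (intro sums_mult sums_diff cubic_geometric_sums q)
       (use sums_mult[OF geometric_sums[of q], of q] q in simp)
  have term_bound: "norm (hom_part (Suc n) F (disc_point w) - sectoral_coeff (Suc n) F * w ^ Suc n) \<le> u n" for n
  proof -
    have "norm (hom_part (Suc n) F (disc_point w) - sectoral_coeff (Suc n) F * w ^ Suc n) \<le> norm w / 2 * (grad_const (Suc n) * norm w ^ n * S / R ^ Suc n)"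
    proof (rule disc_point_bound[OF MVF])
      fix y :: "real^3" assume y: "y$1 = 0" "norm (zc y) = norm w"
      have ny: "norm y = norm w" using y disc_point_zc[of y] norm_disc[of "zc y"] by simp
      have "hom_part n (partial 2 F) y + \<i> * hom_part n (partial 3 F) y = hom_part n (\<lambda>x. 1 * partial 2 F x + \<i> * partial 3 F x) y"
        by (subst hom_part_lin[OF mean_value_on_partial[OF MVF] mean_value_on_partial[OF MVF]]) (use R in auto)
      also have "\<dots> = hom_part n (partial 1 V) y"
        by (rule hom_part_cong[OF open_ball[of 0 R]]) (use R dbar in auto)
      finally show "norm (hom_part n (partial 2 F) y + \<i> * hom_part n (partial 3 F) y) \<le> grad_const (Suc n) * norm w ^ n * S / R ^ Suc n"
        using hom_part_partial_grad_const[OF V bd R, of n 1 y] by (simp add: ny)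
    qed (use R in auto)
    also have "\<dots> = S * (grad_const (Suc n) / 2 * (norm w / R) ^ Suc n)" by (simp add: power_divide)
    also have "\<dots> \<le> S * (grad_const (Suc n) / 2 * q ^ Suc n)"
    proof -
      have "norm w / R \<le> q" unfolding q_def using nw x R by (intro divide_right_mono) auto
      moreover have "grad_const (Suc n) \<ge> 0" by (simp add: grad_const_def)
      ultimately show ?thesis using S0 R by (intro mult_left_mono power_mono) auto
    qed
    also have "\<dots> \<le> S * ((sqrt (2/3) * ((real (Suc n) + 1) * (real (Suc n) + 2) * (2 * real (Suc n) + 1)) - 8.35) * q ^ Suc n)"
      using grad_const_bound[of "Suc n"] S0 q by (intro mult_left_mono mult_right_mono) auto
    also have "\<dots> = u n" by (simp add: u_def algebra_simps)
    finally show ?thesis .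
  qed
  have wR: "norm w < R" using nw x r by simp
  have "(\<lambda>n. hom_part n F (disc_point w)) sums F (disc_point w)"
    by (rule harmonic_expansion[OF F]) (use wR norm_disc[of w] in simp)
  then have "(\<lambda>n. hom_part (Suc n) F (disc_point w)) sums (F (disc_point w) - F 0)"
    by (subst sums_Suc_iff) (simp add: hom_part_0)
  from sums_diff[OF this sectoral_sum_sums[OF F wR]]
  have sm: "(\<lambda>n. hom_part (Suc n) F (disc_point w) - sectoral_coeff (Suc n) F * w ^ Suc n) sums (F (disc_point w) - F 0 - sectoral_sum F w)" .
  have disc_point: "norm (F (disc_point w) - F 0 - sectoral_sum F w) \<le> S * (sqrt (2/3) * (2 * q * (3 - q) * (3 - q + q\<^sup>2) / (1 - q)^4) - 8.35 * (q * (1 / (1 - q))))"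
    using norm_suminf_le[OF term_bound sums_summable[OF su]] sums_unique[OF sm] sums_unique[OF su] by simp
  have M: "norm (partial j V p) \<le> sqrt 5 * S / (R - r)" if "p \<in> cball 0 r" for p j
  proof -
    have sub: "ball p (R - r) \<subseteq> ball 0 R" using that by (subst ball_subset_ball_iff) auto
    show ?thesis by (rule gradient_estimate[OF V sub]) (use r sub bd in auto)
  qed
  \<comment> \<open>The x_0-derivative of F consists of two partials of V, each at most sqrt 5 * S /
    (R - r).\<close>
  have off: "norm (F x - F (disc_point w)) \<le> 2 * sqrt 5 * S / (R - r) * norm x"
  proof -
    define E where "E = (axis 1 1 :: real^3)"
    have xd: "disc_point w + (x$1) *\<^sub>R E = x"
      by (simp add: vec_eq_iff forall_3 w_def zc_def disc_point_def E_def axis_def)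
    \<comment> \<open>The segment from the projection of \<open>x\<close> onto the disc up to
      \<open>x\<close> stays in the closed ball of radius r, because only the first coordinate
      shrinks.\<close>
    have mem: "disc_point w + t *\<^sub>R E \<in> cball 0 r" if "t \<in> closed_segment 0 (x$1)" for t
    proof -
      have t: "\<bar>t\<bar> \<le> \<bar>x$1\<bar>" using that by (auto simp: closed_segment_eq_real_ivl split: if_splits)
      have "(norm (disc_point w + t *\<^sub>R E))\<^sup>2 = t\<^sup>2 + (x$2)\<^sup>2 + (x$3)\<^sup>2"
        unfolding power2_norm_eq_inner by (simp add: inner_vec_def sum_3 w_def zc_def disc_point_def E_def axis_def power2_eq_square)
      also have "\<dots> \<le> (x$1)\<^sup>2 + (x$2)\<^sup>2 + (x$3)\<^sup>2" using power_mono[OF t, of 2] by simp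
      also have "\<dots> = (norm x)\<^sup>2"
        unfolding power2_norm_eq_inner by (simp add: inner_vec_def sum_3 power2_eq_square)
      finally have "norm (disc_point w + t *\<^sub>R E) \<le> norm x" by (rule power2_le_imp_le) simp
      then show ?thesis using x by simp
    qed
    have "norm (F (disc_point w + (x$1) *\<^sub>R E) - F (disc_point w + 0 *\<^sub>R E)) \<le> (2 * sqrt 5 * S / (R - r)) * norm (x$1 - 0)"
    proof (rule differentiable_bound[OF convex_closed_segment[of 0 "x$1"]])
      fix t assume t: "t \<in> closed_segment 0 (x$1)"
      have inb: "disc_point w + t *\<^sub>R E \<in> ball 0 R" using mem[OF t] r by simp
      have "(\<Sum>j\<in>UNIV. of_real (E$j) * partial j F (disc_point w + t *\<^sub>R E)) = partial 1 F (disc_point w + t *\<^sub>R E)"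
        by (simp add: sum_3 E_def axis_def)
      then have "((\<lambda>t. F (disc_point w + t *\<^sub>R E)) has_vector_derivative partial 1 F (disc_point w + t *\<^sub>R E)) (at t)"
        using has_grad_ray[OF mean_value_on_has_grad[OF MVF inb]] by simp
      then show "((\<lambda>t. F (disc_point w + t *\<^sub>R E)) has_derivative (\<lambda>h. h *\<^sub>R partial 1 F (disc_point w + t *\<^sub>R E))) (at t within closed_segment 0 (x$1))"
        by (auto simp: has_vector_derivative_def intro: has_derivative_at_withinI)
      have "norm (partial 1 F (disc_point w + t *\<^sub>R E)) \<le> norm (partial 2 V (disc_point w + t *\<^sub>R E)) + norm (partial 3 V (disc_point w + t *\<^sub>R E))"
        unfolding d1[OF inb] by (rule order_trans[OF norm_triangle_ineq]) (simp add: norm_mult)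
      also have "\<dots> \<le> sqrt 5 * S / (R - r) + sqrt 5 * S / (R - r)" by (intro add_mono M mem t)
      also have "\<dots> = 2 * sqrt 5 * S / (R - r)" by (simp flip: add_divide_distrib)
      finally have le: "norm (partial 1 F (disc_point w + t *\<^sub>R E)) \<le> 2 * sqrt 5 * S / (R - r)" .
      show "onorm (\<lambda>h. h *\<^sub>R partial 1 F (disc_point w + t *\<^sub>R E)) \<le> 2 * sqrt 5 * S / (R - r)"
      proof (intro onorm_le)
        fix s :: real
        show "norm (s *\<^sub>R partial 1 F (disc_point w + t *\<^sub>R E)) \<le> 2 * sqrt 5 * S / (R - r) * norm s"
          using mult_left_mono[OF le norm_ge_zero[of s]] by (simp only: norm_scaleR real_norm_def mult.commute)
      qed
    qed auto
    also have "\<dots> \<le> (2 * sqrt 5 * S / (R - r)) * norm x"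
      using S0 r component_le_norm_cart[of x 1] by (intro mult_left_mono) auto
    finally show ?thesis by (simp add: xd)
  qed
  have V0: "norm (V x - V 0) \<le> sqrt 15 * S / (R - r) * norm x"
    by (rule gradient_lipschitz[OF V bd x r])
  have "sqrt 15 * S / (R - r) * norm x + 2 * sqrt 5 * S / (R - r) * norm x \<le> S * (8.35 * (q * (1 / (1 - q))))"
  proof -
    \<comment> \<open>sqrt 15 is the cost of V, 2 sqrt 5 that of leaving the disc; together they fit
      the reserve.\<close>
    have f1: "sqrt 15 + 2 * sqrt 5 \<le> 8.35"
    proof -
      have "sqrt 15 \<le> 3.874" by (rule real_le_lsqrt) (simp_all add: power2_eq_square)
      moreover have "sqrt 5 \<le> 2.237" by (rule real_le_lsqrt) (simp_all add: power2_eq_square)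
      ultimately show ?thesis by simp
    qed
    have f2: "S / (R - r) * norm x \<le> S / (R - r) * r" using S0 r x by (intro mult_left_mono) auto
    have "(sqrt 15 + 2 * sqrt 5) * (S / (R - r) * norm x) \<le> 8.35 * (S / (R - r) * r)"
      by (rule mult_mono[OF f1 f2]) (use S0 r in simp_all)
    moreover have "r / (R - r) = q * (1 / (1 - q))" using R r by (simp add: q_def field_simps)
    then have "8.35 * (S / (R - r) * r) = S * (8.35 * (q * (1 / (1 - q))))"
      by (metis mult.commute mult.left_commute times_divide_eq_left times_divide_eq_right)
    moreover have "sqrt 15 * S / (R - r) * norm x + 2 * sqrt 5 * S / (R - r) * norm x
        = (sqrt 15 + 2 * sqrt 5) * (S / (R - r) * norm x)"
      by (simp add: algebra_simps add_divide_distrib)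
    ultimately show ?thesis by (simp only:)
  qed
  moreover have "norm (F x - F 0 - sectoral_sum F w) \<le> norm (F x - F (disc_point w)) + norm (F (disc_point w) - F 0 - sectoral_sum F w)"
  proof -
    have "F x - F 0 - sectoral_sum F w = (F x - F (disc_point w)) + (F (disc_point w) - F 0 - sectoral_sum F w)" by simp
    then show ?thesis by (simp only: norm_triangle_ineq)
  qed
  ultimately show ?thesis using disc_point off V0 unfolding w_def[symmetric] q_def[symmetric] by (simp add: algebra_simps)
qed

section \<open>The hyperholomorphic constants\<close>

text \<open>By Rodrigues' formula the diagonal case differentiates the monic polynomial (t^2 - 1)^m
  of degree 2m exactly 2m times, which leaves the constant (2m)!.\<close>

lemma assoc_legendre_diag:
  obtains c where "c \<noteq> 0" "\<And>t. assoc_legendre m m t = c * sqrt (1 - t\<^sup>2) ^ m"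
proof -
  define p where "p = ([:-1, 0, 1:] :: real poly) ^ m"
  have pd: "degree p = 2 * m" "lead_coeff p = 1"
    unfolding p_def lead_coeff_power by (simp_all add: degree_power_eq)
  define q where "q = (pderiv ^^ (2 * m)) p"
  have cq: "coeff q k = (if k = 0 then fact (2 * m) else 0)" for k
    unfolding q_def coeff_higher_pderiv
    using pd by (auto simp: coeff_eq_0 pochhammer_fact[symmetric])
  then have q: "q = [:fact (2 * m):]"
    by (intro poly_eqI) (auto simp: coeff_pCons split: nat.split)
  have sm: "(pderiv ^^ k) (smult a r) = smult a ((pderiv ^^ k) r)" for a k and r :: "real poly"
    by (induction k) (auto simp: pderiv_smult)
  have "(pderiv ^^ m) (legendreP m) = smult (1 / (2 ^ m * fact m)) q"
    by (simp add: legendreP_def sm q_def p_def mult_2 funpow_add)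
  then have "assoc_legendre m m t = (fact (2 * m) / (2 ^ m * fact m)) * sqrt (1 - t\<^sup>2) ^ m" for t
    by (simp add: assoc_legendre_def q)
  then show ?thesis by (rule that[rotated]) simp
qed

text \<open>A unimodular u = c + i s satisfies u^2 = 2 c u - 1, so its powers obey the Chebyshev
  recurrence; this is de Moivre's formula without angles.\<close>

lemma cheby_unit:
  fixes c s :: real
  assumes "c\<^sup>2 + s\<^sup>2 = 1"
  shows "Re (Complex c s ^ m) = chebyT m c" and "Im (Complex c s ^ Suc m) = s * chebyU m c"
proof -
  let ?u = "Complex c s"
  have u2: "?u * ?u = 2 * of_real c * ?u - 1"
    using assms by (simp add: complex_eq_iff power2_eq_square)
  have rec: "?u ^ Suc (Suc k) = of_real (2 * c) * ?u ^ Suc k - ?u ^ k" for k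
  proof -
    have "?u ^ Suc (Suc k) = (?u * ?u) * ?u ^ k" by (simp add: mult.assoc)
    also have "\<dots> = of_real (2 * c) * ?u ^ Suc k - ?u ^ k" unfolding u2 by (simp add: algebra_simps)
    finally show ?thesis .
  qed
  have "Re (?u ^ m) = chebyT m c \<and> Re (?u ^ Suc m) = chebyT (Suc m) c"
  proof (induction m)
    case (Suc m)
    have "Re (?u ^ Suc (Suc m)) = chebyT (Suc (Suc m)) c"
      unfolding rec[of m] using Suc by (simp del: power_Suc)
    with Suc show ?case by (simp del: power_Suc chebyT.simps)
  qed simp
  then show "Re (?u ^ m) = chebyT m c" ..
  have "Im (?u ^ Suc m) = s * chebyU m c \<and> Im (?u ^ Suc (Suc m)) = s * chebyU (Suc m) c"
  proof (induction m)
    case 0 show ?case by (simp add: algebra_simps)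
  next
    case (Suc m)
    have "Im (?u ^ Suc (Suc (Suc m))) = s * chebyU (Suc (Suc m)) c"
      unfolding rec[of "Suc m"] using Suc by (simp add: algebra_simps del: power_Suc)
    with Suc show ?case by (simp del: power_Suc chebyU.simps)
  qed
  then show "Im (?u ^ Suc m) = s * chebyU m c" ..
qed

text \<open>Since r sin(th1) e^(i th2) = z, the top-order solid harmonics are multiples of the real
  and imaginary parts of z^(n+1). The default values on the x_0-axis are harmless because
  \<open>rho\<close> is 0 there.\<close>

lemma sectoral:
  obtains c where "c \<noteq> 0" "\<And>x. solidU (Suc n) (Suc n) x = c * Re (zc x ^ Suc n)"
    "\<And>x. solidV (Suc n) (Suc n) x = c * Im (zc x ^ Suc n)"
proof -
  let ?m = "Suc n"
  obtain c where c: "c \<noteq> 0" "\<And>t. assoc_legendre ?m ?m t = c * sqrt (1 - t\<^sup>2) ^ ?m"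
    by (rule assoc_legendre_diag[of "Suc n"]) (rule that)
  have rho: "norm x * sqrt (1 - (cos_th1 x)\<^sup>2) = rho x" for x :: "real^3"
  proof (cases "x = 0")
    case False
    have n: "(norm x)\<^sup>2 = (x$1)\<^sup>2 + ((x$2)\<^sup>2 + (x$3)\<^sup>2)"
      unfolding power2_norm_eq_inner by (simp add: inner_vec_def sum_3 power2_eq_square)
    have "norm x * sqrt (1 - (cos_th1 x)\<^sup>2) = sqrt ((norm x)\<^sup>2 * (1 - (cos_th1 x)\<^sup>2))"
      by (simp add: real_sqrt_mult)
    also have "(norm x)\<^sup>2 * (1 - (cos_th1 x)\<^sup>2) = (norm x)\<^sup>2 - (x$1)\<^sup>2"
      using False by (simp add: cos_th1_def power_divide right_diff_distrib)
    also have "\<dots> = (x$2)\<^sup>2 + (x$3)\<^sup>2" using n by simp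
    finally show ?thesis by (simp add: rho_def)
  qed (simp add: rho_def)
  have radial: "norm x ^ ?m * assoc_legendre ?m ?m (cos_th1 x) = c * rho x ^ ?m" for x
    unfolding c(2) rho[symmetric] power_mult_distrib by (simp only: mult_ac)
  have unit: "(cos_th2 x)\<^sup>2 + (sin_th2 x)\<^sup>2 = 1" "zc x = of_real (rho x) * Complex (cos_th2 x) (sin_th2 x)" for x
  proof -
    have r2: "(rho x)\<^sup>2 = (x$2)\<^sup>2 + (x$3)\<^sup>2" by (simp add: rho_def)
    show "(cos_th2 x)\<^sup>2 + (sin_th2 x)\<^sup>2 = 1"
      using r2 by (auto simp: cos_th2_def sin_th2_def power_divide simp flip: add_divide_distrib)
    show "zc x = of_real (rho x) * Complex (cos_th2 x) (sin_th2 x)"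
    proof (cases "rho x = 0")
      case True
      then have "x$2 = 0" "x$3 = 0" using r2 by (auto simp: sum_power2_eq_zero_iff)
      then show ?thesis using True by (simp add: zc_def complex_eq_iff)
    qed (simp add: zc_def complex_eq_iff cos_th2_def sin_th2_def)
  qed
  have z: "zc x ^ ?m = of_real (rho x ^ ?m) * Complex (cos_th2 x) (sin_th2 x) ^ ?m" for x
    unfolding unit(2)[of x] by (simp only: power_mult_distrib of_real_power)
  have "solidU ?m ?m x = c * Re (zc x ^ ?m)" for x
  proof -
    have "solidU ?m ?m x = (norm x ^ ?m * assoc_legendre ?m ?m (cos_th1 x)) * chebyT ?m (cos_th2 x)"
      by (simp only: solidU_def mult.assoc)
    also have "\<dots> = c * (rho x ^ ?m * Re (Complex (cos_th2 x) (sin_th2 x) ^ ?m))"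
      unfolding radial cheby_unit(1)[OF unit(1)] by (simp only: mult.assoc)
    also have "rho x ^ ?m * Re (Complex (cos_th2 x) (sin_th2 x) ^ ?m) = Re (zc x ^ ?m)"
      unfolding z by (simp only: Re_complex_of_real Im_complex_of_real times_complex.sel mult_zero_left diff_zero)
    finally show ?thesis .
  qed
  moreover have "solidV ?m ?m x = c * Im (zc x ^ ?m)" for x
  proof -
    have "solidV ?m ?m x = (norm x ^ ?m * assoc_legendre ?m ?m (cos_th1 x)) * (sin_th2 x * chebyU n (cos_th2 x))"
      by (simp only: solidV_def mult.assoc diff_Suc_1)
    also have "\<dots> = c * (rho x ^ ?m * Im (Complex (cos_th2 x) (sin_th2 x) ^ ?m))"
      unfolding radial cheby_unit(2)[OF unit(1)] by (simp only: mult.assoc)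
    also have "rho x ^ ?m * Im (Complex (cos_th2 x) (sin_th2 x) ^ ?m) = Im (zc x ^ ?m)"
      unfolding z by (simp only: Re_complex_of_real Im_complex_of_real times_complex.sel mult_zero_left add_0_right)
    finally show ?thesis .
  qed
  ultimately show ?thesis using c(1) by (rule that[rotated])
qed

lemma partial_of_grad:
  assumes "has_grad v g x" "bounded_linear L"
  shows "partial j (\<lambda>x. L (v x) :: real) x = L (g j)"
proof -
  have "((\<lambda>x. L (v x)) has_derivative (\<lambda>h. L (\<Sum>j\<in>UNIV. of_real (h$j) * g j))) (at x)"
    by (rule bounded_linear.has_derivative[OF assms(2) has_gradD[OF assms(1)]])
  then have "frechet_derivative (\<lambda>x. L (v x)) (at x) = (\<lambda>h. L (\<Sum>j\<in>UNIV. of_real (h$j) * g j))"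
    by (rule frechet_derivative_at[symmetric])
  moreover have "(\<Sum>i\<in>UNIV. of_real ((axis j 1 :: real^3)$i) * g i) = (\<Sum>i\<in>UNIV. if i = j then g i else 0)"
    by (rule sum.cong) (auto simp: axis_def)
  ultimately show ?thesis by (simp add: partial_def)
qed

text \<open>Inverse to the packing F = f_1 - i f_2: applied to \<open>quat_of w\<close>, it returns
  \<open>w\<close>.\<close>

definition quat_of :: "complex \<Rightarrow> quat" where "quat_of w = vector [0, Re w, - Im w, 0]"

lemma quat_of_nth [simp]: "quat_of w $ 1 = 0" "quat_of w $ 2 = Re w" "quat_of w $ 3 = - Im w" "quat_of w $ 4 = 0"
  by (simp_all add: quat_of_def)

lemma quat_eq_iff: "(a::quat) = b \<longleftrightarrow> a$1 = b$1 \<and> a$2 = b$2 \<and> a$3 = b$3 \<and> a$4 = b$4"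
  by (simp add: vec_eq_iff forall_4)

text \<open>On functions of x_1, x_2 alone the conjugate operator is minus the gradient, which turns
  Re z^(n+1) and Im z^(n+1) into multiples of z^n and -i z^n. The common factor \<open>k\<close>
  gives both families the same norm.\<close>

lemma XY_sectoral:
  obtains k :: real where "k \<noteq> 0" "\<And>x. Xdag (Suc n) n x = quat_of (of_real k * zc x ^ n)"
    "\<And>x. Ydag (Suc n) n x = quat_of (of_real k * (- \<i> * zc x ^ n))"
proof -
  obtain c where c: "c \<noteq> 0" "\<And>x. solidU (Suc n) (Suc n) x = c * Re (zc x ^ Suc n)"
    "\<And>x. solidV (Suc n) (Suc n) x = c * Im (zc x ^ Suc n)" 
    by (rule sectoral[of n]) (rule that)
  have g: "has_grad (\<lambda>x. zc x ^ Suc n) (\<lambda>j. of_nat (Suc n) * zc x ^ n * zc_grad j) x" for x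
    using has_grad_pow[OF has_grad_zc, of "Suc n" x] by simp
  have U: "partial j (solidU (Suc n) (Suc n)) x = c * Re (of_nat (Suc n) * zc x ^ n * zc_grad j)" for j x
    unfolding c(2)[abs_def]
    by (rule partial_of_grad[OF g, of "\<lambda>w. c * Re w"]) (intro bounded_linear_const_mult bounded_linear_Re)
  have V: "partial j (solidV (Suc n) (Suc n)) x = c * Im (of_nat (Suc n) * zc x ^ n * zc_grad j)" for j x
    unfolding c(3)[abs_def]
    by (rule partial_of_grad[OF g, of "\<lambda>w. c * Im w"]) (intro bounded_linear_const_mult bounded_linear_Im)
  show ?thesis
  proof (rule that[of "- (c * real (Suc n) / 2)"])
    show "- (c * real (Suc n) / 2) \<noteq> 0" using c(1) by simp
    show "Xdag (Suc n) n x = quat_of (of_real (- (c * real (Suc n) / 2)) * zc x ^ n)" for x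
      by (simp add: Xdag_def Dbar_real_def U quat_eq_iff del: of_nat_Suc)
    show "Ydag (Suc n) n x = quat_of (of_real (- (c * real (Suc n) / 2)) * (- \<i> * zc x ^ n))" for x
      by (simp add: Ydag_def Dbar_real_def V quat_eq_iff del: of_nat_Suc)
  qed
qed

section \<open>Inner products with the sectoral basis\<close>

lemma Sc_qcnj: "Sc (qcnj a \<otimes>q b) = a$1 * b$1 + a$2 * b$2 + a$3 * b$3 + a$4 * b$4"
  by (simp add: Sc_def qcnj_def qmult_def)

lemma set_integral_ball_scale:
  fixes g :: "real^3 \<Rightarrow> complex"
  assumes c: "continuous_on (ball 0 s) g" and s: "s > 0"
  shows "(LINT x:ball 0 s|lborel. g x) = of_real (s^3) * bint (\<lambda>y. g (s *\<^sub>R y))"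
proof -
  have m: "(\<lambda>y. indicator (ball 0 s) y *\<^sub>R g y) \<in> borel_measurable borel"
    by (intro borel_measurable_continuous_on_indicator c) auto
  have "0 + s *\<^sub>R y \<in> ball 0 s \<longleftrightarrow> y \<in> ball 0 1" for y :: "real^3" using s by simp
  then have "indicator (ball 0 s) (0 + s *\<^sub>R y) = (indicator (ball 0 1) y :: real)" for y :: "real^3"
    unfolding indicator_def by simp
  then show ?thesis
    using lborel_scale_integral[OF m s, of 0] by (simp add: bint_def set_lebesgue_integral_def)
qed

lemma zc_moment_pos: "\<exists>N>0. zc_moment n 0 = complex_of_real N"
proof -
  have "zc_moment n 0 = of_real (bint (\<lambda>y. (norm (zc y))\<^sup>2 ^ n))"
    by (simp add: zc_moment_def complex_norm_square[symmetric] flip: bint_of_real of_real_power)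
  moreover have "bint (\<lambda>y. (norm (zc y))\<^sup>2 ^ n) > 0"
  proof (rule bint_pos)
    show "norm (disc_point (1/2)) < 1" by (simp add: norm_disc)
    show "(norm (zc (disc_point (1/2))))\<^sup>2 ^ n > 0" by simp
  qed (auto intro!: continuous_intros)
  ultimately show ?thesis by blast
qed

text \<open>\<open>null_projection\<close> is available for radii below R only, so the ball is
  exhausted by smaller ones and integrability over the whole ball dominates. The exponent 2n + 3 is
  3 from the Jacobian and n from each of the two homogeneous factors.\<close>

lemma projection_ball:
  assumes h: "harmonic_on (ball 0 R) F" and R: "R > 0"
    and int: "set_integrable lborel (ball 0 R) (\<lambda>x. F x * cnj (zc x) ^ n)"
  shows "(LINT x:ball 0 R|lborel. F x * cnj (zc x) ^ n) = sectoral_coeff n F * (of_real (R ^ (2 * n + 3)) * zc_moment n 0)"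
proof -
  let ?G = "\<lambda>x. F x * cnj (zc x) ^ n"
  \<comment> \<open>The index shift by 2 makes the first radius positive.\<close>
  define X where "X k = R * (1 - inverse (real (Suc (Suc k))))" for k
  have X: "0 < X k" "X k < R" for k
  proof -
    have "inverse (real (Suc (Suc k))) < 1" by (simp add: inverse_less_1_iff)
    then show "0 < X k" using R by (simp add: X_def)
    show "X k < R" using R by (simp add: X_def algebra_simps)
  qed
  have "(\<lambda>k. R * (1 - inverse (real (Suc (Suc k))))) \<longlonglongrightarrow> R * (1 - 0)"
    using LIMSEQ_Suc[OF LIMSEQ_inverse_real_of_nat] by (intro tendsto_intros)
  then have Xlim: "X \<longlonglongrightarrow> R" by (simp add: X_def[abs_def])
  have cG: "continuous_on (ball 0 R) ?G"
    by (intro continuous_intros harmonic_on_continuous[OF h])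
  have val: "(LINT x:ball 0 (X k)|lborel. ?G x) = sectoral_coeff n F * (of_real (X k ^ (2 * n + 3)) * zc_moment n 0)" for k
  proof -
    have "(LINT x:ball 0 (X k)|lborel. ?G x) = of_real (X k ^ 3) * bint (\<lambda>y. ?G (X k *\<^sub>R y))"
      by (rule set_integral_ball_scale[OF continuous_on_subset[OF cG]]) (use X[of k] in auto)
    also have "(\<lambda>y. ?G (X k *\<^sub>R y)) = (\<lambda>y. of_real (X k) ^ n * (F (X k *\<^sub>R y) * cnj (zc y) ^ n * uc y ^ 0))"
    proof
      fix y
      have "zc (X k *\<^sub>R y) = of_real (X k) * zc y" by (simp add: zc_def complex_eq_iff)
      then show "?G (X k *\<^sub>R y) = of_real (X k) ^ n * (F (X k *\<^sub>R y) * cnj (zc y) ^ n * uc y ^ 0)"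
        by (simp add: power_mult_distrib mult_ac)
    qed
    also have "of_real (X k ^ 3) * bint (\<lambda>y. of_real (X k) ^ n * (F (X k *\<^sub>R y) * cnj (zc y) ^ n * uc y ^ 0))
      = sectoral_coeff n F * (of_real (X k ^ (2 * n + 3)) * zc_moment n 0)"
    proof -
      have "complex_of_real (X k ^ (2 * n + 3)) = of_real (X k ^ 3) * (of_real (X k) ^ n * of_real (X k) ^ n)"
        unfolding mult_2 power_add of_real_mult of_real_power by (rule mult.commute)
      moreover have "a * (b * (b * z * N)) = z * (a * (b * b) * N)" for a b z N :: complex by simp
      ultimately show ?thesis unfolding bint_cmult null_projection[OF h X] by metis
    qed
    finally show ?thesis .
  qed
  have "(\<lambda>k. LINT x|lborel. indicator (ball 0 (X k)) x *\<^sub>R ?G x) \<longlonglongrightarrow> (LINT x|lborel. indicator (ball 0 R) x *\<^sub>R ?G x)"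
  proof (rule integral_dominated_convergence[where w="\<lambda>x. norm (indicator (ball 0 R) x *\<^sub>R ?G x)"])
    show "(\<lambda>x. indicator (ball 0 R) x *\<^sub>R ?G x) \<in> borel_measurable lborel"
      using int by (simp add: set_integrable_def borel_measurable_integrable)
    show "(\<lambda>x. indicator (ball 0 (X k)) x *\<^sub>R ?G x) \<in> borel_measurable lborel" for k
    proof -
      have "continuous_on (ball 0 (X k)) ?G"
        by (rule continuous_on_subset[OF cG]) (use X[of k] in auto)
      then show ?thesis
        using borel_measurable_continuous_on_indicator[of "ball 0 (X k)" ?G] by simp
    qed
    show "integrable lborel (\<lambda>x. norm (indicator (ball 0 R) x *\<^sub>R ?G x))"
      using int unfolding set_integrable_def by (rule integrable_norm)
    show "AE x in lborel. norm (indicator (ball 0 (X k)) x *\<^sub>R ?G x) \<le> norm (indicator (ball 0 R) x *\<^sub>R ?G x)" for k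
      using X(2)[of k] by (intro AE_I2) (auto simp: indicator_def)
    show "AE x in lborel. (\<lambda>k. indicator (ball 0 (X k)) x *\<^sub>R ?G x) \<longlonglongrightarrow> indicator (ball 0 R) x *\<^sub>R ?G x"
    proof (rule AE_I2)
      fix x :: "real^3"
      show "(\<lambda>k. indicator (ball 0 (X k)) x *\<^sub>R ?G x) \<longlonglongrightarrow> indicator (ball 0 R) x *\<^sub>R ?G x"
      proof (cases "norm x < R")
        case True
        then have "\<forall>\<^sub>F k in sequentially. norm x < X k" using Xlim by (rule order_tendstoD(1)[rotated])
        then have "\<forall>\<^sub>F k in sequentially. indicator (ball 0 (X k)) x *\<^sub>R ?G x = indicator (ball 0 R) x *\<^sub>R ?G x"
          by eventually_elim (use True in simp)
        then show ?thesis by (rule tendsto_eventually)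
      next
        case False
        then have "indicator (ball 0 (X k)) x *\<^sub>R ?G x = indicator (ball 0 R) x *\<^sub>R ?G x" for k
          using X(2)[of k] by simp
        then show ?thesis by (simp only: tendsto_const)
      qed
    qed
  qed
  then have "(\<lambda>k. sectoral_coeff n F * (of_real (X k ^ (2 * n + 3)) * zc_moment n 0)) \<longlonglongrightarrow> (LINT x:ball 0 R|lborel. ?G x)"
    using val by (simp add: set_lebesgue_integral_def)
  moreover have "(\<lambda>k. sectoral_coeff n F * (of_real (X k ^ (2 * n + 3)) * zc_moment n 0)) \<longlonglongrightarrow> sectoral_coeff n F * (of_real (R ^ (2 * n + 3)) * zc_moment n 0)"
    by (intro tendsto_intros Xlim)
  ultimately show ?thesis using LIMSEQ_unique by blast
qed

section \<open>The growth estimate\<close>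

text \<open>Schwarz's lemma for H / (2 A' - H). A strictly larger A' makes the denominator nonzero
  even when A = 0; the limit A' -> A restores the sharp constant.\<close>

lemma borel_caratheodory_zero:
  assumes hol: "H holomorphic_on ball 0 R" and H0: "H 0 = 0" and R: "R > 0"
    and bd: "\<And>w. norm w < R \<Longrightarrow> Re (H w) \<le> A" and w: "norm w < R"
  shows "norm (H w) * (R - norm w) \<le> 2 * norm w * A"
proof -
  have A0: "A \<ge> 0" using bd[of 0] H0 R by simp
  have main: "norm (H w) * (R - norm w) \<le> 2 * norm w * A'" if A': "A' > A" for A'
  proof -
    have A'0: "A' > 0" using A' A0 by simp
    have Rz: "norm (of_real R * z) < R" if "norm z < 1" for z :: complex
      using that R by (simp add: norm_mult)
    \<comment> \<open>The half-plane \<open>Re h < A'\<close> consists of the points nearer to 0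
      than to 2 A', so the quotient defined below has modulus less than 1.\<close>
    have lt: "norm (H (of_real R * z)) < norm (2 * of_real A' - H (of_real R * z))" if "norm z < 1" for z
    proof -
      let ?h = "H (of_real R * z)"
      have "Re ?h < A'" using bd[OF Rz[OF that]] A' by simp
      then have "A' * Re ?h < A' * A'" using A'0 by simp
      then have "(norm ?h)\<^sup>2 < (norm (2 * of_real A' - ?h))\<^sup>2"
        unfolding cmod_power2 by (simp add: power2_eq_square algebra_simps)
      then show ?thesis by (rule power2_less_imp_less) simp
    qed
    define g where "g z = H (of_real R * z) / (2 * of_real A' - H (of_real R * z))" for z
    have nz: "2 * of_real A' - H (of_real R * z) \<noteq> 0" if "norm z < 1" for z
      using lt[OF that] by (metis norm_eq_zero norm_ge_zero not_le)
    have "norm (g (w / of_real R)) \<le> norm (w / of_real R)"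
    proof (rule Schwarz_Lemma(1))
      have "(H \<circ> (\<lambda>z. of_real R * z)) holomorphic_on ball 0 1"
        by (rule holomorphic_on_compose_gen[OF _ hol]) (use R in \<open>auto intro!: holomorphic_intros simp: norm_mult\<close>)
      then have "(\<lambda>z. H (of_real R * z)) holomorphic_on ball 0 1" by (simp add: o_def)
      then show "g holomorphic_on ball 0 1"
        unfolding g_def[abs_def] by (intro holomorphic_intros) (use nz in auto)
      show "g 0 = 0" by (simp add: g_def H0)
      show "norm (g z) < 1" if "norm z < 1" for z
        using lt[OF that] nz[OF that] by (simp add: g_def norm_divide)
      show "norm (w / of_real R) < 1" using w R by (simp add: norm_divide)
    qed
    then have "norm (H w / (2 * of_real A' - H w)) \<le> norm w / R" using R by (simp add: g_def norm_divide)
    moreover have nzw: "norm (2 * of_real A' - H w) > 0"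
      using nz[of "w / of_real R"] w R by (simp add: norm_divide)
    ultimately have "norm (H w) * R \<le> norm w * norm (2 * of_real A' - H w)"
      using R by (simp add: norm_divide field_simps)
    also have "\<dots> \<le> norm w * (2 * A' + norm (H w))"
      using norm_triangle_ineq4[of "2 * of_real A'" "H w"] A'0 by (intro mult_left_mono) (auto simp: norm_mult)
    finally show ?thesis by (simp add: algebra_simps)
  qed
  show ?thesis
  proof (rule tendsto_lowerbound[of "\<lambda>A'. 2 * norm w * A'" _ "at_right A"])
    show "((\<lambda>A'. 2 * norm w * A') \<longlongrightarrow> 2 * norm w * A) (at_right A)" by (intro tendsto_intros)
    show "\<forall>\<^sub>F A' in at_right A. norm (H w) * (R - norm w) \<le> 2 * norm w * A'"
      using main by (simp add: eventually_at_filter)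
  qed simp
qed

lemma sectoral_sum_zero: "sectoral_sum F 0 = 0"
  by (simp add: sectoral_sum_def)

lemma sectoral_sum_holomorphic:
  assumes "harmonic_on (ball 0 R) F" shows "sectoral_sum F holomorphic_on ball 0 R"
proof (rule power_series_holomorphic[of 0 R "\<lambda>n. if n = 0 then 0 else sectoral_coeff n F"])
  fix w :: complex assume "w \<in> ball 0 R"
  then have "(\<lambda>n. sectoral_coeff (Suc n) F * w ^ Suc n) sums sectoral_sum F w" by (intro sectoral_sum_sums[OF assms]) simp
  then have "(\<lambda>n. (if Suc n = 0 then 0 else sectoral_coeff (Suc n) F) * (w - 0) ^ Suc n) sums (sectoral_sum F w - (if (0::nat) = 0 then 0 else sectoral_coeff 0 F) * (w - 0) ^ 0)"
    by simp
  then show "(\<lambda>n. (if n = 0 then 0 else sectoral_coeff n F) * (w - 0) ^ n) sums sectoral_sum F w"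
    by (subst (asm) sums_Suc_iff) simp
qed

section \<open>The sectoral part of f as a power series in z\<close>

context
  fixes R :: real and f :: "real^3 \<Rightarrow> quat" and F :: "real^3 \<Rightarrow> complex"
  assumes R: "R > 0" and L2: "in_L2_ball R f" and mono: "monogenic_on_ball R f"
  defines "F \<equiv> \<lambda>x. 1 * component 2 f x + (- \<i>) * component 3 f x"
begin

lemma F_harm: "harmonic_on (ball 0 R) F"
  unfolding F_def by (rule mono_dbar(1)[OF mono])

lemma F_eq: "F x = of_real (f x $ 2) - \<i> * of_real (f x $ 3)"
  by (simp add: F_def component_def)

text \<open>On a bounded ball square integrability gives integrability through |F| <= |f| <= 1 +
  |f|^2, and |z| is at most R.\<close>

lemma F_integrable: "set_integrable lborel (ball 0 R) (\<lambda>x. F x * cnj (zc x) ^ n)"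
proof (rule set_integrable_bound[of _ _ "\<lambda>x. R ^ n * (1 + (norm (f x))\<^sup>2)"])
  show "set_integrable lborel (ball 0 R) (\<lambda>x. R ^ n * (1 + (norm (f x))\<^sup>2))"
  proof (rule set_integrable_mult_right, rule set_integral_add(1))
    show "set_integrable lborel (ball (0::real^3) R) (\<lambda>x. 1::real)"
      unfolding set_integrable_def
      using integrable_real_indicator[of "ball (0::real^3) R" lborel] emeasure_lborel_ball_finite[of "0::real^3" R] by simp
    show "set_integrable lborel (ball 0 R) (\<lambda>x. (norm (f x))\<^sup>2)" using L2 by (simp add: in_L2_ball_def)
  qed
  have "continuous_on (ball 0 R) (\<lambda>x. F x * cnj (zc x) ^ n)"
    by (intro continuous_intros harmonic_on_continuous[OF F_harm])
  then show "set_borel_measurable lborel (ball 0 R) (\<lambda>x. F x * cnj (zc x) ^ n)"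
    unfolding set_borel_measurable_def
    using borel_measurable_continuous_on_indicator[of "ball 0 R" "\<lambda>x. F x * cnj (zc x) ^ n"] by simp
  show "AE x in lborel. x \<in> ball 0 R \<longrightarrow> norm (F x * cnj (zc x) ^ n) \<le> norm (R ^ n * (1 + (norm (f x))\<^sup>2))"
  proof (intro AE_I2 impI)
    fix x :: "real^3" assume x: "x \<in> ball 0 R"
    have "norm (F x) \<le> norm (f x)"
    proof (rule power2_le_imp_le)
      show "(norm (F x))\<^sup>2 \<le> (norm (f x))\<^sup>2"
        unfolding power2_norm_eq_inner[of "f x"] cmod_power2 F_eq by (simp add: inner_vec_def sum_4 power2_eq_square)
    qed simp
    also have "\<dots> \<le> 1 + (norm (f x))\<^sup>2"
    proof -
      have "0 \<le> (norm (f x) - 1)\<^sup>2" by simp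
      then have "2 * norm (f x) \<le> 1 + (norm (f x))\<^sup>2" by (simp add: power2_diff)
      then show ?thesis using norm_ge_zero[of "f x"] by linarith
    qed
    finally have "norm (F x) * norm (zc x) ^ n \<le> (1 + (norm (f x))\<^sup>2) * R ^ n"
      using norm_zc_le[of x] x by (intro mult_mono power_mono) auto
    then show "norm (F x * cnj (zc x) ^ n) \<le> norm (R ^ n * (1 + (norm (f x))\<^sup>2))"
      using R by (simp add: norm_mult norm_power mult.commute)
  qed
qed

text \<open>The real inner product is the real part of a Hermitian one, once the e1- and
  e2-components are read as a complex number.\<close>

lemma L2_inner_quat_of:
  assumes "set_integrable lborel (ball 0 R) (\<lambda>x. (of_real (g x $ 2) - \<i> * of_real (g x $ 3)) * cnj (w x))"
  shows "L2_inner R (\<lambda>x. quat_of (w x)) g = Re (LINT x:ball 0 R|lborel. (of_real (g x $ 2) - \<i> * of_real (g x $ 3)) * cnj (w x))"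
proof -
  have "L2_inner R (\<lambda>x. quat_of (w x)) g = (LINT x|lborel. Re (indicator (ball 0 R) x *\<^sub>R ((of_real (g x $ 2) - \<i> * of_real (g x $ 3)) * cnj (w x))))"
    unfolding L2_inner_def Sc_qcnj set_lebesgue_integral_def by (simp add: algebra_simps)
  also have "\<dots> = Re (LINT x|lborel. indicator (ball 0 R) x *\<^sub>R ((of_real (g x $ 2) - \<i> * of_real (g x $ 3)) * cnj (w x)))"
    using assms unfolding set_integrable_def by (rule integral_Re)
  finally show ?thesis by (simp add: set_lebesgue_integral_def)
qed

text \<open>The unimodular \<open>\<beta>\<close> treats both families at once: 1 for
  \<open>Xdag\<close> and \<open>- \<i>\<close> for \<open>Ydag\<close>.\<close>

lemma L2_norm_quat_of:
  assumes N: "zc_moment n 0 = of_real N" and b: "norm \<beta> = 1"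
  shows "L2_norm R (\<lambda>x. quat_of (of_real k * (\<beta> * zc x ^ n))) = \<bar>k\<bar> * sqrt (R ^ (2 * n + 3) * N)"
proof -
  let ?w = "\<lambda>x. of_real k * (\<beta> * zc x ^ n)"
  have bb: "\<beta> * cnj \<beta> = 1" using b by (simp add: complex_norm_square[symmetric])
  have eq: "(of_real (quat_of (?w x) $ 2) - \<i> * of_real (quat_of (?w x) $ 3)) * cnj (?w x) = of_real (k\<^sup>2) * (zc x * cnj (zc x)) ^ n" for x
  proof -
    have "of_real (quat_of (?w x) $ 2) - \<i> * of_real (quat_of (?w x) $ 3) = ?w x" by (simp add: complex_eq_iff)
    then have "(of_real (quat_of (?w x) $ 2) - \<i> * of_real (quat_of (?w x) $ 3)) * cnj (?w x)
        = of_real (k * k) * (\<beta> * cnj \<beta>) * (zc x * cnj (zc x)) ^ n"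
      by (simp add: power_mult_distrib mult_ac)
    then show ?thesis by (simp add: bb power2_eq_square)
  qed
  have cont: "continuous_on A (\<lambda>x. complex_of_real (k\<^sup>2) * (zc x * cnj (zc x)) ^ n)" for A
    by (intro continuous_intros)
  have int: "set_integrable lborel (ball 0 R) (\<lambda>x. complex_of_real (k\<^sup>2) * (zc x * cnj (zc x)) ^ n)"
  proof (rule set_integrable_subset)
    show "set_integrable lborel (cball 0 R) (\<lambda>x. complex_of_real (k\<^sup>2) * (zc x * cnj (zc x)) ^ n)"
      using borel_integrable_compact[OF compact_cball cont]
      by (simp add: set_integrable_def indicator_scaleR_eq_if)
  qed auto
  have "(LINT x:ball 0 R|lborel. complex_of_real (k\<^sup>2) * (zc x * cnj (zc x)) ^ n)
     = of_real (R^3) * bint (\<lambda>y. complex_of_real (k\<^sup>2) * (zc (R *\<^sub>R y) * cnj (zc (R *\<^sub>R y))) ^ n)"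
    by (rule set_integral_ball_scale[OF cont R])
  also have "(\<lambda>y. complex_of_real (k\<^sup>2) * (zc (R *\<^sub>R y) * cnj (zc (R *\<^sub>R y))) ^ n)
     = (\<lambda>y. of_real (k\<^sup>2 * (R * R) ^ n) * ((zc y * cnj (zc y)) ^ n * uc y ^ 0))"
  proof
    fix y
    have "zc (R *\<^sub>R y) = of_real R * zc y" by (simp add: zc_def complex_eq_iff)
    then show "complex_of_real (k\<^sup>2) * (zc (R *\<^sub>R y) * cnj (zc (R *\<^sub>R y))) ^ n = of_real (k\<^sup>2 * (R * R) ^ n) * ((zc y * cnj (zc y)) ^ n * uc y ^ 0)"
      by (simp add: power_mult_distrib mult_ac)
  qed
  also have "bint (\<lambda>y. of_real (k\<^sup>2 * (R * R) ^ n) * ((zc y * cnj (zc y)) ^ n * uc y ^ 0)) = of_real (k\<^sup>2 * (R * R) ^ n * N)"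
    unfolding bint_cmult zc_moment_def[symmetric] N by simp
  also have "complex_of_real (R^3) * of_real (k\<^sup>2 * (R * R) ^ n * N) = of_real (k\<^sup>2 * (R ^ (2 * n + 3) * N))"
  proof -
    have "R ^ (2 * n + 3) = (R * R) ^ n * R ^ 3"
      unfolding power_add power_mult by (simp add: power2_eq_square)
    then show ?thesis by simp
  qed
  finally have I: "(LINT x:ball 0 R|lborel. complex_of_real (k\<^sup>2) * (zc x * cnj (zc x)) ^ n) = of_real (k\<^sup>2 * (R ^ (2 * n + 3) * N))" .
  have "L2_inner R (\<lambda>x. quat_of (?w x)) (\<lambda>x. quat_of (?w x)) = k\<^sup>2 * (R ^ (2 * n + 3) * N)"
    by (subst L2_inner_quat_of) (unfold eq, rule int, simp only: I Re_complex_of_real)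
  then show ?thesis by (simp add: L2_norm_def real_sqrt_mult)
qed

lemma scaleR_quat_of: "a *\<^sub>R quat_of w = quat_of (of_real a * w)"
  by (simp add: quat_eq_iff)

lemma coef_quat_of:
  assumes N: "zc_moment n 0 = of_real N"
  shows "L2_inner R (\<lambda>x. quat_of (of_real k * (\<beta> * zc x ^ n))) f = Re (of_real k * cnj \<beta> * (sectoral_coeff n F * of_real (R ^ (2 * n + 3) * N)))"
proof -
  have eq: "(of_real (f x $ 2) - \<i> * of_real (f x $ 3)) * cnj (of_real k * (\<beta> * zc x ^ n)) = (of_real k * cnj \<beta>) * (F x * cnj (zc x) ^ n)" for x
    by (simp add: F_eq mult_ac)
  have int: "set_integrable lborel (ball 0 R) (\<lambda>x. (of_real k * cnj \<beta>) * (F x * cnj (zc x) ^ n))"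
    by (rule set_integrable_mult_right) (rule F_integrable)
  have "L2_inner R (\<lambda>x. quat_of (of_real k * (\<beta> * zc x ^ n))) f = Re (LINT x:ball 0 R|lborel. (of_real k * cnj \<beta>) * (F x * cnj (zc x) ^ n))"
    by (subst L2_inner_quat_of) (unfold eq, rule int, rule refl)
  also have "(LINT x:ball 0 R|lborel. (of_real k * cnj \<beta>) * (F x * cnj (zc x) ^ n)) = (of_real k * cnj \<beta>) * (LINT x:ball 0 R|lborel. F x * cnj (zc x) ^ n)"
    by (rule set_integral_mult_right)
  also have "(LINT x:ball 0 R|lborel. F x * cnj (zc x) ^ n) = sectoral_coeff n F * of_real (R ^ (2 * n + 3) * N)"
    unfolding projection_ball[OF F_harm R F_integrable] N by simp
  finally show ?thesis .
qed

text \<open>The two real Fourier coefficients are multiples of the real and imaginary parts of one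
  complex coefficient, so the pair of normalized basis terms recombines into it. The unknown
  normalization of the Legendre functions cancels.\<close>

lemma hpart_term:
  "coef_a R f (n + 1) n *\<^sub>R Xdag_n R (n + 1) n x + coef_b R f (n + 1) n *\<^sub>R Ydag_n R (n + 1) n x = quat_of (sectoral_coeff n F * zc x ^ n)"
proof -
  obtain k where k: "k \<noteq> 0" "\<And>x. Xdag (Suc n) n x = quat_of (of_real k * zc x ^ n)"
    "\<And>x. Ydag (Suc n) n x = quat_of (of_real k * (- \<i> * zc x ^ n))" by (rule XY_sectoral[of n]) (rule that)
  obtain N where N: "N > 0" "zc_moment n 0 = of_real N" using zc_moment_pos by blast
  define M where "M = R ^ (2 * n + 3) * N"
  have M: "M > 0" using N R by (simp add: M_def)
  \<comment> \<open>Equal to sgn k / sqrt M: the coefficient and the normalized basis function each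
    contribute one factor \<open>\<kappa>\<close>, and \<open>\<kappa>\<close>^2 M = 1 removes
    them.\<close>
  define \<kappa> where "\<kappa> = k / (\<bar>k\<bar> * sqrt M)"
  have \<kappa>: "\<kappa>\<^sup>2 * M = 1" using k M by (simp add: \<kappa>_def power_divide power_mult_distrib)
  have X: "Xdag_n R (Suc n) n = (\<lambda>x. quat_of (of_real \<kappa> * (1 * zc x ^ n)))"
  proof -
    have "L2_norm R (Xdag (Suc n) n) = \<bar>k\<bar> * sqrt M"
      using L2_norm_quat_of[OF N(2), of 1 k] unfolding M_def k(2)[abs_def] by simp
    then show ?thesis unfolding Xdag_n_def k(2) scaleR_quat_of by (simp add: \<kappa>_def)
  qed
  have Y: "Ydag_n R (Suc n) n = (\<lambda>x. quat_of (of_real \<kappa> * (- \<i> * zc x ^ n)))"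
  proof -
    have "L2_norm R (Ydag (Suc n) n) = \<bar>k\<bar> * sqrt M"
      using L2_norm_quat_of[OF N(2), of "- \<i>" k] unfolding M_def k(3)[abs_def] by simp
    then show ?thesis unfolding Ydag_n_def k(3) scaleR_quat_of by (simp add: \<kappa>_def)
  qed
  define \<alpha> where "\<alpha> = sectoral_coeff n F"
  have a: "coef_a R f (Suc n) n = \<kappa> * M * Re \<alpha>"
    unfolding coef_a_def X coef_quat_of[OF N(2)] M_def[symmetric] \<alpha>_def by simp
  have b: "coef_b R f (Suc n) n = - (\<kappa> * M * Im \<alpha>)"
    unfolding coef_b_def Y coef_quat_of[OF N(2)] M_def[symmetric] \<alpha>_def by simp
  have "coef_a R f (Suc n) n *\<^sub>R Xdag_n R (Suc n) n x + coef_b R f (Suc n) n *\<^sub>R Ydag_n R (Suc n) n x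
     = quat_of (of_real (\<kappa>\<^sup>2 * M) * (\<alpha> * zc x ^ n))"
    unfolding a b X Y scaleR_quat_of by (simp add: quat_eq_iff power2_eq_square algebra_simps)
  then show ?thesis by (simp add: \<kappa> \<alpha>_def)
qed

lemma hpart_eq:
  assumes x: "norm x < R" shows "hpart R f x = quat_of (sectoral_sum F (zc x))"
proof -
  have "linear quat_of"
    by (rule linearI) (simp_all add: quat_eq_iff)
  then have "bounded_linear quat_of" by (simp add: linear_conv_bounded_linear)
  moreover have "(\<lambda>n. sectoral_coeff (Suc n) F * zc x ^ Suc n) sums sectoral_sum F (zc x)"
    by (rule sectoral_sum_sums[OF F_harm]) (use norm_zc_le[of x] x in simp)
  ultimately have "(\<lambda>n. quat_of (sectoral_coeff (Suc n) F * zc x ^ Suc n)) sums quat_of (sectoral_sum F (zc x))"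
    by (rule bounded_linear.sums)
  then show ?thesis
    unfolding hpart_def Let_def hpart_term by (rule sums_unique[symmetric])
qed

lemma monogenic_estimate:
  assumes S: "\<And>\<xi>. \<xi> \<in> ball 0 R \<Longrightarrow> \<bar>Sc (f \<xi>)\<bar> \<le> S"
    and A: "\<And>\<xi>. \<xi> \<in> ball 0 R \<Longrightarrow> \<bar>Sc (hpart R f \<xi> \<otimes>q qe1)\<bar> \<le> A"
    and x: "norm x = r" and r: "0 \<le> r" "r < R"
  shows "norm (f x) \<le> norm (f 0) + 2 * r / (R - r)\<^sup>2 * (A1 r R * S + A2 r R * A)"
proof -
  let ?V = "component 1 f"
  define q where "q = r / R"
  have q: "0 \<le> q" "q < 1" "r = q * R" using r R by (auto simp: q_def)
  have VF: "norm (?V x - ?V 0) + norm (F x - F 0 - sectoral_sum F (zc x))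
    \<le> S * (sqrt (2/3) * (2 * q * (3 - q) * (3 - q + q\<^sup>2) / (1 - q)^4))"
    unfolding q_def
  proof (rule riesz_pair_estimate[OF mono_harm[OF mono] F_harm])
    show "partial 2 F y + \<i> * partial 3 F y = partial 1 ?V y" if "y \<in> ball 0 R" for y
      unfolding F_def by (rule mono_dbar(2)[OF mono that])
    show "partial 1 F y = - partial 2 ?V y + \<i> * partial 3 ?V y" if "y \<in> ball 0 R" for y
      unfolding F_def by (rule mono_dbar(3)[OF mono that])
    show "norm (?V y) \<le> S" if "y \<in> ball 0 R" for y
      using S[OF that] by (simp add: component_def Sc_def)
  qed (use x r in simp_all)
  have A0: "A \<ge> 0" using order_trans[OF abs_ge_zero A[of 0]] R by simp
  have zx: "norm (zc x) \<le> r" using norm_zc_le[of x] x by simp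
  \<comment> \<open>Right multiplication by e1 moves the e1-component into the scalar part with a
    minus sign, so \<open>Sc\<close> of it is minus the real part of the power series; evaluating on
    the disc reaches every \<open>w\<close>.\<close>
  have "Re (sectoral_sum F w) \<le> A" if "norm w < R" for w
  proof -
    have "norm (disc_point w) < R" using that by (simp add: norm_disc)
    from A[of "disc_point w"] hpart_eq[OF this] this show ?thesis by (simp add: Sc_def qmult_def)
  qed
  then have "norm (sectoral_sum F (zc x)) * (R - norm (zc x)) \<le> 2 * norm (zc x) * A"
    by (intro borel_caratheodory_zero[OF sectoral_sum_holomorphic[OF F_harm] sectoral_sum_zero R]) (use zx r in auto)
  also have "\<dots> \<le> 2 * r * A" using zx A0 by (intro mult_right_mono) auto
  finally have H1: "norm (sectoral_sum F (zc x)) * (R - norm (zc x)) \<le> 2 * r * A" .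
  have "norm (sectoral_sum F (zc x)) * (R - r) \<le> norm (sectoral_sum F (zc x)) * (R - norm (zc x))"
    using zx by (intro mult_left_mono) auto
  with H1 have "norm (sectoral_sum F (zc x)) * (R - r) \<le> 2 * r * A" by simp
  then have "norm (sectoral_sum F (zc x)) \<le> 2 * r * A / (R - r)" using r by (simp add: pos_le_divide_eq)
  also have "\<dots> = 2 * r / (R - r)\<^sup>2 * ((R - r) * A)"
    using r by (simp add: power2_eq_square)
  \<comment> \<open>Borel-Caratheodory yields the factor R - r, which is at most 2 (2R - r).\<close>
  also have "\<dots> \<le> 2 * r / (R - r)\<^sup>2 * (A2 r R * A)"
    using r A0 R by (intro mult_left_mono mult_right_mono) (auto simp: A2_def)
  finally have H: "norm (sectoral_sum F (zc x)) \<le> 2 * r / (R - r)\<^sup>2 * (A2 r R * A)" .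
  \<comment> \<open>Of the four powers of 1 - q in the summed series, two go into the common factor
    2r / (R - r)^2 and two remain in the denominator of \<open>A1\<close>.\<close>
  have e: "S * (sqrt (2/3) * (2 * q * (3 - q) * (3 - q + q\<^sup>2) / (1 - q)^4)) = 2 * r / (R - r)\<^sup>2 * (A1 r R * S)"
  proof -
    have 1: "R - r = R * (1 - q)" "3 * R - r = R * (3 - q)" "3 * R\<^sup>2 - R * r + r\<^sup>2 = R\<^sup>2 * (3 - q + q\<^sup>2)"
      unfolding q(3) by (simp_all add: power2_eq_square algebra_simps)
    have gen: "s * (c * (2 * q * u * v / t^4)) = 2 * (q * R) / (R * t)\<^sup>2 * (c * ((R * u) * (R\<^sup>2 * v)) / (R * t)\<^sup>2 * s)"
      if "t \<noteq> 0" for s c u v t :: real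
      using R that by (simp add: power_mult_distrib power2_eq_square power4_eq_xxxx field_simps)
    show ?thesis unfolding A1_def 1 unfolding q(3) by (rule gen) (use q in simp)
  qed
  have "norm (f x - f 0) \<le> norm (?V x - ?V 0) + norm (F x - F 0)"
  proof (rule power2_le_imp_le)
    have f4: "f x $ 4 = 0" "f 0 $ 4 = 0"
      using mono x r R by (auto simp: monogenic_on_ball_def in_A_def)
    have "(norm (f x - f 0))\<^sup>2 = (norm (?V x - ?V 0))\<^sup>2 + (norm (F x - F 0))\<^sup>2"
      unfolding power2_norm_eq_inner[of "f x - f 0"] cmod_power2 F_eq component_def
      by (simp add: inner_vec_def sum_4 f4 power2_eq_square algebra_simps)
    then show "(norm (f x - f 0))\<^sup>2 \<le> (norm (?V x - ?V 0) + norm (F x - F 0))\<^sup>2"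
      by (simp add: power2_sum)
  qed simp
  moreover have "norm (F x - F 0) \<le> norm (F x - F 0 - sectoral_sum F (zc x)) + norm (sectoral_sum F (zc x))"
    by (metis diff_add_cancel norm_triangle_ineq)
  moreover have "norm (f x) \<le> norm (f 0) + norm (f x - f 0)"
    by (metis norm_triangle_sub)
  ultimately show ?thesis using VF H unfolding e by (simp add: distrib_left)
qed

end

text \<open>The suprema are taken in \<open>ereal\<close>, so an unbounded scalar part gives
  \<infinity> and a trivially valid bound instead of an arbitrary real value.\<close>

theorem theorem2:
  fixes R r :: real and f :: "real^3 \<Rightarrow> quat"
  assumes "R > 0"
    and "in_L2_ball R f"
    and "monogenic_on_ball R f"
    and "0 \<le> r" and "r < R"
  shows "ereal (maxmod f r) \<le>
     ereal (norm (f 0)) + ereal (2 * r / (R - r)\<^sup>2) *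
       (ereal (A1 r R) * (SUP \<xi>\<in>ball 0 R. ereal \<bar>Sc (f \<xi>)\<bar>)
        + ereal (A2 r R) * (SUP \<xi>\<in>ball 0 R. ereal \<bar>Sc (hpart R f \<xi> \<otimes>q qe1)\<bar>))"
proof (cases "r = 0")
  case True
  \<comment> \<open>At radius 0 the common factor is 0, and 0 times \<infinity> is 0 in
    \<open>ereal\<close>, so both sides reduce to |f(0)|.\<close>
  then show ?thesis by (simp add: maxmod_def zero_ereal_def[symmetric])
next
  case False
  then have r: "r > 0" using assms by simp
  define SS where "SS = (SUP \<xi>\<in>ball 0 R. ereal \<bar>Sc (f \<xi>)\<bar>)"
  define AA where "AA = (SUP \<xi>\<in>ball 0 R. ereal \<bar>Sc (hpart R f \<xi> \<otimes>q qe1)\<bar>)"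
  have z: "(0::real^3) \<in> ball 0 R" using assms by simp
  have SS0: "SS \<ge> 0" unfolding SS_def by (rule SUP_upper2[OF z]) simp
  have AA0: "AA \<ge> 0" unfolding AA_def by (rule SUP_upper2[OF z]) simp
  have c: "2 * r / (R - r)\<^sup>2 > 0" using r assms by simp
  have A1: "A1 r R > 0"
  proof -
    have "R * r \<le> R\<^sup>2" using assms r by (simp add: power2_eq_square)
    then have "3 * R\<^sup>2 - R * r + r\<^sup>2 > 0" using assms by (smt (verit) zero_less_power zero_le_power2)
    then show ?thesis using assms by (simp add: A1_def)
  qed
  have A2: "A2 r R > 0" using assms by (simp add: A2_def)
  show ?thesis
  proof (cases "SS = \<infinity> \<or> AA = \<infinity>")
    case True
    \<comment> \<open>A positive factor keeps an infinite supremum infinite, and nonnegativity of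
      the other summand excludes \<infinity> - \<infinity>.\<close>
    then have inf: "ereal (A1 r R) * SS + ereal (A2 r R) * AA = \<infinity>"
    proof
      assume "SS = \<infinity>"
      then show ?thesis using A1 A2 AA0 by (cases AA) auto
    next
      assume "AA = \<infinity>"
      then show ?thesis using A1 A2 SS0 by (cases SS) auto
    qed
    show ?thesis unfolding SS_def[symmetric] AA_def[symmetric] inf using c r assms(5) by simp
  next
    case False
    then obtain S A where SA: "SS = ereal S" "AA = ereal A"
      using SS0 AA0 by (cases SS; cases AA) auto
    have S: "\<bar>Sc (f \<xi>)\<bar> \<le> S" if "\<xi> \<in> ball 0 R" for \<xi>
      using SUP_upper[OF that, of "\<lambda>\<xi>. ereal \<bar>Sc (f \<xi>)\<bar>"] SA by (simp add: SS_def)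
    have A: "\<bar>Sc (hpart R f \<xi> \<otimes>q qe1)\<bar> \<le> A" if "\<xi> \<in> ball 0 R" for \<xi>
      using SUP_upper[OF that, of "\<lambda>\<xi>. ereal \<bar>Sc (hpart R f \<xi> \<otimes>q qe1)\<bar>"] SA by (simp add: AA_def)
    have "maxmod f r \<le> norm (f 0) + 2 * r / (R - r)\<^sup>2 * (A1 r R * S + A2 r R * A)"
      unfolding maxmod_def
    proof (rule cSUP_least)
      have "r *\<^sub>R axis 1 1 \<in> sphere (0::real^3) r" using r by (simp add: norm_axis_1)
      then show "sphere (0::real^3) r \<noteq> {}" by blast
      show "norm (f x) \<le> norm (f 0) + 2 * r / (R - r)\<^sup>2 * (A1 r R * S + A2 r R * A)" if "x \<in> sphere 0 r" for x
        by (rule monogenic_estimate[OF assms(1-3) S A _ assms(4,5)]) (use that in auto)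
    qed
    then show ?thesis unfolding SS_def[symmetric] AA_def[symmetric] SA by simp
  qed
qed

end
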